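(* Let $L>0$ and assume that $m=n^p$ for some $0<p\le 1/2$ and that $m\ge 5\log n$. Then for arbitrary $0<s_1<s_2<\frac{1}{4p}-\frac12$ there exists a distributed estimator $\hat f$, transmitting $\hat B^{(i)}$ bits from the local machines $i=1,\dots,m$, such that $\hat B^{(i)}\le n^{\frac{1}{1+2s_1}}\log n$ for all $i$, $$\max_{i=1,\dots,m}\ \sup_{s\in[s_1,s_2]}\ \sup_{f_0\in B^{s}_{2,\infty}(L)}\frac{E^{(i)}_{f_0}\hat B^{(i)}}{n^{1/(1+2s)}\log n}\lesssim 1$$ and $$\sup_{s\in[s_1,s_2]}\ \sup_{f_0\in B^{s}_{2,\infty}(L)}\frac{E_{f_0}\|\hat f-f_0\|_2^2}{n^{-2s/(1+2s)}}\lesssim 1.$$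
   Context: Model (distributed Gaussian white noise): there are $m=m_n$ machines; machine $i\in\{1,\dots,m\}$ observes the process $X^{(i)}$ with $dX^{(i)}_t=f_0(t)\,dt+\sqrt{m/n}\,dW^{(i)}_t$, $t\in[0,1]$, where $W^{(1)},\dots,W^{(m)}$ are independent standard Wiener processes and $f_0\in L_2[0,1]$ is unknown. $E_{f_0}$ denotes expectation under the joint law of all data (and any randomization), $E^{(i)}_{f_0}$ expectation under the law of $X^{(i)}$ (and the local randomization of machine $i$). When $m=n^p$, $n^p$ is understood as rounded to an integer if necessary. Distributed estimator: independently of each other, each machine $i$ produces from its own data $X^{(i)}$ (possibly with additional local randomization independent of everything else) a random finite binary string $Y^{(i)}$ of length $\hat B^{(i)}$ (number of transmitted bits), and $\hat f$ is a measurable function of $(Y^{(1)},\dots,Y^{(m)})$ only. Statements concern sequences of such procedures indexed by $n$; the procedure may depend on $s_1,s_2$ but not on the particular $s\in[s_1,s_2]$. Besov balls: let $\{\psi_{jk}: j\ge 0,\ 1\le k\le 2^j\}$ be a compactly supported orthonormal $N$-regular Cohen–Daubechies–Vial wavelet basis of $L_2[0,1]$, with $N$ larger than all regularities considered, and $f_{jk}=\langle f,\psi_{jk}\rangle$. Then $\|f\|^2_{B^s_{2,\infty}}=\sup_{j\ge 0}2^{2js}\sum_{k=1}^{2^j}f_{jk}^2$ and $B^s_{2,\infty}(L)=\{f\in L_2[0,1]:\|f\|_{B^s_{2,\infty}}<L\}$. $\log$ is the base-2 logarithm. $a_n\lesssim b_n$ means $a_n\le C b_n$ for all sufficiently large $n$,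 with $C>0$ not depending on $n$, $i$, $f_0$ or $s\in[s_1,s_2]$ (it may depend on fixed parameters such as $s_1,s_2,L,p$). *)

theory Defs
  imports "HOL-Probability.Probability"
begin

definition L2_unit :: "(real \<Rightarrow> real) set" where
  "L2_unit = {f. f \<in> borel_measurable (lebesgue_on {0..1})
                \<and> integrable (lebesgue_on {0..1}) (\<lambda>x. (f x)\<^sup>2)}"

definition inner_unit :: "(real \<Rightarrow> real) \<Rightarrow> (real \<Rightarrow> real) \<Rightarrow> real" where
  "inner_unit f g = (\<integral>x. f x * g x \<partial>lebesgue_on {0..1})"

text \<open>Extended-real valued, so that it is infinite for functions that are not square integrable.\<close>

definition L2_sqnorm :: "(real \<Rightarrow> real) \<Rightarrow> ennreal" where
  "L2_sqnorm f = (\<integral>\<^sup>+x. ennreal ((f x)\<^sup>2) \<partial>lebesgue_on {0..1})"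


definition wavelet_index :: "(nat \<times> nat) set" where
  "wavelet_index = {(j, k). k \<in> {1..2^j}}"

definition orthonormal_wavelet_basis :: "(nat \<Rightarrow> nat \<Rightarrow> real \<Rightarrow> real) \<Rightarrow> bool" where
  "orthonormal_wavelet_basis \<psi> \<longleftrightarrow>
     (\<forall>(j, k)\<in>wavelet_index. \<psi> j k \<in> L2_unit) \<and>
     (\<forall>(j, k)\<in>wavelet_index. \<forall>(j', k')\<in>wavelet_index.
        inner_unit (\<psi> j k) (\<psi> j' k') = (if j = j' \<and> k = k' then 1 else 0)) \<and>
     (\<forall>f\<in>L2_unit.
        (\<lambda>J. L2_sqnorm (\<lambda>x. f x - (\<Sum>j<J. \<Sum>k=1..2^j. inner_unit f (\<psi> j k) * \<psi> j k x)))
          \<longlonglongrightarrow> 0)"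

text \<open>Daubechies father and mother wavelets with \<open>N\<close> vanishing moments, translated so that both are
  supported in \<open>[-N+1, N]\<close>; the scaling filter \<open>h\<close> has length \<open>2N\<close>. All filters with these
  properties (extremal phase, least asymmetric, ...) are admitted.\<close>

definition daubechies_pair :: "nat \<Rightarrow> (real \<Rightarrow> real) \<Rightarrow> (real \<Rightarrow> real) \<Rightarrow> bool" where
  "daubechies_pair N \<phi> \<theta> \<longleftrightarrow>
     N \<ge> 1 \<and>
     \<phi> \<in> borel_measurable lebesgue \<and> integrable lebesgue (\<lambda>x. (\<phi> x)\<^sup>2) \<and>
     (\<forall>x. x \<notin> {1 - real N..real N} \<longrightarrow> \<phi> x = 0) \<and>
     (\<integral>x. \<phi> x \<partial>lebesgue) = 1 \<and>
     (\<forall>k::int. (\<integral>x. \<phi> x * \<phi> (x - of_int k) \<partial>lebesgue) = (if k = 0 then 1 else 0)) \<and>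
     (\<exists>h::int \<Rightarrow> real.
        (AE x in lebesgue. \<phi> x = sqrt 2 * (\<Sum>k=1 - int N..int N. h k * \<phi> (2 * x - of_int k))) \<and>
        (AE x in lebesgue. \<theta> x =
           sqrt 2 * (\<Sum>k=1 - int N..int N. (-1) powi k * h (1 - k) * \<phi> (2 * x - of_int k)))) \<and>
     (\<forall>l<N. (\<integral>x. x ^ l * \<theta> x \<partial>lebesgue) = 0)"

text \<open>The boundary functions of Cohen, Daubechies and Vial, at unit scale: the left ones live on
  \<open>[0, \<infinity>)\<close>, the right ones on \<open>(-\<infinity>, 0]\<close>. The boundary scaling functions
  combine the restrictions of those translates of \<open>\<phi>\<close> that meet the boundary layer, with weights
  polynomial in the translation parameter, so that polynomials of degree below \<open>N\<close> are reproduced.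
  The boundary wavelets combine scaling functions of the next finer scale. The coefficients are
  fixed, up to a rotation inside each block, by the orthonormality required in
  \<open>cdv_wavelet_basis\<close>.\<close>

definition cdv_boundary ::
  "nat \<Rightarrow> (real \<Rightarrow> real) \<Rightarrow> (nat \<Rightarrow> real \<Rightarrow> real) \<Rightarrow> (nat \<Rightarrow> real \<Rightarrow> real)
     \<Rightarrow> (nat \<Rightarrow> real \<Rightarrow> real) \<Rightarrow> (nat \<Rightarrow> real \<Rightarrow> real) \<Rightarrow> bool" where
  "cdv_boundary N \<phi> \<phi>L \<phi>R \<theta>L \<theta>R \<longleftrightarrow>
     (\<forall>l<N. \<exists>a::nat \<Rightarrow> real. \<forall>x\<ge>0.
        \<phi>L l x = (\<Sum>q<N. a q * (\<Sum>i=1 - int N..int N - 1. of_int i ^ q * \<phi> (x - of_int i)))) \<and>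
     (\<forall>l<N. \<exists>a::nat \<Rightarrow> real. \<forall>x\<le>0.
        \<phi>R l x = (\<Sum>q<N. a q * (\<Sum>i=- int N..int N - 2. of_int i ^ q * \<phi> (x - of_int i)))) \<and>
     (\<forall>l<N. \<exists>(a::nat \<Rightarrow> real) (b::int \<Rightarrow> real). \<forall>x\<ge>0.
        \<theta>L l x = (\<Sum>q<N. a q * \<phi>L q (2 * x))
                 + (\<Sum>i=int N..3 * int N - 2. b i * \<phi> (2 * x - of_int i))) \<and>
     (\<forall>l<N. \<exists>(a::nat \<Rightarrow> real) (b::int \<Rightarrow> real). \<forall>x\<le>0.
        \<theta>R l x = (\<Sum>q<N. a q * \<phi>R q (2 * x))
                 + (\<Sum>i=1 - 3 * int N..- int N - 1. b i * \<phi> (2 * x - of_int i)))"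

text \<open>The \<open>k\<close>-th function of level \<open>j\<close>, \<open>1 \<le> k \<le> 2^j\<close>: \<open>N\<close> left boundary
  functions, \<open>2^j - 2N\<close> dilated translates of \<open>u\<close>, \<open>N\<close> right boundary functions.\<close>

definition cdv_layer ::
  "nat \<Rightarrow> (real \<Rightarrow> real) \<Rightarrow> (nat \<Rightarrow> real \<Rightarrow> real) \<Rightarrow> (nat \<Rightarrow> real \<Rightarrow> real)
     \<Rightarrow> nat \<Rightarrow> nat \<Rightarrow> real \<Rightarrow> real" where
  "cdv_layer N u uL uR j k x = 2 powr (real j / 2) *
     (if k \<le> N then uL (k - 1) (2^j * x)
      else if k \<le> 2^j - N then u (2^j * x - real (k - 1))
      else uR (2^j - k) (2^j * (x - 1)))"

text \<open>With coarsest level \<open>J\<close>, the Cohen--Daubechies--Vial basis consists of \<open>2^J\<close> scaling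
  functions and of \<open>2^j\<close> wavelets for every \<open>j \<ge> J\<close>. Hence an enumeration of
  it by the pairs \<open>(j, k)\<close> with \<open>j \<ge> 0\<close> and \<open>1 \<le> k \<le> 2^j\<close> cannot keep all
  the original levels (the levels below \<open>J\<close> have only \<open>2^J - 1\<close> places). Every enumeration
  \<open>\<tau>\<close> that moves levels by a bounded amount \<open>c\<close> is admitted; this changes Besov norms only up
  to equivalence.\<close>

definition cdv_wavelet_basis :: "nat \<Rightarrow> (nat \<Rightarrow> nat \<Rightarrow> real \<Rightarrow> real) \<Rightarrow> bool" where
  "cdv_wavelet_basis N \<psi> \<longleftrightarrow>
     orthonormal_wavelet_basis \<psi> \<and>
     (\<exists>\<phi> \<theta> \<phi>L \<phi>R \<theta>L \<theta>R (J::nat) (c::nat) (\<tau> :: nat \<times> nat \<Rightarrow> nat + nat \<times> nat).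
        daubechies_pair N \<phi> \<theta> \<and> cdv_boundary N \<phi> \<phi>L \<phi>R \<theta>L \<theta>R \<and> 2 * N \<le> 2^J \<and>
        bij_betw \<tau> wavelet_index ({1..2^J} <+> {(j, k)\<in>wavelet_index. J \<le> j}) \<and>
        (\<forall>(j, k)\<in>wavelet_index.
           (case \<tau> (j, k) of
              Inl k' \<Rightarrow> \<bar>int j - int J\<bar> \<le> int c \<and>
                (AE x in lebesgue_on {0..1}. \<psi> j k x = cdv_layer N \<phi> \<phi>L \<phi>R J k' x)
            | Inr (j', k') \<Rightarrow> \<bar>int j - int j'\<bar> \<le> int c \<and>
                (AE x in lebesgue_on {0..1}. \<psi> j k x = cdv_layer N \<theta> \<theta>L \<theta>R j' k' x))))"

definition besov_sqnorm :: "(nat \<Rightarrow> nat \<Rightarrow> real \<Rightarrow> real) \<Rightarrow> real \<Rightarrow> (real \<Rightarrow> real) \<Rightarrow> ennreal" where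
  "besov_sqnorm \<psi> s f =
     (SUP j. ennreal (2 powr (2 * real j * s) * (\<Sum>k=1..2^j. (inner_unit f (\<psi> j k))\<^sup>2)))"

definition besov_ball :: "(nat \<Rightarrow> nat \<Rightarrow> real \<Rightarrow> real) \<Rightarrow> real \<Rightarrow> real \<Rightarrow> (real \<Rightarrow> real) set" where
  "besov_ball \<psi> s L = {f \<in> L2_unit. besov_sqnorm \<psi> s f < ennreal (L\<^sup>2)}"


definition standard_wiener :: "'w measure \<Rightarrow> (real \<Rightarrow> 'w \<Rightarrow> real) \<Rightarrow> bool" where
  "standard_wiener M W \<longleftrightarrow>
     prob_space M \<and>
     (\<forall>t\<in>{0..1}. W t \<in> borel_measurable M) \<and>
     (AE \<omega> in M. W 0 \<omega> = 0) \<and>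
     (\<forall>s t. 0 \<le> s \<and> s < t \<and> t \<le> 1 \<longrightarrow>
        distributed M lborel (\<lambda>\<omega>. W t \<omega> - W s \<omega>) (\<lambda>x. ennreal (normal_density 0 (sqrt (t - s)) x))) \<and>
     (\<forall>(r::nat) (t::nat \<Rightarrow> real).
        (\<forall>k\<le>r. t k \<in> {0..1}) \<and> (\<forall>k<r. t k \<le> t (Suc k)) \<longrightarrow>
        prob_space.indep_vars M (\<lambda>_. borel) (\<lambda>k \<omega>. W (t (Suc k)) \<omega> - W (t k) \<omega>) {..<r}) \<and>
     (AE \<omega> in M. continuous_on {0..1} (\<lambda>t. W t \<omega>))"

definition path_space :: "(real \<Rightarrow> real) measure" where
  "path_space = Pi\<^sub>M {0..1} (\<lambda>_. borel)"

text \<open>What a machine sees: the path of its observed process and a private random seed.\<close>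

definition data_space :: "((real \<Rightarrow> real) \<times> real) measure" where
  "data_space = path_space \<Otimes>\<^sub>M borel"

text \<open>\<open>W i\<close> is the noise of machine \<open>i\<close> and \<open>U i\<close> its seed. The seeds are uniform on \<open>[0, 1]\<close>;
  since messages take countably many values, every Markov kernel from paths to messages can be
  realised with such a seed. The last two conditions together say that all the \<open>W i\<close> and \<open>U i\<close>
  are independent.\<close>

definition white_noise_model ::
  "nat \<Rightarrow> 'w measure \<Rightarrow> (nat \<Rightarrow> real \<Rightarrow> 'w \<Rightarrow> real) \<Rightarrow> (nat \<Rightarrow> 'w \<Rightarrow> real) \<Rightarrow> bool" where
  "white_noise_model m M W U \<longleftrightarrow>
     prob_space M \<and>
     (\<forall>i\<in>{1..m}. standard_wiener M (W i)) \<and>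
     (\<forall>i\<in>{1..m}. distributed M lborel (U i) (indicator {0..1})) \<and>
     (\<forall>i\<in>{1..m}. prob_space.indep_set M
        {(\<lambda>\<omega>. \<lambda>t\<in>{0..1}. W i t \<omega>) -` A \<inter> space M | A. A \<in> sets path_space}
        {U i -` B \<inter> space M | B. B \<in> sets borel}) \<and>
     prob_space.indep_vars M (\<lambda>_. data_space)
        (\<lambda>i \<omega>. (\<lambda>t\<in>{0..1}. W i t \<omega>, U i \<omega>)) {1..m}"

text \<open>The path on \<open>[0, 1]\<close> of \<open>dX = f dt + sqrt (m/n) dW\<close>, \<open>X 0 = 0\<close>.\<close>

definition observed_path ::
  "nat \<Rightarrow> nat \<Rightarrow> (real \<Rightarrow> real) \<Rightarrow> (real \<Rightarrow> 'w \<Rightarrow> real) \<Rightarrow> 'w \<Rightarrow> real \<Rightarrow> real" where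
  "observed_path m n f W \<omega> =
     (\<lambda>t\<in>{0..1}. (\<integral>u. f u \<partial>lebesgue_on {0..t}) + sqrt (real m / real n) * W t \<omega>)"

text \<open>\<open>enc i\<close> maps the data of machine \<open>i\<close> to its message, \<open>dec\<close> maps the tuple of messages to
  the estimate. There are only countably many tuples of messages, so \<open>dec\<close> is automatically
  measurable.\<close>

definition distributed_estimator ::
  "nat \<Rightarrow> (nat \<Rightarrow> (real \<Rightarrow> real) \<times> real \<Rightarrow> bool list)
     \<Rightarrow> ((nat \<Rightarrow> bool list) \<Rightarrow> real \<Rightarrow> real) \<Rightarrow> bool" where
  "distributed_estimator m enc dec \<longleftrightarrow>
     (\<forall>i\<in>{1..m}. enc i \<in> data_space \<rightarrow>\<^sub>M count_space UNIV) \<and> (\<forall>y. dec y \<in> L2_unit)"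

definition message ::
  "nat \<Rightarrow> nat \<Rightarrow> (nat \<Rightarrow> (real \<Rightarrow> real) \<times> real \<Rightarrow> bool list) \<Rightarrow> (real \<Rightarrow> real)
     \<Rightarrow> (nat \<Rightarrow> real \<Rightarrow> 'w \<Rightarrow> real) \<Rightarrow> (nat \<Rightarrow> 'w \<Rightarrow> real) \<Rightarrow> nat \<Rightarrow> 'w \<Rightarrow> bool list" where
  "message m n enc f W U i \<omega> = enc i (observed_path m n f (W i) \<omega>, U i \<omega>)"

definition expected_bits ::
  "nat \<Rightarrow> nat \<Rightarrow> (nat \<Rightarrow> (real \<Rightarrow> real) \<times> real \<Rightarrow> bool list) \<Rightarrow> (real \<Rightarrow> real)
     \<Rightarrow> 'w measure \<Rightarrow> (nat \<Rightarrow> real \<Rightarrow> 'w \<Rightarrow> real) \<Rightarrow> (nat \<Rightarrow> 'w \<Rightarrow> real) \<Rightarrow> nat \<Rightarrow> ennreal" where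
  "expected_bits m n enc f M W U i =
     (\<integral>\<^sup>+\<omega>. ennreal (real (length (message m n enc f W U i \<omega>))) \<partial>M)"

definition risk ::
  "nat \<Rightarrow> nat \<Rightarrow> (nat \<Rightarrow> (real \<Rightarrow> real) \<times> real \<Rightarrow> bool list)
     \<Rightarrow> ((nat \<Rightarrow> bool list) \<Rightarrow> real \<Rightarrow> real) \<Rightarrow> (real \<Rightarrow> real)
     \<Rightarrow> 'w measure \<Rightarrow> (nat \<Rightarrow> real \<Rightarrow> 'w \<Rightarrow> real) \<Rightarrow> (nat \<Rightarrow> 'w \<Rightarrow> real) \<Rightarrow> ennreal" where
  "risk m n enc dec f M W U =
     (\<integral>\<^sup>+\<omega>. L2_sqnorm (\<lambda>x. dec (\<lambda>i\<in>{1..m}. message m n enc f W U i \<omega>) x - f x) \<partial>M)"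

end

theory Submission
  imports Defs "HOL-Real_Asymp.Real_Asymp"
begin

text \<open>Every machine decides on its own, level by level, whether to transmit: at level \<open>j\<close> it compares the
  debiased energy \<open>\<Sum>\<^sub>k X\<^sub>j\<^sub>k\<^sup>2 - 2\<^sup>j m/n\<close> of its noisy coefficients with \<open>\<tau> 2\<^sup>j / n\<close> and, if the test is passed,
  sends all \<open>2\<^sup>j\<close> coefficients with \<open>O(log n)\<close> bits each. The central machine averages what it receives,
  reading a missing level as zero. The local noise level \<open>m/n\<close> makes the energy fluctuate by
  \<open>2^(j/2) m/n\<close>, so by Chebyshev's inequality the false alarm probability is \<open>O(m\<^sup>2 / 2\<^sup>j)\<close> and a false alarm costs
  \<open>O(m\<^sup>2)\<close> coefficients in expectation. Likewise a missed detection and a false alarm each cost \<open>O(m\<^sup>2/n)\<close> in risk,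
  and the bias caused by averaging only noise that has passed the test is \<open>O(m/n)\<close> per level. Since
  \<open>s\<^sub>2 < 1/(4p) - 1/2\<close>, the total \<open>m\<^sup>2 log n\<close> over all levels is below the critical dimension
  \<open>n powr (1 / (1 + 2s))\<close>, for every \<open>s \<le> s\<^sub>2\<close>. Only the orthonormality and completeness of the
  wavelets enter; they are replaced by step functions, for which the Wiener integral is a finite sum of
  increments of the path.\<close>

section \<open>Square integrable functions\<close>

text \<open>Two dependences shape the argument. First, a machine tests the very data that it sends,
  so the noise that survives the test is neither centred nor independent of the decision. Averaging
  over machines reduces its variance but not its mean. The means E[D \<xi>_k] are the coefficients
  of the bounded variable D (the 0/1 outcome of the test) with respect to the noise variables, and a
  Bessel inequality bounds their sum of squares by a constant that does not grow with 2^j; this is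
  where the bias m/n per level comes from. Second, step functions are only nearly orthonormal, so
  the noise variables within a level are correlated. Independence inside a level is therefore
  replaced by two properties of all linear combinations of the noise: an operator bound for the
  covariance, with constant 4, and the Gaussian identity between fourth and second moments. By
  Isserlis and Bessel they still give an energy variance linear in 2^j, as for independent
  coefficients. The bound on s2 enters as 2p < 1/(1+2 s2): m^2 lies below the smallest critical
  dimension by a power of n, and that power absorbs the logarithmic number of levels.\<close>

definition square_integrable :: "'a measure \<Rightarrow> ('a \<Rightarrow> real) set" where
  "square_integrable M = {f \<in> borel_measurable M. integrable M (\<lambda>x. (f x)\<^sup>2)}"

lemma square_integrable_meas: "f \<in> square_integrable M \<Longrightarrow> f \<in> borel_measurable M"
  and square_integrable_int: "f \<in> square_integrable M \<Longrightarrow> integrable M (\<lambda>x. (f x)\<^sup>2)"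
  by (auto simp: square_integrable_def)

lemma square_integrable_mult:
  assumes "f \<in> square_integrable M" "g \<in> square_integrable M"
  shows "integrable M (\<lambda>x. f x * g x)"
proof (rule Bochner_Integration.integrable_bound)
  show "integrable M (\<lambda>x. (f x)\<^sup>2 + (g x)\<^sup>2)"
    using assms by (auto simp: square_integrable_def)
  show "(\<lambda>x. f x * g x) \<in> borel_measurable M"
    using assms by (auto simp: square_integrable_def)
  have "\<bar>f x * g x\<bar> \<le> (f x)\<^sup>2 + (g x)\<^sup>2" for x
  proof -
    have "2 * (\<bar>f x\<bar> * \<bar>g x\<bar>) \<le> (f x)\<^sup>2 + (g x)\<^sup>2"
      using sum_squares_bound[of "\<bar>f x\<bar>" "\<bar>g x\<bar>"] by simp
    moreover have "0 \<le> \<bar>f x\<bar> * \<bar>g x\<bar>" by simp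
    ultimately show ?thesis unfolding abs_mult by linarith
  qed
  then show "AE x in M. norm (f x * g x) \<le> norm ((f x)\<^sup>2 + (g x)\<^sup>2)"
    by (auto intro!: AE_I2)
qed

lemma square_integrable_cmult:
  assumes "f \<in> square_integrable M"
  shows "(\<lambda>x. c * f x) \<in> square_integrable M"
  using assms by (auto simp: square_integrable_def power_mult_distrib)

lemma square_integrable_add:
  assumes "f \<in> square_integrable M" "g \<in> square_integrable M"
  shows "(\<lambda>x. f x + g x) \<in> square_integrable M"
proof -
  have "integrable M (\<lambda>x. (f x)\<^sup>2 + (g x)\<^sup>2 + 2 * (f x * g x))"
    using assms square_integrable_mult[OF assms] by (auto simp: square_integrable_def)
  then show ?thesis
    using assms by (auto simp: square_integrable_def power2_sum mult.assoc)
qed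

lemma square_integrable_zero: "(\<lambda>x. 0) \<in> square_integrable M"
  by (simp add: square_integrable_def)

lemma square_integrable_sum:
  assumes "\<And>i. i \<in> I \<Longrightarrow> f i \<in> square_integrable M"
  shows "(\<lambda>x. \<Sum>i\<in>I. f i x) \<in> square_integrable M"
  using assms by (induction I rule: infinite_finite_induct)
    (auto intro: square_integrable_zero square_integrable_add)

lemma square_integrable_diff:
  assumes "f \<in> square_integrable M" "g \<in> square_integrable M"
  shows "(\<lambda>x. f x - g x) \<in> square_integrable M"
  using square_integrable_add[OF assms(1) square_integrable_cmult[OF assms(2), of "-1"]] by simp

lemma square_integrable_bound:
  assumes "f \<in> square_integrable M" "g \<in> borel_measurable M" "\<And>x. x \<in> space M \<Longrightarrow> \<bar>g x\<bar> \<le> \<bar>f x\<bar>"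
  shows "g \<in> square_integrable M"
proof -
  have "integrable M (\<lambda>x. (g x)\<^sup>2)"
    by (rule Bochner_Integration.integrable_bound[of M "\<lambda>x. (f x)\<^sup>2"])
      (use assms in \<open>auto simp: square_integrable_def abs_le_square_iff intro!: AE_I2\<close>)
  then show ?thesis using assms by (auto simp: square_integrable_def)
qed

lemma square_integrable_integrable:
  assumes "finite_measure M" "f \<in> square_integrable M"
  shows "integrable M f"
proof -
  interpret finite_measure M by fact
  have "(\<lambda>x. 1) \<in> square_integrable M"
    by (simp add: square_integrable_def)
  from square_integrable_mult[OF assms(2) this] show ?thesis by simp
qed

text \<open>The quadratic polynomial t -> integral of (f + t g)^2 is nonnegative; evaluate it at its
  minimizer. If g has norm zero it degenerates to an affine function, whose slope must then
  vanish.\<close>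

lemma Cauchy_Schwarz_integral:
  assumes "f \<in> square_integrable M" "g \<in> square_integrable M"
  shows "(\<integral>x. f x * g x \<partial>M)\<^sup>2 \<le> (\<integral>x. (f x)\<^sup>2 \<partial>M) * (\<integral>x. (g x)\<^sup>2 \<partial>M)"
proof -
  let ?a = "\<integral>x. (f x)\<^sup>2 \<partial>M" and ?b = "\<integral>x. f x * g x \<partial>M" and ?c = "\<integral>x. (g x)\<^sup>2 \<partial>M"
  note [simp] = square_integrable_mult[OF assms] square_integrable_int[OF assms(1)]
    square_integrable_int[OF assms(2)]
  have pos: "0 \<le> ?a + 2 * t * ?b + t\<^sup>2 * ?c" for t
  proof -
    have "0 \<le> (\<integral>x. (f x + t * g x)\<^sup>2 \<partial>M)" by simp
    also have "(\<lambda>x. (f x + t * g x)\<^sup>2) = (\<lambda>x. (f x)\<^sup>2 + 2 * t * (f x * g x) + t\<^sup>2 * (g x)\<^sup>2)"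
      by (auto simp: power2_eq_square algebra_simps)
    finally show ?thesis by simp
  qed
  have c: "?c \<ge> 0" by simp
  show ?thesis
  proof (cases "?c = 0")
    case True
    have "?b = 0"
    proof (rule ccontr)
      assume "?b \<noteq> 0"
      \<comment> \<open>At this t the affine function \<open>?a + 2 * t * ?b\<close> takes the value
        -1.\<close>
      then have "2 * (- (?a + 1) / (2 * ?b)) * ?b = - (?a + 1)" by simp
      then show False using pos[of "- (?a + 1) / (2 * ?b)"] True by simp
    qed
    then show ?thesis using True by simp
  next
    case False
    then have "0 \<le> ?a - ?b\<^sup>2 / ?c"
      using pos[of "- ?b / ?c"] by (simp add: power2_eq_square field_simps)
    then show ?thesis using c False by (simp add: field_simps)
  qed
qed

lemma integral_sum_sq:
  assumes "\<And>k. k \<in> S \<Longrightarrow> f k \<in> square_integrable M"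
  shows "(\<integral>x. (\<Sum>k\<in>S. u k * f k x)\<^sup>2 \<partial>M) = (\<Sum>k\<in>S. \<Sum>l\<in>S. u k * u l * (\<integral>x. f k x * f l x \<partial>M))"
proof -
  have [simp]: "k \<in> S \<Longrightarrow> l \<in> S \<Longrightarrow> integrable M (\<lambda>x. f k x * f l x)" for k l
    by (intro square_integrable_mult assms)
  have "(\<lambda>x. (\<Sum>k\<in>S. u k * f k x)\<^sup>2) = (\<lambda>x. \<Sum>k\<in>S. \<Sum>l\<in>S. u k * u l * (f k x * f l x))"
    by (simp add: power2_eq_square sum_product algebra_simps)
  then show ?thesis by simp
qed

text \<open>Cauchy--Schwarz applied to the vector \<open>u k = \<integral> h f\<^sub>k\<close> itself.\<close>

lemma bessel_of_operator_bound:
  assumes B0: "B \<ge> 0" and f: "\<And>k. k \<in> S \<Longrightarrow> f k \<in> square_integrable M"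
    and h: "h \<in> square_integrable M"
    and B: "\<And>u. (\<integral>x. (\<Sum>k\<in>S. u k * f k x)\<^sup>2 \<partial>M) \<le> B * (\<Sum>k\<in>S. (u k)\<^sup>2)"
  shows "(\<Sum>k\<in>S. (\<integral>x. h x * f k x \<partial>M)\<^sup>2) \<le> B * (\<integral>x. (h x)\<^sup>2 \<partial>M)"
proof -
  define u where "u k = (\<integral>x. h x * f k x \<partial>M)" for k
  let ?U = "\<Sum>k\<in>S. (u k)\<^sup>2"
  let ?Z = "\<lambda>x. \<Sum>k\<in>S. u k * f k x"
  have Z: "?Z \<in> square_integrable M"
    by (intro square_integrable_sum square_integrable_cmult f)
  have "(\<integral>x. h x * ?Z x \<partial>M) = (\<integral>x. (\<Sum>k\<in>S. u k * (h x * f k x)) \<partial>M)"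
    by (simp add: sum_distrib_left algebra_simps)
  also have "\<dots> = (\<Sum>k\<in>S. u k * u k)"
    by (simp add: square_integrable_mult h f u_def)
  finally have e: "(\<integral>x. h x * ?Z x \<partial>M) = ?U" by (simp add: power2_eq_square)
  have h0: "0 \<le> (\<integral>x. (h x)\<^sup>2 \<partial>M)" by simp
  have "?U\<^sup>2 \<le> (\<integral>x. (h x)\<^sup>2 \<partial>M) * (\<integral>x. (?Z x)\<^sup>2 \<partial>M)"
    using Cauchy_Schwarz_integral[OF h Z] by (simp add: e)
  also have "\<dots> \<le> (\<integral>x. (h x)\<^sup>2 \<partial>M) * (B * ?U)"
    by (intro mult_left_mono B h0)
  finally have *: "?U * ?U \<le> (B * (\<integral>x. (h x)\<^sup>2 \<partial>M)) * ?U" by (simp add: power2_eq_square algebra_simps)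
  have "?U \<ge> 0" by (intro sum_nonneg) auto
  show ?thesis
  proof (cases "?U = 0")
    case True
    have "0 \<le> B * (\<integral>x. (h x)\<^sup>2 \<partial>M)" using h0 B0 by simp
    then show ?thesis using True by (simp add: u_def)
  next
    case False
    with \<open>?U \<ge> 0\<close> have "?U > 0" by simp
    then have "?U \<le> B * (\<integral>x. (h x)\<^sup>2 \<partial>M)" using * by (metis mult_le_cancel_right_pos)
    then show ?thesis by (simp add: u_def)
  qed
qed

lemma integrable_sq_mult_of_fourth:
  fixes x y :: "'a \<Rightarrow> real"
  assumes "x \<in> borel_measurable M" "y \<in> borel_measurable M"
    "integrable M (\<lambda>w. x w ^ 4)" "integrable M (\<lambda>w. y w ^ 4)"
  shows "integrable M (\<lambda>w. (x w)\<^sup>2 * (y w)\<^sup>2)"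
proof -
  have "(\<lambda>w. (x w)\<^sup>2) \<in> square_integrable M" "(\<lambda>w. (y w)\<^sup>2) \<in> square_integrable M"
    using assms by (auto simp: square_integrable_def)
  then show ?thesis by (rule square_integrable_mult)
qed

text \<open>Polarization of the fourth moment identity gives the Isserlis formula for pairs.\<close>

lemma isserlis_of_fourth_moments:
  fixes x y :: "'a \<Rightarrow> real"
  assumes [measurable]: "x \<in> borel_measurable M" "y \<in> borel_measurable M"
    and [simp]: "x \<in> square_integrable M" "y \<in> square_integrable M"
    and i4: "integrable M (\<lambda>w. x w ^ 4)" "integrable M (\<lambda>w. y w ^ 4)"
      "integrable M (\<lambda>w. (x w + y w) ^ 4)" "integrable M (\<lambda>w. (x w - y w) ^ 4)"
    and m4: "(\<integral>w. x w ^ 4 \<partial>M) = 3 * (\<integral>w. (x w)\<^sup>2 \<partial>M)\<^sup>2" "(\<integral>w. y w ^ 4 \<partial>M) = 3 * (\<integral>w. (y w)\<^sup>2 \<partial>M)\<^sup>2"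
      "(\<integral>w. (x w + y w) ^ 4 \<partial>M) = 3 * (\<integral>w. (x w + y w)\<^sup>2 \<partial>M)\<^sup>2"
      "(\<integral>w. (x w - y w) ^ 4 \<partial>M) = 3 * (\<integral>w. (x w - y w)\<^sup>2 \<partial>M)\<^sup>2"
  shows "(\<integral>w. (x w)\<^sup>2 * (y w)\<^sup>2 \<partial>M) =
     (\<integral>w. (x w)\<^sup>2 \<partial>M) * (\<integral>w. (y w)\<^sup>2 \<partial>M) + 2 * (\<integral>w. x w * y w \<partial>M)\<^sup>2"
proof -
  note [simp] = integrable_sq_mult_of_fourth[OF assms(1,2) i4(1,2)] i4 square_integrable_mult
    square_integrable_int
  let ?a = "\<integral>w. (x w)\<^sup>2 \<partial>M" and ?b = "\<integral>w. (y w)\<^sup>2 \<partial>M" and ?c = "\<integral>w. x w * y w \<partial>M"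
  have "(\<integral>w. (x w + y w)\<^sup>2 \<partial>M) = (\<integral>w. (x w)\<^sup>2 + (y w)\<^sup>2 + 2 * (x w * y w) \<partial>M)"
    by (simp only: power2_sum mult.assoc)
  then have p: "(\<integral>w. (x w + y w)\<^sup>2 \<partial>M) = ?a + ?b + 2 * ?c" by simp
  have "(\<integral>w. (x w - y w)\<^sup>2 \<partial>M) = (\<integral>w. (x w)\<^sup>2 + (y w)\<^sup>2 - 2 * (x w * y w) \<partial>M)"
    by (simp only: power2_diff mult.assoc)
  then have q: "(\<integral>w. (x w - y w)\<^sup>2 \<partial>M) = ?a + ?b - 2 * ?c" by simp
  have "(\<lambda>w. (x w)\<^sup>2 * (y w)\<^sup>2) =
      (\<lambda>w. ((x w + y w)^4 + (x w - y w)^4 - 2 * x w ^ 4 - 2 * y w ^ 4) / 12)"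
    by (rule ext) (simp add: power4_eq_xxxx power2_eq_square algebra_simps)
  then have "(\<integral>w. (x w)\<^sup>2 * (y w)\<^sup>2 \<partial>M) = (3 * (?a + ?b + 2 * ?c)\<^sup>2 + 3 * (?a + ?b - 2 * ?c)\<^sup>2
     - 6 * ?a\<^sup>2 - 6 * ?b\<^sup>2) / 12"
    by (simp add: m4 p q)
  also have "\<dots> = ?a * ?b + 2 * ?c\<^sup>2" by (simp add: power2_eq_square algebra_simps)
  finally show ?thesis .
qed

section \<open>Tests and moments for one machine at one level\<close>

text \<open>Gaussianity enters only through the second and fourth moments of linear combinations.
  The factor 4 in the second moment bound stands for the identity covariance of an orthonormal
  system: it is what remains after the wavelets are replaced by step functions
  (\<open>near_orthonormal_operator_bound\<close>).\<close>

locale noise_level = prob_space +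
  fixes S :: "'k set" and \<xi> :: "'k \<Rightarrow> 'a \<Rightarrow> real"
  assumes finite_S: "finite S"
    and noise_meas [measurable]: "\<And>k. k \<in> S \<Longrightarrow> \<xi> k \<in> borel_measurable M"
    and noise_int4: "\<And>u. integrable M (\<lambda>\<omega>. (\<Sum>k\<in>S. u k * \<xi> k \<omega>) ^ 4)"
    and noise_moment2: "\<And>u. expectation (\<lambda>\<omega>. (\<Sum>k\<in>S. u k * \<xi> k \<omega>)\<^sup>2) \<le> 4 * (\<Sum>k\<in>S. (u k)\<^sup>2)"
    and noise_moment4: "\<And>u. expectation (\<lambda>\<omega>. (\<Sum>k\<in>S. u k * \<xi> k \<omega>) ^ 4) =
           3 * (expectation (\<lambda>\<omega>. (\<Sum>k\<in>S. u k * \<xi> k \<omega>)\<^sup>2))\<^sup>2"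
begin

text \<open>The locale speaks about all linear combinations; unit vectors as coefficients recover
  the single noise variables, and sums of two unit vectors the pairs.\<close>

lemma single_combination:
  "k \<in> S \<Longrightarrow> (\<Sum>j\<in>S. (if j = k then 1 else 0) * \<xi> j \<omega>) = \<xi> k \<omega>"
  by (simp add: finite_S if_distrib[of "\<lambda>x. x * _"] sum.delta cong: if_cong)

lemma pair_combination:
  assumes "k \<in> S" "l \<in> S"
  shows "(\<Sum>j\<in>S. ((if j = k then 1 else 0) + s * (if j = l then 1 else 0)) * \<xi> j \<omega>) = \<xi> k \<omega> + s * \<xi> l \<omega>"
  unfolding distrib_right sum.distrib
  using single_combination[OF assms(1), of \<omega>] single_combination[OF assms(2), of \<omega>]
  by (simp add: mult.assoc flip: sum_distrib_left)

lemma noise_int4_single: "k \<in> S \<Longrightarrow> integrable M (\<lambda>\<omega>. \<xi> k \<omega> ^ 4)"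
  using noise_int4[of "\<lambda>j. if j = k then 1 else 0"] by (simp only: single_combination)

lemma noise_sq_square_integrable: "k \<in> S \<Longrightarrow> (\<lambda>\<omega>. (\<xi> k \<omega>)\<^sup>2) \<in> square_integrable M"
  using noise_int4_single[of k] by (auto simp: square_integrable_def)

lemma noise_square_integrable: "k \<in> S \<Longrightarrow> \<xi> k \<in> square_integrable M"
  using square_integrable_integrable[OF finite_measure_axioms noise_sq_square_integrable]
  by (auto simp: square_integrable_def)

lemma noise_moment2_single: "k \<in> S \<Longrightarrow> expectation (\<lambda>\<omega>. (\<xi> k \<omega>)\<^sup>2) \<le> 4"
  using noise_moment2[of "\<lambda>j. if j = k then 1 else 0"]
  by (simp only: single_combination) (simp add: finite_S if_distrib[of "\<lambda>x. x\<^sup>2"] cong: if_cong)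

lemma noise_moment4_single: "k \<in> S \<Longrightarrow> expectation (\<lambda>\<omega>. \<xi> k \<omega> ^ 4) \<le> 48"
proof -
  assume k: "k \<in> S"
  have "expectation (\<lambda>\<omega>. \<xi> k \<omega> ^ 4) = 3 * (expectation (\<lambda>\<omega>. (\<xi> k \<omega>)\<^sup>2))\<^sup>2"
    using noise_moment4[of "\<lambda>j. if j = k then 1 else 0"] k by (simp only: single_combination)
  also have "\<dots> \<le> 3 * 4\<^sup>2"
    by (intro mult_left_mono power_mono noise_moment2_single k) auto
  finally show ?thesis by simp
qed

text \<open>The fourth moment identity is applied to the coefficient vectors e_k, e_l and e_k + e_l,
  e_k - e_l. The case \<open>k = l\<close> is included.\<close>

lemma isserlis_noise:
  assumes k: "k \<in> S" and l: "l \<in> S"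
  shows "expectation (\<lambda>\<omega>. (\<xi> k \<omega>)\<^sup>2 * (\<xi> l \<omega>)\<^sup>2) =
     expectation (\<lambda>\<omega>. (\<xi> k \<omega>)\<^sup>2) * expectation (\<lambda>\<omega>. (\<xi> l \<omega>)\<^sup>2) + 2 * (expectation (\<lambda>\<omega>. \<xi> k \<omega> * \<xi> l \<omega>))\<^sup>2"
proof (rule isserlis_of_fourth_moments)
  note p1 = pair_combination[of k l 1, OF k l, unfolded mult_1_left]
  have p2: "(\<Sum>j\<in>S. ((if j = k then 1 else 0) + - 1 * (if j = l then 1 else 0)) * \<xi> j \<omega>) = \<xi> k \<omega> - \<xi> l \<omega>" for \<omega>
    using pair_combination[of k l "-1", OF k l] by simp
  show "integrable M (\<lambda>w. (\<xi> k w + \<xi> l w) ^ 4)"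
    using noise_int4[of "\<lambda>j. (if j = k then 1 else 0) + (if j = l then 1 else 0)"] by (simp only: p1)
  show "integrable M (\<lambda>w. (\<xi> k w - \<xi> l w) ^ 4)"
    using noise_int4[of "\<lambda>j. (if j = k then 1 else 0) + - 1 * (if j = l then 1 else 0)"] by (simp only: p2)
  show "expectation (\<lambda>w. (\<xi> k w + \<xi> l w) ^ 4) = 3 * (expectation (\<lambda>w. (\<xi> k w + \<xi> l w)\<^sup>2))\<^sup>2"
    using noise_moment4[of "\<lambda>j. (if j = k then 1 else 0) + (if j = l then 1 else 0)"] by (simp only: p1)
  show "expectation (\<lambda>w. (\<xi> k w - \<xi> l w) ^ 4) = 3 * (expectation (\<lambda>w. (\<xi> k w - \<xi> l w)\<^sup>2))\<^sup>2"
    using noise_moment4[of "\<lambda>j. (if j = k then 1 else 0) + - 1 * (if j = l then 1 else 0)"] by (simp only: p2)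
  show "expectation (\<lambda>w. \<xi> k w ^ 4) = 3 * (expectation (\<lambda>w. (\<xi> k w)\<^sup>2))\<^sup>2"
    using noise_moment4[of "\<lambda>j. if j = k then 1 else 0"] k by (simp only: single_combination)
  show "expectation (\<lambda>w. \<xi> l w ^ 4) = 3 * (expectation (\<lambda>w. (\<xi> l w)\<^sup>2))\<^sup>2"
    using noise_moment4[of "\<lambda>j. if j = l then 1 else 0"] l by (simp only: single_combination)
qed (use k l in \<open>auto intro: noise_int4_single noise_square_integrable\<close>)

text \<open>This is the exact mean that debiasing has to subtract. It need not equal
  \<open>card S\<close>, because the step functions are only nearly normalized.\<close>

definition noise_energy :: real where
  "noise_energy = (\<Sum>k\<in>S. expectation (\<lambda>\<omega>. (\<xi> k \<omega>)\<^sup>2))"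

lemma noise_energy_le: "noise_energy \<le> 4 * card S"
  unfolding noise_energy_def
  using sum_bounded_above[of S "\<lambda>k. expectation (\<lambda>\<omega>. (\<xi> k \<omega>)\<^sup>2)" 4] noise_moment2_single by simp

lemma centred_energy_square_integrable:
  "(\<lambda>\<omega>. (\<Sum>k\<in>S. (\<xi> k \<omega>)\<^sup>2) - noise_energy) \<in> square_integrable M"
proof -
  have "(\<lambda>\<omega>. noise_energy) \<in> square_integrable M" by (simp add: square_integrable_def)
  then show ?thesis
    by (intro square_integrable_diff square_integrable_sum noise_sq_square_integrable)
qed

text \<open>By Isserlis the covariance of two squares is twice the squared covariance. Bessel,
  applied to one noise variable against all the others, bounds each row of squared covariances by 4
  * 4, so the variance stays linear in \<open>card S\<close> without independence; 32 = 2 *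
  16.\<close>

lemma variance_noise_energy:
  "expectation (\<lambda>\<omega>. ((\<Sum>k\<in>S. (\<xi> k \<omega>)\<^sup>2) - noise_energy)\<^sup>2) \<le> 32 * card S"
proof -
  define e where "e k = expectation (\<lambda>\<omega>. (\<xi> k \<omega>)\<^sup>2)" for k
  define y where "y k \<omega> = (\<xi> k \<omega>)\<^sup>2 - e k" for k \<omega>
  have const: "(\<lambda>\<omega>. c) \<in> square_integrable M" for c by (simp add: square_integrable_def)
  have y: "y k \<in> square_integrable M" if "k \<in> S" for k
    unfolding y_def[abs_def] using that
    by (intro square_integrable_diff noise_sq_square_integrable const)
  have cov: "expectation (\<lambda>\<omega>. y k \<omega> * y l \<omega>) = 2 * (expectation (\<lambda>\<omega>. \<xi> k \<omega> * \<xi> l \<omega>))\<^sup>2"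
    if "k \<in> S" "l \<in> S" for k l
  proof -
    have [simp]: "integrable M (\<lambda>\<omega>. (\<xi> k \<omega>)\<^sup>2 * (\<xi> l \<omega>)\<^sup>2)"
      "integrable M (\<lambda>\<omega>. (\<xi> k \<omega>)\<^sup>2)" "integrable M (\<lambda>\<omega>. (\<xi> l \<omega>)\<^sup>2)"
      using that by (auto intro: square_integrable_mult noise_sq_square_integrable
          square_integrable_int noise_square_integrable)
    have "(\<lambda>\<omega>. y k \<omega> * y l \<omega>) = (\<lambda>\<omega>. (\<xi> k \<omega>)\<^sup>2 * (\<xi> l \<omega>)\<^sup>2 - e l * (\<xi> k \<omega>)\<^sup>2 - e k * (\<xi> l \<omega>)\<^sup>2 + e k * e l)"
      by (auto simp: y_def algebra_simps)
    then have "expectation (\<lambda>\<omega>. y k \<omega> * y l \<omega>)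
       = expectation (\<lambda>\<omega>. (\<xi> k \<omega>)\<^sup>2 * (\<xi> l \<omega>)\<^sup>2) - e l * e k - e k * e l + e k * e l"
      by (simp add: prob_space e_def)
    then show ?thesis using isserlis_noise[OF that] by (simp add: e_def)
  qed
  have "(\<lambda>\<omega>. (\<Sum>k\<in>S. (\<xi> k \<omega>)\<^sup>2) - noise_energy) = (\<lambda>\<omega>. \<Sum>k\<in>S. 1 * y k \<omega>)"
    by (auto simp: y_def noise_energy_def sum_subtractf e_def)
  then have "expectation (\<lambda>\<omega>. ((\<Sum>k\<in>S. (\<xi> k \<omega>)\<^sup>2) - noise_energy)\<^sup>2)
      = expectation (\<lambda>\<omega>. (\<Sum>k\<in>S. 1 * y k \<omega>)\<^sup>2)" by metis
  also have "\<dots> = (\<Sum>k\<in>S. \<Sum>l\<in>S. expectation (\<lambda>\<omega>. y k \<omega> * y l \<omega>))"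
    using integral_sum_sq[of S y M "\<lambda>_. 1", OF y] by simp
  also have "\<dots> = (\<Sum>k\<in>S. \<Sum>l\<in>S. 2 * (expectation (\<lambda>\<omega>. \<xi> k \<omega> * \<xi> l \<omega>))\<^sup>2)"
    by (intro sum.cong refl cov)
  also have "\<dots> = (\<Sum>k\<in>S. 2 * (\<Sum>l\<in>S. (expectation (\<lambda>\<omega>. \<xi> k \<omega> * \<xi> l \<omega>))\<^sup>2))"
    by (simp add: sum_distrib_left)
  also have "\<dots> \<le> (\<Sum>k\<in>S. 2 * (4 * 4))"
  proof (intro sum_mono mult_left_mono)
    fix k assume k: "k \<in> S"
    have "(\<Sum>l\<in>S. (expectation (\<lambda>\<omega>. \<xi> k \<omega> * \<xi> l \<omega>))\<^sup>2) \<le> 4 * expectation (\<lambda>\<omega>. (\<xi> k \<omega>)\<^sup>2)"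
      by (rule bessel_of_operator_bound) (auto intro: noise_square_integrable noise_moment2 k)
    also have "\<dots> \<le> 4 * 4" using noise_moment2_single[OF k] by simp
    finally show "(\<Sum>l\<in>S. (expectation (\<lambda>\<omega>. \<xi> k \<omega> * \<xi> l \<omega>))\<^sup>2) \<le> 4 * 4" .
  qed auto
  finally show ?thesis by simp
qed

section \<open>The debiased energy statistic and the error probabilities of its threshold
  test\<close>

definition energy_stat :: "('k \<Rightarrow> real) \<Rightarrow> real \<Rightarrow> 'a \<Rightarrow> real" where
  "energy_stat g \<sigma> \<omega> = (\<Sum>k\<in>S. (g k + \<sigma> * \<xi> k \<omega>)\<^sup>2) - \<sigma>\<^sup>2 * noise_energy"

lemma energy_stat_deviation:
  "energy_stat g \<sigma> \<omega> - (\<Sum>k\<in>S. (g k)\<^sup>2) =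
     2 * \<sigma> * (\<Sum>k\<in>S. g k * \<xi> k \<omega>) + \<sigma>\<^sup>2 * ((\<Sum>k\<in>S. (\<xi> k \<omega>)\<^sup>2) - noise_energy)"
  unfolding energy_stat_def
  by (simp add: power2_eq_square algebra_simps sum.distrib sum_distrib_left)

lemma energy_stat_meas [measurable]: "energy_stat g \<sigma> \<in> borel_measurable M"
  unfolding energy_stat_def[abs_def] by measurable

lemma energy_stat_square_integrable:
  "(\<lambda>\<omega>. energy_stat g \<sigma> \<omega> - (\<Sum>k\<in>S. (g k)\<^sup>2)) \<in> square_integrable M"
  unfolding energy_stat_deviation
  by (intro square_integrable_add square_integrable_cmult square_integrable_sum
      noise_square_integrable centred_energy_square_integrable)

text \<open>The deviation is a linear plus a centred quadratic term in the noise. Bounding the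
  square of the sum by twice the sum of squares avoids their mixed, third order moments; 32 = 8 * 4
  and 64 = 2 * 32.\<close>

lemma energy_stat_variance:
  "expectation (\<lambda>\<omega>. (energy_stat g \<sigma> \<omega> - (\<Sum>k\<in>S. (g k)\<^sup>2))\<^sup>2)
     \<le> 32 * \<sigma>\<^sup>2 * (\<Sum>k\<in>S. (g k)\<^sup>2) + 64 * \<sigma> ^ 4 * card S"
proof -
  let ?Z = "\<lambda>\<omega>. \<Sum>k\<in>S. g k * \<xi> k \<omega>" and ?Y = "\<lambda>\<omega>. (\<Sum>k\<in>S. (\<xi> k \<omega>)\<^sup>2) - noise_energy"
  have Z: "?Z \<in> square_integrable M"
    by (intro square_integrable_cmult square_integrable_sum noise_square_integrable)
  have [simp]: "integrable M (\<lambda>\<omega>. (?Z \<omega>)\<^sup>2)" "integrable M (\<lambda>\<omega>. (?Y \<omega>)\<^sup>2)"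
    by (intro square_integrable_int Z centred_energy_square_integrable)+
  have "expectation (\<lambda>\<omega>. (energy_stat g \<sigma> \<omega> - (\<Sum>k\<in>S. (g k)\<^sup>2))\<^sup>2)
    \<le> expectation (\<lambda>\<omega>. 8 * \<sigma>\<^sup>2 * (?Z \<omega>)\<^sup>2 + 2 * \<sigma> ^ 4 * (?Y \<omega>)\<^sup>2)"
  proof (rule integral_mono)
    show "integrable M (\<lambda>\<omega>. (energy_stat g \<sigma> \<omega> - (\<Sum>k\<in>S. (g k)\<^sup>2))\<^sup>2)"
      by (intro square_integrable_int energy_stat_square_integrable)
    fix \<omega>
    have "(x + y)\<^sup>2 \<le> 2 * x\<^sup>2 + 2 * y\<^sup>2" for x y :: real
      using sum_squares_bound[of x y] by (simp add: power2_sum)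
    from this[of "2 * \<sigma> * ?Z \<omega>" "\<sigma>\<^sup>2 * ?Y \<omega>"]
    show "(energy_stat g \<sigma> \<omega> - (\<Sum>k\<in>S. (g k)\<^sup>2))\<^sup>2 \<le> 8 * \<sigma>\<^sup>2 * (?Z \<omega>)\<^sup>2 + 2 * \<sigma> ^ 4 * (?Y \<omega>)\<^sup>2"
      unfolding energy_stat_deviation by (simp add: power_mult_distrib mult.assoc)
  qed simp
  also have "\<dots> = 8 * \<sigma>\<^sup>2 * expectation (\<lambda>\<omega>. (?Z \<omega>)\<^sup>2) + 2 * \<sigma> ^ 4 * expectation (\<lambda>\<omega>. (?Y \<omega>)\<^sup>2)"
    by simp
  also have "\<dots> \<le> 8 * \<sigma>\<^sup>2 * (4 * (\<Sum>k\<in>S. (g k)\<^sup>2)) + 2 * \<sigma> ^ 4 * (32 * card S)"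
    by (intro add_mono mult_left_mono noise_moment2 variance_noise_energy) auto
  finally show ?thesis by (simp add: mult.assoc)
qed

text \<open>A real 0/1 variable, so that it can multiply the noise and its expectation is the
  probability of transmission.\<close>

definition detect :: "('k \<Rightarrow> real) \<Rightarrow> real \<Rightarrow> real \<Rightarrow> 'a \<Rightarrow> real" where
  "detect g \<sigma> \<theta> \<omega> = of_bool (\<theta> \<le> energy_stat g \<sigma> \<omega>)"

lemma detect_meas [measurable]: "detect g \<sigma> \<theta> \<in> borel_measurable M"
  unfolding detect_def[abs_def] by measurable

lemma detect_cases: "detect g \<sigma> \<theta> \<omega> = 0 \<or> detect g \<sigma> \<theta> \<omega> = 1"
  by (simp add: detect_def)

lemma detect_bounds: "0 \<le> detect g \<sigma> \<theta> \<omega>" "detect g \<sigma> \<theta> \<omega> \<le> 1"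
  by (simp_all add: detect_def)

lemma detect_integrable [simp]: "integrable M (detect g \<sigma> \<theta>)"
  by (rule integrable_const_bound[of _ 1]) (auto simp: detect_def)

lemma detect_expectation_nonneg: "0 \<le> expectation (detect g \<sigma> \<theta>)"
  by (intro Bochner_Integration.integral_nonneg detect_bounds)

text \<open>Stated for a function \<open>h\<close> with values between 0 and 1 that is supported on
  the deviation event, so that it serves both for \<open>detect\<close> (false alarm) and for its
  complement (missed detection).\<close>

lemma chebyshev_energy_stat:
  assumes "t > 0" "h \<in> borel_measurable M" "\<And>\<omega>. 0 \<le> h \<omega>" "\<And>\<omega>. h \<omega> \<le> 1"
    "\<And>\<omega>. h \<omega> \<noteq> 0 \<Longrightarrow> t \<le> \<bar>energy_stat g \<sigma> \<omega> - (\<Sum>k\<in>S. (g k)\<^sup>2)\<bar>"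
  shows "expectation h \<le> (32 * \<sigma>\<^sup>2 * (\<Sum>k\<in>S. (g k)\<^sup>2) + 64 * \<sigma> ^ 4 * card S) / t\<^sup>2"
proof -
  let ?T = "\<lambda>\<omega>. energy_stat g \<sigma> \<omega> - (\<Sum>k\<in>S. (g k)\<^sup>2)"
  have [simp]: "integrable M (\<lambda>\<omega>. (?T \<omega>)\<^sup>2)"
    by (intro square_integrable_int energy_stat_square_integrable)
  have "expectation h \<le> expectation (\<lambda>\<omega>. (?T \<omega>)\<^sup>2 / t\<^sup>2)"
  proof (rule integral_mono)
    show "integrable M h"
      by (rule integrable_const_bound[of _ 1]) (use assms in auto)
    fix \<omega>
    show "h \<omega> \<le> (?T \<omega>)\<^sup>2 / t\<^sup>2"
    proof (cases "h \<omega> = 0")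
      case False
      have "t\<^sup>2 \<le> (?T \<omega>)\<^sup>2" using assms(1) assms(5)[OF False] by (metis abs_of_pos abs_le_square_iff)
      then have "1 \<le> (?T \<omega>)\<^sup>2 / t\<^sup>2" using assms(1) by (simp add: field_simps)
      then show ?thesis using assms(4)[of \<omega>] by linarith
    qed simp
  qed simp
  also have "\<dots> = expectation (\<lambda>\<omega>. (?T \<omega>)\<^sup>2) / t\<^sup>2" by simp
  also have "\<dots> \<le> (32 * \<sigma>\<^sup>2 * (\<Sum>k\<in>S. (g k)\<^sup>2) + 64 * \<sigma> ^ 4 * card S) / t\<^sup>2"
    by (intro divide_right_mono energy_stat_variance) simp
  finally show ?thesis .
qed

text \<open>The signal reaches at most half of the threshold, so an alarm needs a deviation of the
  other half, t. Both t and the leading part of the variance are proportional to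
  \<open>card S\<close>, hence the product with \<open>card S\<close>, the expected number of
  coefficients sent in vain, is free of the dimension: 64 m / \<tau> + 256 m^2 / \<tau>^2, at most
  320 m^2.\<close>

lemma false_alarm:
  fixes \<tau> n mm :: real
  assumes S: "S \<noteq> {}" and \<tau>: "\<tau> \<ge> 1" and n: "n > 0" and mm: "mm \<ge> 1" and \<sigma>: "\<sigma>\<^sup>2 = mm / n"
    and b: "(\<Sum>k\<in>S. (g k)\<^sup>2) \<le> \<tau> * card S / (2 * n)"
  shows "card S * expectation (detect g \<sigma> (\<tau> * card S / n)) \<le> 320 * mm\<^sup>2"
proof -
  define d where "d = real (card S)"
  have d: "d > 0" using S finite_S by (simp add: d_def card_gt_0_iff)
  let ?b = "\<Sum>k\<in>S. (g k)\<^sup>2"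
  define t where "t = \<tau> * d / (2 * n)"
  have t: "t > 0" using \<tau> n d by (simp add: t_def)
  have s4: "\<sigma> ^ 4 = mm\<^sup>2 / n\<^sup>2" 
  proof -
    have "\<sigma> ^ 4 = (\<sigma>\<^sup>2)\<^sup>2" by simp
    then show ?thesis by (simp only: \<sigma> power_divide)
  qed
  have "expectation (detect g \<sigma> (\<tau> * d / n)) \<le> (32 * \<sigma>\<^sup>2 * ?b + 64 * \<sigma> ^ 4 * d) / t\<^sup>2"
    unfolding d_def
  proof (rule chebyshev_energy_stat)
    fix \<omega> assume "detect g \<sigma> (\<tau> * real (card S) / n) \<omega> \<noteq> 0"
    then have "\<tau> * d / n \<le> energy_stat g \<sigma> \<omega>" by (auto simp: detect_def d_def)
    moreover have "\<tau> * d / n = t + t" by (simp add: t_def field_simps)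
    moreover have "?b \<le> t" using b by (simp add: t_def d_def)
    ultimately show "t \<le> \<bar>energy_stat g \<sigma> \<omega> - ?b\<bar>" by linarith
  qed (use t in \<open>auto simp: detect_bounds\<close>)
  also have "\<dots> \<le> (32 * \<sigma>\<^sup>2 * t + 64 * \<sigma> ^ 4 * d) / t\<^sup>2"
    using b by (intro divide_right_mono add_mono mult_left_mono) (auto simp: t_def d_def)
  finally have "d * expectation (detect g \<sigma> (\<tau> * d / n)) \<le> d * ((32 * \<sigma>\<^sup>2 * t + 64 * \<sigma> ^ 4 * d) / t\<^sup>2)"
    using d by (intro mult_left_mono) auto
  also have "\<dots> = 64 * mm / \<tau> + 256 * mm\<^sup>2 / \<tau>\<^sup>2"
    unfolding \<sigma> s4 t_def using n d \<tau> by (simp add: field_simps power2_eq_square)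
  also have "\<dots> \<le> 64 * mm\<^sup>2 + 256 * mm\<^sup>2"
  proof (rule add_mono)
    have "64 * mm / \<tau> \<le> 64 * mm" using \<tau> mm by (simp add: field_simps)
    also have "\<dots> \<le> 64 * mm\<^sup>2" using mm by (simp add: power2_eq_square)
    finally show "64 * mm / \<tau> \<le> 64 * mm\<^sup>2" .
    have "1 \<le> \<tau>\<^sup>2" using \<tau> by (simp add: one_le_power)
    then show "256 * mm\<^sup>2 / \<tau>\<^sup>2 \<le> 256 * mm\<^sup>2" using mm by (simp add: divide_le_eq mult_le_cancel_left1)
  qed
  finally show ?thesis by (simp add: d_def)
qed

text \<open>If the signal energy is at most twice the threshold, losing all of it is affordable.
  Otherwise a miss requires a deviation of half the energy, and Chebyshev improves with the energy:
  after multiplication by it there remain 128 m / n and 256 (m^2 / n) times a ratio that is at most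
  1/2.\<close>

lemma missed_detection:
  fixes \<tau> n mm :: real
  assumes S: "S \<noteq> {}" and \<tau>: "\<tau> \<ge> 1" and n: "n > 0" and mm: "mm \<ge> 1" and \<sigma>: "\<sigma>\<^sup>2 = mm / n"
  shows "(\<Sum>k\<in>S. (g k)\<^sup>2) * (1 - expectation (detect g \<sigma> (\<tau> * card S / n)))
    \<le> 2 * \<tau> * card S / n + 256 * mm\<^sup>2 / n"
proof -
  define d where "d = real (card S)"
  have d: "d > 0" using S finite_S by (simp add: d_def card_gt_0_iff)
  let ?b = "\<Sum>k\<in>S. (g k)\<^sup>2" and ?D = "detect g \<sigma> (\<tau> * d / n)"
  have b0: "?b \<ge> 0" by (intro sum_nonneg) auto
  have s4: "\<sigma> ^ 4 = mm\<^sup>2 / n\<^sup>2" 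
  proof -
    have "\<sigma> ^ 4 = (\<sigma>\<^sup>2)\<^sup>2" by simp
    then show ?thesis by (simp only: \<sigma> power_divide)
  qed
  show ?thesis
  proof (cases "?b \<le> 2 * \<tau> * d / n")
    case True
    have "?b * (1 - expectation ?D) \<le> ?b * 1"
      by (intro mult_left_mono b0) (use detect_expectation_nonneg in auto)
    also have "\<dots> \<le> 2 * \<tau> * d / n + 256 * mm\<^sup>2 / n" using True n by (simp add: add_increasing2)
    finally show ?thesis by (simp add: d_def)
  next
    case False
    then have bb: "?b > 2 * \<tau> * d / n" by simp
    moreover have "2 * \<tau> * d / n > 0" using \<tau> n d by simp
    ultimately have bp: "?b > 0" by linarith
    have "1 - expectation ?D = expectation (\<lambda>\<omega>. 1 - ?D \<omega>)" by (simp add: prob_space)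
    also have "\<dots> \<le> (32 * \<sigma>\<^sup>2 * ?b + 64 * \<sigma> ^ 4 * d) / (?b/2)\<^sup>2"
      unfolding d_def
    proof (rule chebyshev_energy_stat)
      fix \<omega> assume "1 - detect g \<sigma> (\<tau> * real (card S) / n) \<omega> \<noteq> 0"
      then have "energy_stat g \<sigma> \<omega> < \<tau> * d / n" by (auto simp: detect_def d_def split: if_splits)
      moreover have "\<tau> * d / n \<le> ?b / 2" using bb by (simp add: field_simps)
      ultimately have "energy_stat g \<sigma> \<omega> < ?b / 2" by linarith
      then show "?b / 2 \<le> \<bar>energy_stat g \<sigma> \<omega> - ?b\<bar>" using bp by (simp add: abs_if)
    qed (use bp in \<open>auto simp: detect_bounds\<close>)
    finally have "?b * (1 - expectation ?D) \<le> ?b * ((32 * \<sigma>\<^sup>2 * ?b + 64 * \<sigma> ^ 4 * d) / (?b/2)\<^sup>2)"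
      by (intro mult_left_mono b0)
    also have "\<dots> = 128 * mm / n + 256 * mm\<^sup>2 / n * (d / n / ?b)"
      unfolding \<sigma> s4 using n bp by (simp add: field_simps power2_eq_square)
    also have "\<dots> \<le> 128 * mm\<^sup>2 / n + 256 * mm\<^sup>2 / n * (1/2)"
    proof (rule add_mono)
      show "128 * mm / n \<le> 128 * mm\<^sup>2 / n"
        using n mm by (intro divide_right_mono) (auto simp: power2_eq_square)
      have "2 * (d / n) \<le> 2 * \<tau> * d / n" using \<tau> n d by (simp add: field_simps)
      then have "2 * (d / n) \<le> ?b" using bb by linarith
      then have "d / n \<le> 1/2 * ?b" by linarith
      then have "d / n / ?b \<le> 1/2" using bp by (simp only: pos_divide_le_eq)
      then show "256 * mm\<^sup>2 / n * (d / n / ?b) \<le> 256 * mm\<^sup>2 / n * (1/2)"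
        using n by (intro mult_left_mono) auto
    qed
    also have "\<dots> \<le> 2 * \<tau> * d / n + 256 * mm\<^sup>2 / n" using \<tau> n d by (simp add: add_increasing)
    finally show ?thesis by (simp add: d_def)
  qed
qed

section \<open>The noise that passes the test\<close>

lemma noise_sum_integrable: "integrable M (\<lambda>\<omega>. \<Sum>k\<in>S. (\<xi> k \<omega>)\<^sup>2)"
  by (intro Bochner_Integration.integrable_sum square_integrable_int noise_square_integrable)

lemma detected_noise_integrable:
  "integrable M (\<lambda>\<omega>. detect g \<sigma> \<theta> \<omega> * (\<Sum>k\<in>S. (\<xi> k \<omega>)\<^sup>2))"
proof (rule Bochner_Integration.integrable_bound[OF noise_sum_integrable])
  show "AE \<omega> in M. norm (detect g \<sigma> \<theta> \<omega> * (\<Sum>k\<in>S. (\<xi> k \<omega>)\<^sup>2)) \<le> norm (\<Sum>k\<in>S. (\<xi> k \<omega>)\<^sup>2)"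
    by (intro AE_I2) (simp add: detect_def)
qed measurable

lemma detected_noise_le: "expectation (\<lambda>\<omega>. detect g \<sigma> \<theta> \<omega> * (\<Sum>k\<in>S. (\<xi> k \<omega>)\<^sup>2)) \<le> 4 * card S"
proof -
  have "expectation (\<lambda>\<omega>. detect g \<sigma> \<theta> \<omega> * (\<Sum>k\<in>S. (\<xi> k \<omega>)\<^sup>2)) \<le> expectation (\<lambda>\<omega>. \<Sum>k\<in>S. (\<xi> k \<omega>)\<^sup>2)"
    by (intro integral_mono detected_noise_integrable noise_sum_integrable)
      (auto simp: detect_def intro: sum_nonneg)
  also have "\<dots> = noise_energy"
    unfolding noise_energy_def
    by (intro Bochner_Integration.integral_sum square_integrable_int noise_square_integrable)
  finally show ?thesis using noise_energy_le by linarith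
qed

text \<open>Test and noise are dependent, since large noise is what triggers a false alarm. The
  energy is therefore split on the event of detection into its mean, at most 4 d, and its
  fluctuation, which a weighted inequality between products and squares trades for d plus a small
  multiple of its square; the variance bound 32 d turns the latter into the constant 8.\<close>

lemma detected_noise_le_false_alarm:
  assumes S: "S \<noteq> {}"
  shows "expectation (\<lambda>\<omega>. detect g \<sigma> \<theta> \<omega> * (\<Sum>k\<in>S. (\<xi> k \<omega>)\<^sup>2)) \<le> 5 * card S * expectation (detect g \<sigma> \<theta>) + 8"
proof -
  define d where "d = real (card S)"
  have d: "d > 0" using S finite_S by (simp add: d_def card_gt_0_iff)
  let ?Y = "\<lambda>\<omega>. (\<Sum>k\<in>S. (\<xi> k \<omega>)\<^sup>2) - noise_energy" and ?D = "detect g \<sigma> \<theta>"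
  have [simp]: "integrable M (\<lambda>\<omega>. (?Y \<omega>)\<^sup>2)"
    by (intro square_integrable_int centred_energy_square_integrable)
  have "expectation (\<lambda>\<omega>. ?D \<omega> * (\<Sum>k\<in>S. (\<xi> k \<omega>)\<^sup>2))
    \<le> expectation (\<lambda>\<omega>. 5 * d * ?D \<omega> + 1 / (4 * d) * (?Y \<omega>)\<^sup>2)"
  proof (rule integral_mono)
    fix \<omega>
    show "?D \<omega> * (\<Sum>k\<in>S. (\<xi> k \<omega>)\<^sup>2) \<le> 5 * d * ?D \<omega> + 1 / (4 * d) * (?Y \<omega>)\<^sup>2"
    proof (cases "?D \<omega> = 0")
      case False
      then have D: "?D \<omega> = 1" using detect_cases by metis
      \<comment> \<open>The weight is chosen such that the fluctuation costs exactly one further d,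
        making 4 d into 5 d.\<close>
      have "0 \<le> (2 * d - ?Y \<omega>)\<^sup>2 / (4 * d)" using d by simp
      also have "\<dots> = d - ?Y \<omega> + 1 / (4 * d) * (?Y \<omega>)\<^sup>2"
        using d by (simp add: power2_eq_square field_simps)
      finally show ?thesis using noise_energy_le D by (simp add: d_def)
    qed (use d in simp)
  qed (auto intro: detected_noise_integrable)
  also have "\<dots> = 5 * d * expectation ?D + 1 / (4 * d) * expectation (\<lambda>\<omega>. (?Y \<omega>)\<^sup>2)"
    by simp
  also have "\<dots> \<le> 5 * d * expectation ?D + 1 / (4 * d) * (32 * d)"
    using d variance_noise_energy by (intro add_left_mono mult_left_mono) (auto simp: d_def)
  also have "\<dots> = 5 * d * expectation ?D + 8" using d by simp
  finally show ?thesis by (simp add: d_def)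
qed

text \<open>These means are the coefficients of the test variable against the noise variables.
  Bessel with operator constant 4 compares their squares with the second moment of
  \<open>detect\<close>, which is at most 1; the dimension does not enter.\<close>

lemma selection_bias: "(\<Sum>k\<in>S. (expectation (\<lambda>\<omega>. detect g \<sigma> \<theta> \<omega> * \<xi> k \<omega>))\<^sup>2) \<le> 4"
proof -
  have D: "detect g \<sigma> \<theta> \<in> square_integrable M"
    unfolding square_integrable_def
    by (auto intro!: integrable_const_bound[of _ 1] simp: detect_def)
  have "(\<Sum>k\<in>S. (expectation (\<lambda>\<omega>. detect g \<sigma> \<theta> \<omega> * \<xi> k \<omega>))\<^sup>2) \<le> 4 * expectation (\<lambda>\<omega>. (detect g \<sigma> \<theta> \<omega>)\<^sup>2)"
    by (rule bessel_of_operator_bound) (auto intro: noise_square_integrable noise_moment2 D)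
  also have "expectation (\<lambda>\<omega>. (detect g \<sigma> \<theta> \<omega>)\<^sup>2) \<le> expectation (\<lambda>\<omega>. 1)"
    by (intro integral_mono square_integrable_int D) (auto simp: detect_def)
  finally show ?thesis by (simp add: prob_space)
qed

end

section \<open>Averaging over the machines\<close>

lemma (in prob_space) indep_vars_imp_indep_var:
  fixes Y :: "'i \<Rightarrow> 'a \<Rightarrow> real"
  assumes indep: "indep_vars (\<lambda>_. borel) Y I" and ij: "i \<in> I" "j \<in> I" "i \<noteq> j"
  shows "indep_var borel (Y i) borel (Y j)"
proof -
  have "indep_var borel ((\<lambda>f. f i) \<circ> (\<lambda>\<omega>. restrict (\<lambda>i. Y i \<omega>) {i}))
      borel ((\<lambda>f. f j) \<circ> (\<lambda>\<omega>. restrict (\<lambda>i. Y i \<omega>) {j}))"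
    by (rule indep_var_compose[OF indep_var_restrict[OF indep]]) (use ij in auto)
  then show ?thesis by (simp add: comp_def)
qed

text \<open>The variables need not be centred: products of distinct ones factor into means, and the
  squared sum of the means is bounded by Cauchy-Schwarz. That second term is the part which
  averaging cannot reduce.\<close>

lemma (in prob_space) second_moment_indep_sum:
  fixes Y :: "'i \<Rightarrow> 'a \<Rightarrow> real"
  assumes I: "finite I" and indep: "indep_vars (\<lambda>_. borel) Y I"
    and Y: "\<And>i. i \<in> I \<Longrightarrow> Y i \<in> square_integrable M"
  shows "expectation (\<lambda>\<omega>. (\<Sum>i\<in>I. Y i \<omega>)\<^sup>2) \<le>
    (\<Sum>i\<in>I. expectation (\<lambda>\<omega>. (Y i \<omega>)\<^sup>2)) + card I * (\<Sum>i\<in>I. (expectation (Y i))\<^sup>2)"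
proof -
  have int: "integrable M (Y i)" if "i \<in> I" for i
    by (rule square_integrable_integrable[OF finite_measure_axioms Y[OF that]])
  have pair: "expectation (\<lambda>\<omega>. Y i \<omega> * Y j \<omega>) \<le>
      expectation (Y i) * expectation (Y j) + (if i = j then expectation (\<lambda>\<omega>. (Y i \<omega>)\<^sup>2) else 0)"
    if ij: "i \<in> I" "j \<in> I" for i j
  proof (cases "i = j")
    case True
    then show ?thesis by (simp add: power2_eq_square)
  next
    case False
    have "indep_var borel (Y i) borel (Y j)"
      by (rule indep_vars_imp_indep_var[OF indep ij False])
    then show ?thesis using False
      by (simp add: indep_var_lebesgue_integral int ij)
  qed
  have "expectation (\<lambda>\<omega>. (\<Sum>i\<in>I. Y i \<omega>)\<^sup>2) = (\<Sum>i\<in>I. \<Sum>j\<in>I. expectation (\<lambda>\<omega>. Y i \<omega> * Y j \<omega>))"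
    using integral_sum_sq[of I Y M "\<lambda>_. 1", OF Y] by simp
  also have "\<dots> \<le> (\<Sum>i\<in>I. \<Sum>j\<in>I. expectation (Y i) * expectation (Y j)
      + (if i = j then expectation (\<lambda>\<omega>. (Y i \<omega>)\<^sup>2) else 0))"
    by (intro sum_mono pair)
  also have "\<dots> = (\<Sum>i\<in>I. expectation (Y i))\<^sup>2 + (\<Sum>i\<in>I. expectation (\<lambda>\<omega>. (Y i \<omega>)\<^sup>2))"
    by (simp add: sum.distrib power2_eq_square sum_product I)
  also have "(\<Sum>i\<in>I. expectation (Y i))\<^sup>2 \<le> card I * (\<Sum>i\<in>I. (expectation (Y i))\<^sup>2)"
    using Cauchy_Schwarz_ineq_sum[of "\<lambda>_. 1" "\<lambda>i. expectation (Y i)" I] by simp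
  finally show ?thesis by simp
qed

lemma sum_mean_sq_le:
  fixes a :: "'i \<Rightarrow> real"
  assumes "finite I" "I \<noteq> {}"
  shows "((\<Sum>i\<in>I. a i) / card I)\<^sup>2 \<le> (\<Sum>i\<in>I. (a i)\<^sup>2) / card I"
proof -
  have c: "real (card I) > 0" using assms by (simp add: card_gt_0_iff)
  have "(\<Sum>i\<in>I. a i)\<^sup>2 \<le> card I * (\<Sum>i\<in>I. (a i)\<^sup>2)"
    using Cauchy_Schwarz_ineq_sum[of "\<lambda>_. 1" a I] by simp
  then show ?thesis using c by (simp add: power_divide divide_le_eq power2_eq_square field_simps)
qed

lemma sq_sum3_le: "(x + y + z)\<^sup>2 \<le> 3 * (x\<^sup>2 + y\<^sup>2 + (z::real)\<^sup>2)"
proof -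
  have "0 \<le> (x - y)\<^sup>2 + (y - z)\<^sup>2 + (x - z)\<^sup>2" by simp
  then show ?thesis by (simp add: power2_eq_square algebra_simps)
qed

lemma pow4_sum_le: "(x + y) ^ 4 \<le> 8 * x ^ 4 + 8 * (y::real) ^ 4"
proof -
  have 1: "(a + b)\<^sup>2 \<le> 2 * a\<^sup>2 + 2 * b\<^sup>2" for a b :: real
    using sum_squares_bound[of a b] by (simp add: power2_sum)
  have "(x + y) ^ 4 = ((x + y)\<^sup>2)\<^sup>2" by simp
  also have "\<dots> \<le> (2 * x\<^sup>2 + 2 * y\<^sup>2)\<^sup>2" by (intro power_mono 1) auto
  also have "\<dots> \<le> 2 * (2 * x\<^sup>2)\<^sup>2 + 2 * (2 * y\<^sup>2)\<^sup>2" by (rule 1)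
  finally show ?thesis by (simp add: power_mult_distrib)
qed

text \<open>The fourth power comes from values outside the quantization range. The constant is 385 =
  1 + 8 * 48, with 8 from separating signal and noise in the fourth power and 48 from the fourth
  moment of the noise.\<close>

lemma (in noise_level) quantization_error_integral:
  assumes k: "k \<in> S" and e [measurable]: "e \<in> borel_measurable M"
    and eb: "\<And>\<omega>. \<omega> \<in> space M \<Longrightarrow> (e \<omega>)\<^sup>2 \<le> (1 + (g + \<sigma> * \<xi> k \<omega>) ^ 4) / n\<^sup>2" and \<sigma>: "\<bar>\<sigma>\<bar> \<le> 1"
  shows "e \<in> square_integrable M" "expectation (\<lambda>\<omega>. (e \<omega>)\<^sup>2) \<le> (385 + 8 * g ^ 4) / n\<^sup>2"
proof -
  let ?h = "\<lambda>\<omega>. (1 + (8 * g ^ 4 + 8 * \<xi> k \<omega> ^ 4)) / n\<^sup>2"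
  have h: "integrable M ?h" using noise_int4_single[OF k] by simp
  have le: "(e \<omega>)\<^sup>2 \<le> ?h \<omega>" if "\<omega> \<in> space M" for \<omega>
  proof -
    have s4: "\<sigma> ^ 4 \<le> 1" using \<sigma> power_le_one[of "\<bar>\<sigma>\<bar>" 4] by simp
    have "(g + \<sigma> * \<xi> k \<omega>) ^ 4 \<le> 8 * g ^ 4 + 8 * (\<sigma> * \<xi> k \<omega>) ^ 4" by (rule pow4_sum_le)
    also have "(\<sigma> * \<xi> k \<omega>) ^ 4 \<le> 1 * \<xi> k \<omega> ^ 4"
      unfolding power_mult_distrib using s4 by (intro mult_right_mono) auto
    finally have "(1 + (g + \<sigma> * \<xi> k \<omega>) ^ 4) / n\<^sup>2 \<le> ?h \<omega>"
      by (intro divide_right_mono) auto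
    then show ?thesis using eb[OF that] by linarith
  qed
  show e2: "e \<in> square_integrable M"
    unfolding square_integrable_def
    by (auto intro!: Bochner_Integration.integrable_bound[OF h] e AE_I2 intro: order_trans[OF le])
  have "expectation (\<lambda>\<omega>. (e \<omega>)\<^sup>2) \<le> expectation ?h"
    by (intro integral_mono' h le) auto
  also have "expectation ?h = (1 + (8 * g ^ 4 + 8 * expectation (\<lambda>\<omega>. \<xi> k \<omega> ^ 4))) / n\<^sup>2"
    using noise_int4_single[OF k] by (simp add: prob_space)
  also have "\<dots> \<le> (385 + 8 * g ^ 4) / n\<^sup>2"
    using noise_moment4_single[OF k] by (intro divide_right_mono) auto
  finally show "expectation (\<lambda>\<omega>. (e \<omega>)\<^sup>2) \<le> (385 + 8 * g ^ 4) / n\<^sup>2" .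
qed

text \<open>The error of the averaged estimator splits into a quantization part, the averaged noise that
  passes the test, and the signal lost by the machines that do not transmit. In the second part
  independence only helps with the centred noise; its mean is controlled by \<open>selection_bias\<close>.\<close>

lemma level_risk:
  fixes \<xi> :: "'i \<Rightarrow> 'k \<Rightarrow> 'a \<Rightarrow> real" and e :: "'i \<Rightarrow> 'k \<Rightarrow> 'a \<Rightarrow> real"
    and n :: real
  assumes I: "finite I" "I \<noteq> {}"
    and lev: "\<And>i. i \<in> I \<Longrightarrow> noise_level M S (\<xi> i)"
    and D_def: "\<And>i. i \<in> I \<Longrightarrow> D i = noise_level.detect M S (\<xi> i) g \<sigma> \<theta>"
    and indep: "\<And>k. k \<in> S \<Longrightarrow> prob_space.indep_vars M (\<lambda>_. borel) (\<lambda>i \<omega>. D i \<omega> * \<xi> i k \<omega>) I"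
    and e: "\<And>i k. i \<in> I \<Longrightarrow> k \<in> S \<Longrightarrow> e i k \<in> borel_measurable M"
    and eb: "\<And>i k \<omega>. i \<in> I \<Longrightarrow> k \<in> S \<Longrightarrow> \<omega> \<in> space M \<Longrightarrow>
       (e i k \<omega>)\<^sup>2 \<le> (1 + (g k + \<sigma> * \<xi> i k \<omega>) ^ 4) / n\<^sup>2"
    and \<sigma>: "\<sigma>\<^sup>2 = card I / n" and n: "n \<ge> card I"
    and miss: "\<And>i. i \<in> I \<Longrightarrow> (\<Sum>k\<in>S. (g k)\<^sup>2) * (1 - (\<integral>\<omega>. D i \<omega> \<partial>M)) \<le> B"
    and noise: "\<And>i. i \<in> I \<Longrightarrow> (\<integral>\<omega>. D i \<omega> * (\<Sum>k\<in>S. (\<xi> i k \<omega>)\<^sup>2) \<partial>M) \<le> N"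
  defines "c \<equiv> \<lambda>k \<omega>. (\<Sum>i\<in>I. D i \<omega> * (g k + \<sigma> * \<xi> i k \<omega> + e i k \<omega>)) / card I"
  shows "integrable M (\<lambda>\<omega>. \<Sum>k\<in>S. (c k \<omega> - g k)\<^sup>2)"
    and "(\<integral>\<omega>. (\<Sum>k\<in>S. (c k \<omega> - g k)\<^sup>2) \<partial>M) \<le>
      3 * ((\<Sum>k\<in>S. 385 + 8 * g k ^ 4) / n\<^sup>2 + (N / n + 4 * card I / n) + B)"
proof -
  define m where "m = real (card I)"
  have m: "m > 0" using I by (simp add: m_def card_gt_0_iff)
  have n0: "n > 0" using m n by (simp add: m_def)
  obtain i0 where i0: "i0 \<in> I" using I by auto
  interpret L0: noise_level M S "\<xi> i0" by (rule lev[OF i0])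
  note fS = L0.finite_S
  have \<sigma>1: "\<bar>\<sigma>\<bar> \<le> 1"
  proof -
    have "\<sigma>\<^sup>2 \<le> 1\<^sup>2" using n n0 m by (simp add: \<sigma> m_def)
    then show ?thesis using abs_le_square_iff[of \<sigma> 1] by simp
  qed
  have D01: "D i \<omega> = 0 \<or> D i \<omega> = 1" if "i \<in> I" for i \<omega>
    using that lev noise_level.detect_cases by (metis D_def)
  have Dm [measurable]: "D i \<in> borel_measurable M" if "i \<in> I" for i
    using that lev noise_level.detect_meas by (metis D_def)
  have Di: "integrable M (D i)" if "i \<in> I" for i
    using that lev noise_level.detect_integrable by (metis D_def)
  have \<xi>m [measurable]: "\<xi> i k \<in> borel_measurable M" if "i \<in> I" "k \<in> S" for i k
    using that lev noise_level.noise_meas by metis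
  note e [measurable]
  have esq: "e i k \<in> square_integrable M" "(\<integral>\<omega>. (e i k \<omega>)\<^sup>2 \<partial>M) \<le> (385 + 8 * g k ^ 4) / n\<^sup>2"
    if "i \<in> I" "k \<in> S" for i k
    using noise_level.quantization_error_integral[OF lev[OF that(1)] that(2) e[OF that] _ \<sigma>1, where g = "g k" and n = n]
      eb[OF that] by blast+
  have \<xi>sq: "\<xi> i k \<in> square_integrable M" if "i \<in> I" "k \<in> S" for i k
    using that lev noise_level.noise_square_integrable by metis
  have Desq: "(\<lambda>\<omega>. D i \<omega> * e i k \<omega>) \<in> square_integrable M" if "i \<in> I" "k \<in> S" for i k
  proof (rule square_integrable_bound[OF esq(1)[OF that]])
    show "(\<lambda>\<omega>. D i \<omega> * e i k \<omega>) \<in> borel_measurable M" using that by measurable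
    show "\<bar>D i \<omega> * e i k \<omega>\<bar> \<le> \<bar>e i k \<omega>\<bar>" for \<omega> using D01[OF that(1), of \<omega>] by auto
  qed
  have D\<xi>sq: "(\<lambda>\<omega>. D i \<omega> * \<xi> i k \<omega>) \<in> square_integrable M" if "i \<in> I" "k \<in> S" for i k
  proof (rule square_integrable_bound[OF \<xi>sq[OF that]])
    show "(\<lambda>\<omega>. D i \<omega> * \<xi> i k \<omega>) \<in> borel_measurable M" using that by measurable
    show "\<bar>D i \<omega> * \<xi> i k \<omega>\<bar> \<le> \<bar>\<xi> i k \<omega>\<bar>" for \<omega> using D01[OF that(1), of \<omega>] by auto
  qed
  have const: "(\<lambda>\<omega>. a) \<in> square_integrable M" for a :: real by (simp add: square_integrable_def)
  have Dsq: "D i \<in> square_integrable M" if "i \<in> I" for i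
  proof (rule square_integrable_bound[OF const[of 1]])
    show "D i \<in> borel_measurable M" using that by measurable
    show "\<bar>D i \<omega>\<bar> \<le> \<bar>1\<bar>" for \<omega> using D01[OF that, of \<omega>] by auto
  qed
  \<comment> \<open>\<open>x\<close> collects the quantization errors of the transmitting machines,
    \<open>y\<close> their noise, and \<open>z\<close> is the proportion of silent machines; each of
    those contributes 0 in place of \<open>g k\<close>.\<close>
  define x where "x k \<omega> = (\<Sum>i\<in>I. D i \<omega> * e i k \<omega>) / m" for k \<omega>
  define y where "y k \<omega> = \<sigma> / m * (\<Sum>i\<in>I. D i \<omega> * \<xi> i k \<omega>)" for k \<omega>
  define z where "z \<omega> = (\<Sum>i\<in>I. 1 - D i \<omega>) / m" for \<omega>
  have split: "c k \<omega> - g k = x k \<omega> + y k \<omega> + (- g k) * z \<omega>" for k \<omega>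
    unfolding c_def x_def y_def z_def using m I
    by (simp add: m_def sum.distrib sum_subtractf field_simps sum_distrib_left)
  have xs: "x k \<in> square_integrable M" if "k \<in> S" for k
    unfolding x_def[abs_def] divide_inverse
    by (subst mult.commute) (intro square_integrable_cmult square_integrable_sum Desq that)
  have ys: "y k \<in> square_integrable M" if "k \<in> S" for k
    unfolding y_def[abs_def] by (intro square_integrable_cmult square_integrable_sum D\<xi>sq that)
  have zs: "z \<in> square_integrable M"
    unfolding z_def[abs_def] divide_inverse
    by (subst mult.commute) (intro square_integrable_cmult square_integrable_sum square_integrable_diff const Dsq)
  note [simp] = square_integrable_int[OF xs] square_integrable_int[OF ys] square_integrable_int[OF zs]
  have cs: "(\<lambda>\<omega>. c k \<omega> - g k) \<in> square_integrable M" if "k \<in> S" for k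
    unfolding split by (intro square_integrable_add square_integrable_cmult xs ys zs that)
  show int: "integrable M (\<lambda>\<omega>. \<Sum>k\<in>S. (c k \<omega> - g k)\<^sup>2)"
    by (intro Bochner_Integration.integrable_sum square_integrable_int cs)
  have X: "(\<integral>\<omega>. (x k \<omega>)\<^sup>2 \<partial>M) \<le> (385 + 8 * g k ^ 4) / n\<^sup>2" if k: "k \<in> S" for k
  proof -
    have "(\<integral>\<omega>. (x k \<omega>)\<^sup>2 \<partial>M) \<le> (\<integral>\<omega>. (\<Sum>i\<in>I. (e i k \<omega>)\<^sup>2) / m \<partial>M)"
    proof (rule integral_mono)
      show "integrable M (\<lambda>\<omega>. (\<Sum>i\<in>I. (e i k \<omega>)\<^sup>2) / m)"
        by (intro integrable_divide Bochner_Integration.integrable_sum square_integrable_int esq k)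
      fix \<omega>
      have "(x k \<omega>)\<^sup>2 \<le> (\<Sum>i\<in>I. (D i \<omega> * e i k \<omega>)\<^sup>2) / m"
        unfolding x_def m_def by (rule sum_mean_sq_le[OF I])
      also have "\<dots> \<le> (\<Sum>i\<in>I. (e i k \<omega>)\<^sup>2) / m"
      proof (intro divide_right_mono sum_mono)
        fix i assume "i \<in> I"
        then show "(D i \<omega> * e i k \<omega>)\<^sup>2 \<le> (e i k \<omega>)\<^sup>2" using D01[of i \<omega>] by auto
      qed (use m in simp)
      finally show "(x k \<omega>)\<^sup>2 \<le> (\<Sum>i\<in>I. (e i k \<omega>)\<^sup>2) / m" .
    qed (use k in simp)
    also have "\<dots> = (\<Sum>i\<in>I. \<integral>\<omega>. (e i k \<omega>)\<^sup>2 \<partial>M) / m"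
      using esq(1) k by (simp add: square_integrable_int)
    also have "\<dots> \<le> (\<Sum>i\<in>I. (385 + 8 * g k ^ 4) / n\<^sup>2) / m"
      using m k by (intro divide_right_mono sum_mono esq) auto
    also have "\<dots> = (385 + 8 * g k ^ 4) / n\<^sup>2" using m by (simp add: m_def)
    finally show ?thesis .
  qed
  have Y: "(\<Sum>k\<in>S. \<integral>\<omega>. (y k \<omega>)\<^sup>2 \<partial>M) \<le> N / n + 4 * m / n"
  proof -
    have "(\<Sum>k\<in>S. \<integral>\<omega>. (y k \<omega>)\<^sup>2 \<partial>M) = (\<Sum>k\<in>S. (\<sigma> / m)\<^sup>2 * (\<integral>\<omega>. (\<Sum>i\<in>I. D i \<omega> * \<xi> i k \<omega>)\<^sup>2 \<partial>M))"
      by (simp add: y_def power_mult_distrib power_divide)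
    also have "\<dots> \<le> (\<Sum>k\<in>S. (\<sigma> / m)\<^sup>2 * ((\<Sum>i\<in>I. \<integral>\<omega>. (D i \<omega> * \<xi> i k \<omega>)\<^sup>2 \<partial>M)
        + m * (\<Sum>i\<in>I. (\<integral>\<omega>. D i \<omega> * \<xi> i k \<omega> \<partial>M)\<^sup>2)))"
      unfolding m_def
      by (intro sum_mono mult_left_mono L0.second_moment_indep_sum I indep D\<xi>sq) auto
    also have "\<dots> = (\<sigma> / m)\<^sup>2 * ((\<Sum>i\<in>I. \<Sum>k\<in>S. \<integral>\<omega>. (D i \<omega> * \<xi> i k \<omega>)\<^sup>2 \<partial>M)
        + m * (\<Sum>i\<in>I. \<Sum>k\<in>S. (\<integral>\<omega>. D i \<omega> * \<xi> i k \<omega> \<partial>M)\<^sup>2))"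
      unfolding sum_distrib_left[symmetric] sum.distrib
      by (subst (1 2) sum.swap) simp
    also have "\<dots> \<le> (\<sigma> / m)\<^sup>2 * ((\<Sum>i\<in>I. N) + m * (\<Sum>i\<in>I. 4))"
    proof (intro mult_left_mono add_mono sum_mono)
      fix i assume i: "i \<in> I"
      have "(\<Sum>k\<in>S. \<integral>\<omega>. (D i \<omega> * \<xi> i k \<omega>)\<^sup>2 \<partial>M) = (\<integral>\<omega>. (\<Sum>k\<in>S. (D i \<omega> * \<xi> i k \<omega>)\<^sup>2) \<partial>M)"
        by (intro Bochner_Integration.integral_sum[symmetric] square_integrable_int D\<xi>sq i)
      also have "\<dots> = (\<integral>\<omega>. D i \<omega> * (\<Sum>k\<in>S. (\<xi> i k \<omega>)\<^sup>2) \<partial>M)"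
      proof (intro Bochner_Integration.integral_cong refl)
        fix \<omega>
        show "(\<Sum>k\<in>S. (D i \<omega> * \<xi> i k \<omega>)\<^sup>2) = D i \<omega> * (\<Sum>k\<in>S. (\<xi> i k \<omega>)\<^sup>2)"
          using D01[OF i, of \<omega>] by auto
      qed
      also have "\<dots> \<le> N" by (rule noise[OF i])
      finally show "(\<Sum>k\<in>S. \<integral>\<omega>. (D i \<omega> * \<xi> i k \<omega>)\<^sup>2 \<partial>M) \<le> N" .
      show "(\<Sum>k\<in>S. (\<integral>\<omega>. D i \<omega> * \<xi> i k \<omega> \<partial>M)\<^sup>2) \<le> 4"
        unfolding D_def[OF i] by (rule noise_level.selection_bias[OF lev[OF i]])
    qed (use m in auto)
    \<comment> \<open>The prefactor is 1/(m n). The diagonal terms are m in number, whereas the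
      selection bias carries m^2, so \<open>N\<close> loses the factor m and the bias keeps
      it.\<close>
    also have "\<dots> = N / n + 4 * m / n"
      using m n0 by (simp add: power_divide \<sigma> flip: m_def) (simp add: power2_eq_square field_simps)
    finally show ?thesis .
  qed
  have Z: "(\<Sum>k\<in>S. (g k)\<^sup>2) * (\<integral>\<omega>. (z \<omega>)\<^sup>2 \<partial>M) \<le> B"
  proof -
    have g0: "0 \<le> (\<Sum>k\<in>S. (g k)\<^sup>2)" by (intro sum_nonneg) auto
    have "(\<integral>\<omega>. (z \<omega>)\<^sup>2 \<partial>M) \<le> (\<integral>\<omega>. (\<Sum>i\<in>I. 1 - D i \<omega>) / m \<partial>M)"
    proof (rule integral_mono)
      show "integrable M (\<lambda>\<omega>. (\<Sum>i\<in>I. 1 - D i \<omega>) / m)"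
        using Di by simp
      fix \<omega>
      have "(z \<omega>)\<^sup>2 \<le> (\<Sum>i\<in>I. (1 - D i \<omega>)\<^sup>2) / m"
        unfolding z_def m_def by (rule sum_mean_sq_le[OF I])
      also have "\<dots> = (\<Sum>i\<in>I. 1 - D i \<omega>) / m"
      proof (intro arg_cong2[of _ _ _ _ "(/)"] sum.cong refl)
        fix i assume "i \<in> I"
        then show "(1 - D i \<omega>)\<^sup>2 = 1 - D i \<omega>" using D01[of i \<omega>] by auto
      qed
      finally show "(z \<omega>)\<^sup>2 \<le> (\<Sum>i\<in>I. 1 - D i \<omega>) / m" .
    qed simp
    also have "\<dots> = (\<Sum>i\<in>I. 1 - (\<integral>\<omega>. D i \<omega> \<partial>M)) / m"
      using Di by (simp add: L0.prob_space)
    finally have "(\<Sum>k\<in>S. (g k)\<^sup>2) * (\<integral>\<omega>. (z \<omega>)\<^sup>2 \<partial>M) \<le>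
        (\<Sum>k\<in>S. (g k)\<^sup>2) * ((\<Sum>i\<in>I. 1 - (\<integral>\<omega>. D i \<omega> \<partial>M)) / m)"
      by (intro mult_left_mono g0)
    also have "\<dots> = (\<Sum>i\<in>I. (\<Sum>k\<in>S. (g k)\<^sup>2) * (1 - (\<integral>\<omega>. D i \<omega> \<partial>M))) / m"
      by (simp flip: sum_distrib_left)
    also have "\<dots> \<le> (\<Sum>i\<in>I. B) / m"
      using m by (intro divide_right_mono sum_mono miss) auto
    also have "\<dots> = B" using m by (simp add: m_def)
    finally show ?thesis .
  qed
  have "(\<integral>\<omega>. (\<Sum>k\<in>S. (c k \<omega> - g k)\<^sup>2) \<partial>M) \<le>
     (\<integral>\<omega>. (\<Sum>k\<in>S. 3 * ((x k \<omega>)\<^sup>2 + (y k \<omega>)\<^sup>2 + (g k)\<^sup>2 * (z \<omega>)\<^sup>2)) \<partial>M)"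
  proof (intro integral_mono int sum_mono)
    show "integrable M (\<lambda>\<omega>. \<Sum>k\<in>S. 3 * ((x k \<omega>)\<^sup>2 + (y k \<omega>)\<^sup>2 + (g k)\<^sup>2 * (z \<omega>)\<^sup>2))"
      by (intro Bochner_Integration.integrable_sum) auto
    show "(c k \<omega> - g k)\<^sup>2 \<le> 3 * ((x k \<omega>)\<^sup>2 + (y k \<omega>)\<^sup>2 + (g k)\<^sup>2 * (z \<omega>)\<^sup>2)" for k \<omega>
      unfolding split using sq_sum3_le[of "x k \<omega>" "y k \<omega>" "- g k * z \<omega>"] by (simp add: power_mult_distrib)
  qed
  also have "\<dots> = (\<Sum>k\<in>S. 3 * ((\<integral>\<omega>. (x k \<omega>)\<^sup>2 \<partial>M) + (\<integral>\<omega>. (y k \<omega>)\<^sup>2 \<partial>M) + (g k)\<^sup>2 * (\<integral>\<omega>. (z \<omega>)\<^sup>2 \<partial>M)))"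
    by (subst Bochner_Integration.integral_sum) auto
  also have "\<dots> = 3 * ((\<Sum>k\<in>S. \<integral>\<omega>. (x k \<omega>)\<^sup>2 \<partial>M) + (\<Sum>k\<in>S. \<integral>\<omega>. (y k \<omega>)\<^sup>2 \<partial>M)
      + (\<Sum>k\<in>S. (g k)\<^sup>2) * (\<integral>\<omega>. (z \<omega>)\<^sup>2 \<partial>M))"
    by (simp add: sum_distrib_left sum_distrib_right sum.distrib)
  also have "\<dots> \<le> 3 * ((\<Sum>k\<in>S. (385 + 8 * g k ^ 4) / n\<^sup>2) + (N / n + 4 * m / n) + B)"
    by (intro mult_left_mono add_mono sum_mono X Y Z) auto
  finally show "(\<integral>\<omega>. (\<Sum>k\<in>S. (c k \<omega> - g k)\<^sup>2) \<partial>M) \<le>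
      3 * ((\<Sum>k\<in>S. 385 + 8 * g k ^ 4) / n\<^sup>2 + (N / n + 4 * card I / n) + B)"
    by (simp add: m_def sum_divide_distrib)
qed

section \<open>Messages\<close>

text \<open>The cells \<open>\<lfloor>n x\<rfloor>\<close> for \<open>\<bar>x\<bar> \<le> n\<close> are numbered by \<open>0, \<dots>, 2 n\<^sup>2\<close>; a value outside
  \<open>[-n, n]\<close> is sent as \<open>0\<close>, which costs at most \<open>x\<^sup>2 \<le> x\<^sup>4 / n\<^sup>2\<close>.\<close>

definition quantize :: "nat \<Rightarrow> real \<Rightarrow> nat" where
  "quantize n x = (if \<bar>x\<bar> \<le> real n then nat (\<lfloor>real n * x\<rfloor> + (int n)\<^sup>2) else n\<^sup>2)"

text \<open>Subtracting \<open>n\<^sup>2\<close> undoes the shift that makes the cell numbers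
  nonnegative; the code \<open>n\<^sup>2\<close> used for values out of range is thus read as the
  real number 0.\<close>

definition dequantize :: "nat \<Rightarrow> nat \<Rightarrow> real" where
  "dequantize n z = (real z - (real n)\<^sup>2) / real n"

lemma quantize_le: "quantize n x \<le> 2 * n\<^sup>2"
proof (cases "\<bar>x\<bar> \<le> real n")
  case True
  have "real n * x \<le> real n * real n" using True by (intro mult_left_mono) auto
  then have "\<lfloor>real n * x\<rfloor> \<le> (int n)\<^sup>2"
    by (metis floor_mono floor_of_nat of_nat_mult of_nat_power power2_eq_square)
  then have "nat (\<lfloor>real n * x\<rfloor> + (int n)\<^sup>2) \<le> nat (2 * (int n)\<^sup>2)" by (intro nat_mono) simp
  also have "\<dots> = 2 * n\<^sup>2" by (simp add: nat_mult_distrib nat_power_eq)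
  finally show ?thesis using True by (simp add: quantize_def)
qed (simp add: quantize_def)

lemma quantize_error:
  assumes n: "n > 0"
  shows "(dequantize n (quantize n x) - x)\<^sup>2 \<le> (1 + x ^ 4) / (real n)\<^sup>2"
proof (cases "\<bar>x\<bar> \<le> real n")
  case True
  have "real n * (- x) \<le> real n * real n" using True by (intro mult_left_mono) auto
  then have "- ((real n)\<^sup>2) \<le> real n * x" by (simp add: power2_eq_square)
  then have "- ((int n)\<^sup>2) \<le> \<lfloor>real n * x\<rfloor>" by (simp add: le_floor_iff)
  then have "real (quantize n x) = of_int \<lfloor>real n * x\<rfloor> + (real n)\<^sup>2"
    using True by (simp add: quantize_def)
  then have q: "dequantize n (quantize n x) - x = (of_int \<lfloor>real n * x\<rfloor> - real n * x) / real n"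
    using n by (simp add: dequantize_def field_simps)
  have "\<bar>of_int \<lfloor>real n * x\<rfloor> - real n * x\<bar> \<le> 1" by linarith
  then have "(of_int \<lfloor>real n * x\<rfloor> - real n * x)\<^sup>2 \<le> 1" by (simp add: abs_square_le_1)
  then show ?thesis unfolding q power_divide
    by (intro divide_right_mono) (auto intro: add_increasing2)
next
  case False
  then have "(real n)\<^sup>2 \<le> x\<^sup>2" by (simp add: abs_le_square_iff[symmetric])
  then have "(real n)\<^sup>2 * x\<^sup>2 \<le> x\<^sup>2 * x\<^sup>2" by (intro mult_right_mono) auto
  then have "x\<^sup>2 \<le> x ^ 4 / (real n)\<^sup>2" using n by (simp add: field_simps power4_eq_xxxx power2_eq_square)
  also have "\<dots> \<le> (1 + x ^ 4) / (real n)\<^sup>2" by (intro divide_right_mono) auto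
  finally show ?thesis using False n by (simp add: quantize_def dequantize_def)
qed

lemma quantize_measurable [measurable]: "quantize n \<in> borel \<rightarrow>\<^sub>M count_space UNIV"
proof -
  have [measurable]: "(\<lambda>x. \<lfloor>real n * x\<rfloor>) \<in> borel \<rightarrow>\<^sub>M count_space UNIV" by measurable
  show ?thesis unfolding quantize_def[abs_def] by measurable
qed

text \<open>The length is fixed for every argument, also outside the range of injectivity, so that
  length computations and the parsing of messages need no range condition.\<close>

lemma finite_code_exists: "\<exists>c :: nat \<Rightarrow> bool list. inj_on c {..<2 ^ b} \<and> (\<forall>z. length (c z) = b)"
proof -
  let ?X = "{xs :: bool list. set xs \<subseteq> UNIV \<and> length xs = b}"
  have X: "finite ?X" "card ?X = 2 ^ b"
    using card_lists_length_eq[of "UNIV :: bool set" b] finite_lists_length_eq[of "UNIV :: bool set" b]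
    by (auto simp: card_UNIV_bool)
  obtain f where f: "f ` {..<(2::nat) ^ b} \<subseteq> ?X" "inj_on f {..<(2::nat) ^ b}"
    using card_le_inj[of "{..<(2::nat) ^ b}" ?X] X by auto
  define c where "c z = (if z < 2 ^ b then f z else replicate b True)" for z
  have "inj_on c {..<2 ^ b}" using f(2) by (auto simp: inj_on_def c_def)
  moreover have "length (c z) = b" for z using f(1) by (auto simp: c_def)
  ultimately show ?thesis by blast
qed

text \<open>Unique parsing: the hypothesis is a prefix condition at each position, so the first
  blocks agree and can be cancelled from both streams. It is used twice, for the code words within a
  level and for the levels within a message.\<close>

lemma concat_prefix_code_eq:
  assumes "\<And>j r r'. j \<in> set js \<Longrightarrow> F j @ r = F' j @ r' \<Longrightarrow> F j = F' j"
    and "concat (map F js) @ r = concat (map F' js) @ r'"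
  shows "\<forall>j\<in>set js. F j = F' j"
  using assms
proof (induction js)
  case (Cons j js)
  have "F j @ (concat (map F js) @ r) = F' j @ (concat (map F' js) @ r')"
    using Cons.prems(2) by simp
  from this have j: "F j = F' j" by (rule Cons.prems(1)[rotated]) simp
  have "\<forall>j\<in>set js. F j = F' j"
  proof (rule Cons.IH)
    show "concat (map F js) @ r = concat (map F' js) @ r'" using Cons.prems(2) j by simp
    show "F i = F' i" if "i \<in> set js" "F i @ s = F' i @ s'" for i s s'
      using Cons.prems(1)[OF _ that(2)] that(1) by simp
  qed
  then show ?case using j by simp
qed simp

text \<open>The leading flag makes the block self-delimiting: the number and the length of the code
  words that follow a \<open>True\<close> are known in advance. A silent level costs one
  bit.\<close>

definition chunk :: "(nat \<Rightarrow> bool list) \<Rightarrow> bool \<Rightarrow> nat \<Rightarrow> (nat \<Rightarrow> nat) \<Rightarrow> bool list" where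
  "chunk c D d z = (if D then True # concat (map (\<lambda>k. c (z k)) [1..<d + 1]) else [False])"

lemma chunk_prefix_code:
  assumes len: "\<And>z. length (c z) = b" and eq: "chunk c D d z @ r = chunk c D' d z' @ r'"
  shows "D = D'" "chunk c D d z = chunk c D' d z'"
proof -
  show D: "D = D'" using eq by (auto simp: chunk_def split: if_splits)
  have "length (chunk c D d z) = length (chunk c D' d z')"
    using len by (simp add: chunk_def D length_concat comp_def)
  then show "chunk c D d z = chunk c D' d z'" using eq by simp
qed

lemma chunk_inj:
  assumes inj: "inj_on c A" and len: "\<And>z. length (c z) = b"
    and z: "\<And>k. z k \<in> A" "\<And>k. z' k \<in> A" and eq: "chunk c True d z = chunk c True d z'"
    and k: "k \<in> {1..d}"
  shows "z k = z' k"
proof -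
  have "\<forall>k\<in>set [1..<d+1]. c (z k) = c (z' k)"
  proof (rule concat_prefix_code_eq)
    show "concat (map (\<lambda>k. c (z k)) [1..<d + 1]) @ [] = concat (map (\<lambda>k. c (z' k)) [1..<d + 1]) @ []"
      using eq by (simp add: chunk_def)
    fix j r r' assume "c (z j) @ r = c (z' j) @ r'"
    then show "c (z j) = c (z' j)" using len by simp
  qed
  then have "c (z k) = c (z' k)" using k by (simp only: set_upt) simp
  then show ?thesis by (rule inj_onD[OF inj _ z])
qed

lemma length_chunk:
  assumes "\<And>z. length (c z) = b"
  shows "length (chunk c D d z) = 1 + (if D then d * b else 0)"
  using assms by (simp add: chunk_def length_concat comp_def sum_list_triv)

definition encode ::
  "(nat \<Rightarrow> bool list) \<Rightarrow> nat \<Rightarrow> (nat \<Rightarrow> bool) \<Rightarrow> (nat \<Rightarrow> nat \<Rightarrow> nat) \<Rightarrow> bool list" where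
  "encode c J D z = concat (map (\<lambda>j. chunk c (D j) (2 ^ j) (z j)) [0..<J])"

lemma length_encode:
  assumes "\<And>z. length (c z) = b"
  shows "length (encode c J D z) = J + b * (\<Sum>j<J. if D j then 2 ^ j else 0)"
proof -
  have "length (encode c J D z) = (\<Sum>j<J. 1 + (if D j then 2 ^ j * b else 0))"
    unfolding encode_def length_concat map_map comp_def length_chunk[OF assms]
    by (simp add: sum_list_distinct_conv_sum_set atLeast0LessThan)
  also have "\<dots> = J + (\<Sum>j<J. if D j then 2 ^ j * b else 0)"
    by (simp only: sum.distrib) simp
  also have "(\<Sum>j<J. if D j then 2 ^ j * b else 0) = b * (\<Sum>j<J. if D j then 2 ^ j else 0)"
    unfolding sum_distrib_left by (intro sum.cong) auto
  finally show ?thesis .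
qed

lemma encode_inj:
  assumes inj: "inj_on c A" and len: "\<And>z. length (c z) = b"
    and z: "\<And>j k. z j k \<in> A" "\<And>j k. z' j k \<in> A" and eq: "encode c J D z = encode c J D' z'"
    and j: "j < J"
  shows "D j = D' j" "D j \<Longrightarrow> k \<in> {1..2 ^ j} \<Longrightarrow> z j k = z' j k"
proof -
  have "\<forall>j\<in>set [0..<J]. chunk c (D j) (2 ^ j) (z j) = chunk c (D' j) (2 ^ j) (z' j)"
  proof (rule concat_prefix_code_eq)
    show "concat (map (\<lambda>j. chunk c (D j) (2 ^ j) (z j)) [0..<J]) @ [] =
       concat (map (\<lambda>j. chunk c (D' j) (2 ^ j) (z' j)) [0..<J]) @ []"
      using eq by (simp add: encode_def)
    fix j r r' assume "chunk c (D j) (2 ^ j) (z j) @ r = chunk c (D' j) (2 ^ j) (z' j) @ r'"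
    then show "chunk c (D j) (2 ^ j) (z j) = chunk c (D' j) (2 ^ j) (z' j)"
      by (rule chunk_prefix_code(2)[OF len])
  qed
  then have e: "chunk c (D j) (2 ^ j) (z j) = chunk c (D' j) (2 ^ j) (z' j)" using j by simp
  then have "chunk c (D j) (2 ^ j) (z j) @ [] = chunk c (D' j) (2 ^ j) (z' j) @ []" by simp
  then show D: "D j = D' j" by (rule chunk_prefix_code(1)[OF len])
  assume Dj: "D j" and k: "k \<in> {1..2 ^ j}"
  show "z j k = z' j k"
    by (rule chunk_inj[OF inj len z]) (use e D Dj k in auto)
qed

text \<open>The decoder picks any preimage of the message. Preimages may differ, but only in values
  that were not transmitted, and those are read as 0 anyway.\<close>

lemma decoder_exists:
  assumes inj: "inj_on c A" and len: "\<And>z. length (c z) = b"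
  shows "\<exists>Q :: bool list \<Rightarrow> nat \<Rightarrow> nat \<Rightarrow> real. \<forall>D z j k. (\<forall>j k. z j k \<in> A) \<longrightarrow> j < J \<longrightarrow> k \<in> {1..2 ^ j} \<longrightarrow>
    Q (encode c J D z) j k = (if D j then r (z j k) else 0)"
proof -
  define Q where "Q y j k = (SOME q. \<exists>D z. (\<forall>j k. z j k \<in> A) \<and> y = encode c J D z \<and>
     q = (if D j then r (z j k) else 0))" for y j k
  have "Q (encode c J D z) j k = (if D j then r (z j k) else 0)"
    if z: "\<forall>j k. z j k \<in> A" and j: "j < J" and k: "k \<in> {1..2 ^ j}" for D z j k
  proof -
    have "\<exists>D' z'. (\<forall>j k. z' j k \<in> A) \<and> encode c J D z = encode c J D' z' \<and>
       Q (encode c J D z) j k = (if D' j then r (z' j k) else 0)"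
      unfolding Q_def by (rule someI_ex) (use z in blast)
    then obtain D' z' where *: "\<forall>j k. z' j k \<in> A" "encode c J D z = encode c J D' z'"
      "Q (encode c J D z) j k = (if D' j then r (z' j k) else 0)" by blast
    have "D j = D' j" "D j \<Longrightarrow> z j k = z' j k"
      using encode_inj[OF inj len _ _ *(2) j] z *(1) k by blast+
    then show ?thesis using *(3) by auto
  qed
  then show ?thesis by blast
qed

section \<open>Measurability of the encoder\<close>

lemma measurable_count_space_append:
  fixes f g :: "'a \<Rightarrow> ('b :: countable) list"
  assumes f: "f \<in> M \<rightarrow>\<^sub>M count_space UNIV" and g: "g \<in> M \<rightarrow>\<^sub>M count_space UNIV"
  shows "(\<lambda>x. f x @ g x) \<in> M \<rightarrow>\<^sub>M count_space UNIV"
proof (rule measurable_compose_countable[where f = "\<lambda>i x. i @ g x" and g = f, OF _ f])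
  fix i
  show "(\<lambda>x. i @ g x) \<in> M \<rightarrow>\<^sub>M count_space UNIV"
    by (rule measurable_compose[OF g]) simp
qed

lemma measurable_concat_map:
  fixes f :: "'i \<Rightarrow> 'a \<Rightarrow> ('b :: countable) list"
  assumes "\<And>j. j \<in> set js \<Longrightarrow> f j \<in> M \<rightarrow>\<^sub>M count_space UNIV"
  shows "(\<lambda>x. concat (map (\<lambda>j. f j x) js)) \<in> M \<rightarrow>\<^sub>M count_space UNIV"
  using assms by (induction js) (auto intro: measurable_count_space_append)

lemma measurable_encode:
  assumes D: "\<And>j. j < J \<Longrightarrow> Measurable.pred M (\<lambda>x. D x j)"
    and z: "\<And>j k. j < J \<Longrightarrow> (\<lambda>x. z x j k) \<in> M \<rightarrow>\<^sub>M count_space UNIV"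
  shows "(\<lambda>x. encode c J (D x) (z x)) \<in> M \<rightarrow>\<^sub>M count_space UNIV"
  unfolding encode_def
proof (rule measurable_concat_map)
  fix j assume "j \<in> set [0..<J]"
  then have j: "j < J" by simp
  note D[OF j, measurable]
  have 1: "(\<lambda>x. concat (map (\<lambda>k. c (z x j k)) [1..<2 ^ j + 1])) \<in> M \<rightarrow>\<^sub>M count_space UNIV"
    by (intro measurable_concat_map measurable_compose[OF z[OF j]]) simp
  have [measurable]: "(\<lambda>x. True # concat (map (\<lambda>k. c (z x j k)) [1..<2 ^ j + 1])) \<in> M \<rightarrow>\<^sub>M count_space UNIV"
    by (rule measurable_compose[OF 1]) simp
  show "(\<lambda>x. chunk c (D x j) (2 ^ j) (z x j)) \<in> M \<rightarrow>\<^sub>M count_space UNIV"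
    unfolding chunk_def by measurable
qed

section \<open>Step functions in the unit interval\<close>

abbreviation unit_lebesgue :: "real measure" where
  "unit_lebesgue \<equiv> lebesgue_on {0..1}"

lemma L2_unit_eq: "L2_unit = square_integrable unit_lebesgue"
  by (simp add: L2_unit_def square_integrable_def)

lemma prob_space_unit_lebesgue: "prob_space unit_lebesgue"
  by (rule prob_spaceI) (simp add: emeasure_restrict_space)

interpretation unit: prob_space unit_lebesgue
  by (rule prob_space_unit_lebesgue)

lemma borel_measurable_unit_lebesgue:
  "g \<in> borel_measurable borel \<Longrightarrow> g \<in> borel_measurable unit_lebesgue"
  by (intro measurable_restrict_space1 measurable_completion) simp

lemma const_L2_unit: "(\<lambda>x. c) \<in> L2_unit"
  by (simp add: L2_unit_eq square_integrable_def)

lemma bounded_L2_unit: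
  assumes "f \<in> borel_measurable unit_lebesgue" "\<And>x. \<bar>f x\<bar> \<le> c"
  shows "f \<in> L2_unit"
  unfolding L2_unit_eq
proof (rule square_integrable_bound[OF const_L2_unit[unfolded L2_unit_eq, of c] assms(1)])
  show "\<bar>f x\<bar> \<le> \<bar>c\<bar>" for x using assms(2)[of x] by linarith
qed

section \<open>Truncation, continuous approximation and step functions\<close>

definition clamp :: "real \<Rightarrow> real \<Rightarrow> real" where
  "clamp B y = max (- B) (min B y)"

lemma clamp_props: "B \<ge> 0 \<Longrightarrow> \<bar>clamp B y\<bar> \<le> B" "B \<ge> 0 \<Longrightarrow> \<bar>y - clamp B y\<bar> \<le> \<bar>y\<bar>"
  "\<bar>y\<bar> \<le> B \<Longrightarrow> clamp B y = y"
  by (auto simp: clamp_def)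

lemma clamp_continuous: "continuous_on A (clamp B)"
  unfolding clamp_def[abs_def] by (intro continuous_intros)

lemma clamp_meas [measurable]: "clamp B \<in> borel_measurable borel"
  unfolding clamp_def[abs_def] by measurable

lemma sq_sum2_le: "(x + y)\<^sup>2 \<le> 2 * x\<^sup>2 + 2 * (y::real)\<^sup>2"
  using sum_squares_bound[of x y] by (simp add: power2_sum)

lemma sq_dist_triangle:
  assumes "f \<in> square_integrable M" "g \<in> square_integrable M" "h \<in> square_integrable M"
  shows "(\<integral>x. (f x - h x)\<^sup>2 \<partial>M) \<le> 2 * (\<integral>x. (f x - g x)\<^sup>2 \<partial>M) + 2 * (\<integral>x. (g x - h x)\<^sup>2 \<partial>M)"
proof -
  note [simp] = square_integrable_int[OF square_integrable_diff]
  have "(\<integral>x. (f x - h x)\<^sup>2 \<partial>M) \<le> (\<integral>x. 2 * (f x - g x)\<^sup>2 + 2 * (g x - h x)\<^sup>2 \<partial>M)"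
  proof (rule integral_mono)
    show "(f x - h x)\<^sup>2 \<le> 2 * (f x - g x)\<^sup>2 + 2 * (g x - h x)\<^sup>2" for x
      using sq_sum2_le[of "f x - g x" "g x - h x"] by simp
  qed (use assms in simp_all)
  then show ?thesis using assms by simp
qed

text \<open>A measurable function is an almost everywhere limit of continuous ones, but without any
  domination. Both sides are therefore first truncated at a level \<open>B\<close>, which supplies
  the constant dominating function; each of the two errors is made smaller than e/4, since the
  triangle inequality for squares doubles them.\<close>

lemma continuous_approximation:
  assumes f: "f \<in> L2_unit" and e: "e > 0"
  shows "\<exists>g. continuous_on UNIV g \<and> g \<in> L2_unit \<and> (\<integral>x. (f x - g x)\<^sup>2 \<partial>unit_lebesgue) \<le> e"
proof -
  note f2 = f[unfolded L2_unit_eq]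
  have fm [measurable]: "f \<in> borel_measurable unit_lebesgue" using f2 by (rule square_integrable_meas)
  have "f measurable_on {0..1}"
    using fm by (subst measurable_on_iff_borel_measurable) auto
  then obtain N g where N: "negligible N" and gc: "\<And>n. continuous_on UNIV (g n)"
    and lim: "\<And>x. x \<notin> N \<Longrightarrow> (\<lambda>n. g n x) \<longlonglongrightarrow> (if x \<in> {0..1} then f x else 0)"
    unfolding measurable_on_def by blast
  have AEN: "AE x in unit_lebesgue. x \<notin> N"
    using AE_not_in[of N lebesgue] N
    by (subst AE_restrict_space_iff) (auto simp: negligible_iff_null_sets)
  have cm: "(\<lambda>x. clamp B (f x)) \<in> L2_unit" if "B \<ge> 0" for B
    by (rule bounded_L2_unit[of _ B]) (auto simp: clamp_props that)
  have "(\<lambda>B. \<integral>x. (f x - clamp (real B) (f x))\<^sup>2 \<partial>unit_lebesgue) \<longlonglongrightarrow> (\<integral>x. 0 \<partial>unit_lebesgue)"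
  proof (rule integral_dominated_convergence)
    show "integrable unit_lebesgue (\<lambda>x. (f x)\<^sup>2)" by (rule square_integrable_int[OF f2])
    show "AE x in unit_lebesgue. (\<lambda>B. (f x - clamp (real B) (f x))\<^sup>2) \<longlonglongrightarrow> 0"
    proof (rule AE_I2)
      fix x
      obtain B0 where B0: "\<bar>f x\<bar> \<le> real B0" using real_arch_simple by blast
      have "\<forall>\<^sub>F B in sequentially. (f x - clamp (real B) (f x))\<^sup>2 = 0"
        using eventually_ge_at_top[of B0] by eventually_elim (use B0 clamp_props(3) in fastforce)
      then show "(\<lambda>B. (f x - clamp (real B) (f x))\<^sup>2) \<longlonglongrightarrow> 0"
        by (rule tendsto_eventually)
    qed
    show "AE x in unit_lebesgue. norm ((f x - clamp (real B) (f x))\<^sup>2) \<le> (f x)\<^sup>2" for B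
      by (intro AE_I2) (use clamp_props(2)[of "real B"] in \<open>simp add: abs_le_square_iff\<close>)
  qed measurable
  then have "(\<lambda>B. \<integral>x. (f x - clamp (real B) (f x))\<^sup>2 \<partial>unit_lebesgue) \<longlonglongrightarrow> 0" by simp
  from order_tendstoD(2)[OF this, of "e/4"] e obtain B where
    B: "(\<integral>x. (f x - clamp (real B) (f x))\<^sup>2 \<partial>unit_lebesgue) < e / 4"
    by (auto simp: eventually_sequentially)
  have gm [measurable]: "g n \<in> borel_measurable unit_lebesgue" for n
    by (rule borel_measurable_unit_lebesgue[OF borel_measurable_continuous_onI[OF gc]])
  have gcl: "(\<lambda>x. clamp (real B) (g n x)) \<in> L2_unit" for n
    by (rule bounded_L2_unit[of _ B]) (auto simp: clamp_props)
  have "(\<lambda>n. \<integral>x. (clamp (real B) (f x) - clamp (real B) (g n x))\<^sup>2 \<partial>unit_lebesgue) \<longlonglongrightarrow> (\<integral>x. 0 \<partial>unit_lebesgue)"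
  proof (rule integral_dominated_convergence)
    show "integrable unit_lebesgue (\<lambda>x. (2 * real B)\<^sup>2)" by simp
    show "AE x in unit_lebesgue. (\<lambda>n. (clamp (real B) (f x) - clamp (real B) (g n x))\<^sup>2) \<longlonglongrightarrow> 0"
      using AEN AE_space
    proof eventually_elim
      case (elim x)
      then have "(\<lambda>n. g n x) \<longlonglongrightarrow> f x" using lim[of x] by auto
      then have "(\<lambda>n. clamp (real B) (g n x)) \<longlonglongrightarrow> clamp (real B) (f x)"
        by (rule continuous_on_tendsto_compose[OF clamp_continuous[of UNIV]]) auto
      then have "(\<lambda>n. (clamp (real B) (f x) - clamp (real B) (g n x))\<^sup>2) \<longlonglongrightarrow>
          (clamp (real B) (f x) - clamp (real B) (f x))\<^sup>2"
        by (intro tendsto_intros)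
      then show ?case by simp
    qed
    show "AE x in unit_lebesgue. norm ((clamp (real B) (f x) - clamp (real B) (g n x))\<^sup>2) \<le> (2 * real B)\<^sup>2" for n
    proof (intro AE_I2)
      fix x
      have "\<bar>clamp (real B) (f x) - clamp (real B) (g n x)\<bar> \<le> \<bar>2 * real B\<bar>"
        using clamp_props(1)[of "real B" "f x"] clamp_props(1)[of "real B" "g n x"] by simp
      then show "norm ((clamp (real B) (f x) - clamp (real B) (g n x))\<^sup>2) \<le> (2 * real B)\<^sup>2"
        by (simp only: abs_le_square_iff real_norm_def abs_power2)
    qed
  qed measurable
  then have "(\<lambda>n. \<integral>x. (clamp (real B) (f x) - clamp (real B) (g n x))\<^sup>2 \<partial>unit_lebesgue) \<longlonglongrightarrow> 0" by simp
  from order_tendstoD(2)[OF this, of "e/4"] e obtain n where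
    n: "(\<integral>x. (clamp (real B) (f x) - clamp (real B) (g n x))\<^sup>2 \<partial>unit_lebesgue) < e / 4"
    by (auto simp: eventually_sequentially)
  have "(\<integral>x. (f x - clamp (real B) (g n x))\<^sup>2 \<partial>unit_lebesgue) \<le> e"
    using sq_dist_triangle[OF f2 cm[of "real B", unfolded L2_unit_eq] gcl[of n, unfolded L2_unit_eq]] B n by simp
  moreover have "continuous_on UNIV (\<lambda>x. clamp (real B) (g n x))"
    by (rule continuous_on_compose2[OF clamp_continuous[of UNIV] gc]) auto
  ultimately show ?thesis using gcl by blast
qed

text \<open>Left-open cells partition the interval without the null point 0, and the cell with
  height \<open>\<alpha> l\<close> corresponds to the path increment over the same cell.\<close>

definition step :: "nat \<Rightarrow> (nat \<Rightarrow> real) \<Rightarrow> real \<Rightarrow> real" where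
  "step K \<alpha> x = (\<Sum>l<K. \<alpha> l * indicator {real l / real K<..real (Suc l) / real K} x)"

lemma step_cell_unique:
  assumes "x \<in> {real l / real K<..real (Suc l) / real K}" "x \<in> {real l' / real K<..real (Suc l') / real K}" "K > 0"
  shows "l = l'"
proof -
  have "real l < real (Suc l')" "real l' < real (Suc l)"
    using assms by (auto simp: field_simps intro: le_less_trans less_le_trans)
  then show ?thesis by linarith
qed

lemma step_eq:
  assumes "l < K" "x \<in> {real l / real K<..real (Suc l) / real K}"
  shows "step K \<alpha> x = \<alpha> l"
proof -
  have "step K \<alpha> x = (\<Sum>i<K. if i = l then \<alpha> i else 0)"
    unfolding step_def
  proof (intro sum.cong refl)
    fix i assume "i \<in> {..<K}"
    then show "\<alpha> i * indicator {real i / real K<..real (Suc i) / real K} x = (if i = l then \<alpha> i else 0)"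
      using step_cell_unique[of x i K l] assms by (cases "i = l") (auto simp: indicator_def)
  qed
  then show ?thesis using assms by simp
qed

lemma unit_cell_exists:
  assumes "0 < x" "x \<le> 1" "K > 0"
  shows "\<exists>l<K. x \<in> {real l / real K<..real (Suc l) / real K}"
proof -
  \<comment> \<open>Ceiling minus one instead of floor, because the cells are closed on the
    right.\<close>
  define l where "l = nat (\<lceil>real K * x\<rceil> - 1)"
  have "\<lceil>real K * x\<rceil> \<ge> 1" using assms by (simp add: one_le_ceiling)
  then have l: "real l = of_int \<lceil>real K * x\<rceil> - 1" by (simp add: l_def)
  have "real l < real K * x" "real K * x \<le> real (Suc l)" using l by linarith+
  moreover from this have "real l < real K" using assms mult_left_le[of x "real K"] by linarith
  ultimately show ?thesis using assms by (intro exI[of _ l]) (auto simp: field_simps)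
qed

text \<open>The case holds for all heights \<open>\<beta>\<close> at once, so pointwise identities
  between step functions on a common grid reduce to identities between heights.\<close>

lemma step_cases:
  assumes "K > 0"
  obtains "step K \<alpha> x = 0 \<and> (\<forall>\<beta>. step K \<beta> x = 0)" | l where "l < K" "\<forall>\<beta>. step K \<beta> x = \<beta> l"
proof (cases "\<exists>l<K. x \<in> {real l / real K<..real (Suc l) / real K}")
  case True
  then show ?thesis using step_eq that(2) by blast
next
  case False
  then have "step K \<beta> x = 0" for \<beta>
    unfolding step_def by (intro sum.neutral) (auto simp: indicator_def)
  then show ?thesis using that(1) by blast
qed

lemma step_measurable [measurable]: "step K \<alpha> \<in> borel_measurable unit_lebesgue"
proof -
  have "step K \<alpha> \<in> borel_measurable borel" unfolding step_def[abs_def] by measurable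
  then show ?thesis by (intro measurable_restrict_space1 measurable_completion) simp
qed

lemma step_abs_le: "\<bar>step K \<alpha> x\<bar> \<le> (\<Sum>l<K. \<bar>\<alpha> l\<bar>)"
  unfolding step_def
  by (intro order_trans[OF sum_abs] sum_mono) (auto simp: indicator_def)

lemma step_L2_unit: "step K \<alpha> \<in> L2_unit"
  by (rule bounded_L2_unit[OF step_measurable step_abs_le])

text \<open>Uniform continuity, sampled at the left end of each cell. The claim covers all large
  \<open>K\<close>, so that finitely many functions can later share one grid.\<close>

lemma step_approximation_continuous:
  assumes g: "continuous_on UNIV g" and e: "e > 0"
  shows "\<exists>K0. \<forall>K\<ge>K0. K > 0 \<longrightarrow> (\<integral>x. (g x - step K (\<lambda>l. g (real l / real K)) x)\<^sup>2 \<partial>unit_lebesgue) \<le> e"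
proof -
  have "uniformly_continuous_on {0..1} g"
    by (intro compact_uniformly_continuous continuous_on_subset[OF g]) auto
  moreover have "sqrt e > 0" using e by simp
  ultimately obtain d where d: "d > 0" "\<And>x x'. x \<in> {0..1} \<Longrightarrow> x' \<in> {0..1} \<Longrightarrow> dist x' x < d \<Longrightarrow> dist (g x') (g x) < sqrt e"
    unfolding uniformly_continuous_on_def by metis
  obtain K0 where K0: "1 / d < real K0" using reals_Archimedean2 by blast
  have "(\<integral>x. (g x - step K (\<lambda>l. g (real l / real K)) x)\<^sup>2 \<partial>unit_lebesgue) \<le> e" if K: "K \<ge> K0" "K > 0" for K
  proof -
    have "1 / d < real K" using K K0 by linarith
    then have Kd: "1 / real K < d" using d K by (simp add: field_simps)
    have AE0: "AE x in unit_lebesgue. x \<noteq> 0"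
      using AE_not_in[of "{0}" lebesgue]
      by (subst AE_restrict_space_iff) auto
    have "(\<integral>x. (g x - step K (\<lambda>l. g (real l / real K)) x)\<^sup>2 \<partial>unit_lebesgue) \<le> (\<integral>x. e \<partial>unit_lebesgue)"
    proof (rule integral_mono_AE')
      show "AE x in unit_lebesgue. (g x - step K (\<lambda>l. g (real l / real K)) x)\<^sup>2 \<le> e"
        using AE0 AE_space
      proof eventually_elim
        case (elim x)
        then have x: "0 < x" "x \<le> 1" by auto
        from unit_cell_exists[OF this K(2)] obtain l where
          l: "l < K" "x \<in> {real l / real K<..real (Suc l) / real K}" by blast
        have "dist x (real l / real K) \<le> 1 / real K"
          using l(2) by (auto simp: dist_real_def add_divide_distrib)
        then have "dist (g x) (g (real l / real K)) < sqrt e"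
          using Kd l(1) x by (intro d(2)) auto
        then have "\<bar>g x - g (real l / real K)\<bar> \<le> sqrt e" by (simp add: dist_real_def)
        then have "(g x - g (real l / real K))\<^sup>2 \<le> (sqrt e)\<^sup>2"
          using e by (simp only: abs_le_square_iff[symmetric] abs_of_pos real_sqrt_gt_zero)
        then show ?case using step_eq[OF l] e by simp
      qed
    qed (use e in \<open>auto intro!: AE_I2\<close>)
    then show ?thesis using unit.prob_space by simp
  qed
  then show ?thesis by blast
qed

text \<open>A common grid matters: linear combinations of the approximants are then step functions
  on it, and the noise of a whole level consists of combinations of the same increments.\<close>

lemma step_approximation:
  assumes I: "finite I" and f: "\<And>i. i \<in> I \<Longrightarrow> f i \<in> L2_unit" and e: "e > 0"
  shows "\<exists>K>0. \<exists>\<alpha>. \<forall>i\<in>I. (\<integral>x. (f i x - step K (\<alpha> i) x)\<^sup>2 \<partial>unit_lebesgue) \<le> e"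
proof -
  have "\<forall>i\<in>I. \<exists>g. continuous_on UNIV g \<and> g \<in> L2_unit \<and> (\<integral>x. (f i x - g x)\<^sup>2 \<partial>unit_lebesgue) \<le> e / 4"
    using continuous_approximation[OF f, of _ "e / 4"] e by simp
  then obtain g where g: "\<And>i. i \<in> I \<Longrightarrow> continuous_on UNIV (g i)" "\<And>i. i \<in> I \<Longrightarrow> g i \<in> L2_unit"
    "\<And>i. i \<in> I \<Longrightarrow> (\<integral>x. (f i x - g i x)\<^sup>2 \<partial>unit_lebesgue) \<le> e / 4"
    by metis
  have "\<forall>i\<in>I. \<exists>K0. \<forall>K\<ge>K0. K > 0 \<longrightarrow> (\<integral>x. (g i x - step K (\<lambda>l. g i (real l / real K)) x)\<^sup>2 \<partial>unit_lebesgue) \<le> e / 4"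
    using step_approximation_continuous[OF g(1), of _ "e/4"] e by simp
  from bchoice[OF this] obtain K0 where K0: "\<And>i K. i \<in> I \<Longrightarrow> K \<ge> K0 i \<Longrightarrow> K > 0 \<Longrightarrow>
      (\<integral>x. (g i x - step K (\<lambda>l. g i (real l / real K)) x)\<^sup>2 \<partial>unit_lebesgue) \<le> e / 4"
    by blast
  define K where "K = Suc (\<Sum>i\<in>I. K0 i)"
  have K1: "K > 0" by (simp add: K_def)
  have K2: "K0 i \<le> K" if "i \<in> I" for i
    unfolding K_def by (rule le_SucI, rule member_le_sum, use I that in auto)
  have "(\<integral>x. (f i x - step K (\<lambda>l. g i (real l / real K)) x)\<^sup>2 \<partial>unit_lebesgue) \<le> e" if i: "i \<in> I" for i
    using sq_dist_triangle[OF f[OF i, unfolded L2_unit_eq] g(2)[OF i, unfolded L2_unit_eq]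
        step_L2_unit[unfolded L2_unit_eq, of K "\<lambda>l. g i (real l / real K)"]]
      g(3)[OF i] K0[OF i K2[OF i] K1] by linarith
  then show ?thesis using K1 by (intro exI[of _ K] conjI exI[of _ "\<lambda>i l. g i (real l / real K)"]) auto
qed

lemma integrable_mult_interval:
  fixes f :: "real \<Rightarrow> real"
  assumes f: "integrable unit_lebesgue f"
  shows "integrable unit_lebesgue (\<lambda>x. f x * indicator {a<..b::real} x)"
proof (rule Bochner_Integration.integrable_bound[OF f])
  have "(indicator {a<..b} :: real \<Rightarrow> real) \<in> borel_measurable unit_lebesgue"
    by (rule borel_measurable_unit_lebesgue) measurable
  then show "(\<lambda>x. f x * indicator {a<..b} x) \<in> borel_measurable unit_lebesgue"
    using f by (intro borel_measurable_times) auto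
qed (auto simp: indicator_def)

lemma step_integral:
  assumes f: "integrable unit_lebesgue f"
  shows "(\<integral>x. f x * step K \<alpha> x \<partial>unit_lebesgue) =
    (\<Sum>l<K. \<alpha> l * (\<integral>x. f x * indicator {real l / real K<..real (Suc l) / real K} x \<partial>unit_lebesgue))"
proof -
  have "(\<lambda>x. f x * step K \<alpha> x) =
    (\<lambda>x. \<Sum>l<K. \<alpha> l * (f x * indicator {real l / real K<..real (Suc l) / real K} x))"
    by (simp only: step_def sum_distrib_left mult.left_commute)
  then have "(\<integral>x. f x * step K \<alpha> x \<partial>unit_lebesgue) = (\<Sum>l<K. \<integral>x. \<alpha> l *
      (f x * indicator {real l / real K<..real (Suc l) / real K} x) \<partial>unit_lebesgue)"
    by (simp only:) (intro Bochner_Integration.integral_sum integrable_mult_right integrable_mult_interval f)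
  then show ?thesis by simp
qed

lemma cell_measure:
  assumes "l < K"
  shows "(\<integral>x. indicator {real l / real K<..real (Suc l) / real K} x \<partial>unit_lebesgue) = 1 / real K" (is "integral\<^sup>L _ (indicator ?C) = _")
proof -
  have "0 \<le> real l / real K" "real (Suc l) / real K \<le> 1" using assms by (simp_all add: divide_le_eq_1)
  then have s: "{real l / real K<..real (Suc l) / real K} \<subseteq> {0..1}"
    by (meson atLeastAtMost_iff greaterThanAtMost_iff less_imp_le order_trans subsetI)
  have "(\<integral>x. indicator ?C x \<partial>unit_lebesgue) = (\<integral>x. indicator {0..1} x *\<^sub>R (indicator ?C x :: real) \<partial>lebesgue)"
    by (rule integral_restrict_space) simp
  also have "(\<lambda>x. indicator {0..1} x *\<^sub>R (indicator ?C x :: real)) = (indicator ?C :: real \<Rightarrow> real)"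
    using s by (auto simp: indicator_def fun_eq_iff)
  also have "(\<integral>x. (indicator ?C x :: real) \<partial>lebesgue) = measure lebesgue ?C" by simp
  also have "\<dots> = 1 / real K" using assms by (simp add: field_simps)
  finally show ?thesis .
qed

lemma step_sq_integral:
  assumes "K > 0"
  shows "(\<integral>x. (step K \<alpha> x)\<^sup>2 \<partial>unit_lebesgue) = (\<Sum>l<K. (\<alpha> l)\<^sup>2) / real K"
proof -
  have "(step K \<alpha> x)\<^sup>2 = 1 * step K (\<lambda>l. (\<alpha> l)\<^sup>2) x" for x
    by (rule step_cases[OF assms, of \<alpha> x]) auto
  then have "(\<integral>x. (step K \<alpha> x)\<^sup>2 \<partial>unit_lebesgue) = (\<integral>x. 1 * step K (\<lambda>l. (\<alpha> l)\<^sup>2) x \<partial>unit_lebesgue)" by simp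
  also have "\<dots> = (\<Sum>l<K. (\<alpha> l)\<^sup>2 * (\<integral>x. 1 * indicator {real l / real K<..real (Suc l) / real K} x \<partial>unit_lebesgue))"
    by (rule step_integral) simp
  also have "\<dots> = (\<Sum>l<K. (\<alpha> l)\<^sup>2 * (1 / real K))"
    by (intro sum.cong refl) (simp only: mult_1_left cell_measure lessThan_iff)
  finally show ?thesis by (simp add: sum_divide_distrib)
qed

lemma step_linear: "(\<Sum>k\<in>S. u k * step K (\<alpha> k) x) = step K (\<lambda>l. \<Sum>k\<in>S. u k * \<alpha> k l) x"
  unfolding step_def sum_distrib_left sum_distrib_right
  by (subst sum.swap) (simp add: mult.assoc)

section \<open>Wiener integrals of step functions\<close>

text \<open>The Wiener integral of \<open>step K \<alpha>\<close> along the path. It reads finitely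
  many coordinates, so it is defined on every path and measurable for the product sigma-algebra,
  which the encoder must respect; a Wiener integral of a general square integrable function is
  defined only almost surely.\<close>

definition increments :: "nat \<Rightarrow> (nat \<Rightarrow> real) \<Rightarrow> (real \<Rightarrow> real) \<Rightarrow> real" where
  "increments K \<alpha> w = (\<Sum>l<K. \<alpha> l * (w (real (Suc l) / real K) - w (real l / real K)))"

lemma grid_in_unit: "l < K \<Longrightarrow> real (Suc l) / real K \<in> {0..1}" "l < K \<Longrightarrow> real l / real K \<in> {0..1}"
  by (simp_all add: divide_le_eq_1)

lemma increments_measurable [measurable]: "increments K \<alpha> \<in> borel_measurable path_space"
  unfolding increments_def[abs_def] path_space_def
  by (intro borel_measurable_sum borel_measurable_times borel_measurable_diff borel_measurable_const
      measurable_component_singleton grid_in_unit) auto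

text \<open>Needed because the model states independence for the restricted paths.\<close>

lemma increments_restrict: "increments K \<alpha> (\<lambda>t\<in>{0..1}. w t) = increments K \<alpha> w"
  unfolding increments_def using grid_in_unit by (intro sum.cong refl) (simp only: lessThan_iff restrict_apply' )

lemma increments_linear: "(\<Sum>k\<in>S. u k * increments K (\<alpha> k) w) = increments K (\<lambda>l. \<Sum>k\<in>S. u k * \<alpha> k l) w"
  unfolding increments_def sum_distrib_left sum_distrib_right
  by (subst sum.swap) (simp only: mult.assoc)

lemma integral_initial_segment:
  fixes f :: "real \<Rightarrow> real"
  assumes "t \<in> {0..1}"
  shows "(\<integral>u. f u \<partial>lebesgue_on {0..t}) = (\<integral>u. f u * indicator {0..t} u \<partial>unit_lebesgue)"
proof -
  have "(\<integral>u. f u \<partial>lebesgue_on {0..t}) = (\<integral>u. indicator {0..t} u *\<^sub>R f u \<partial>lebesgue)"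
    by (rule integral_restrict_space) simp
  also have "(\<lambda>u. indicator {0..t} u *\<^sub>R f u) = (\<lambda>u. indicator {0..1} u *\<^sub>R (f u * indicator {0..t} u))"
    using assms by (auto simp: indicator_def fun_eq_iff)
  also have "(\<integral>u. indicator {0..1} u *\<^sub>R (f u * indicator {0..t} u) \<partial>lebesgue) =
      (\<integral>u. f u * indicator {0..t} u \<partial>unit_lebesgue)"
    by (rule integral_restrict_space[symmetric]) simp
  finally show ?thesis .
qed

lemma integrable_mult_initial_segment:
  fixes f :: "real \<Rightarrow> real"
  assumes f: "integrable unit_lebesgue f"
  shows "integrable unit_lebesgue (\<lambda>x. f x * indicator {0..t::real} x)"
proof (rule Bochner_Integration.integrable_bound[OF f])
  have "(indicator {0..t} :: real \<Rightarrow> real) \<in> borel_measurable unit_lebesgue"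
    by (rule borel_measurable_unit_lebesgue) measurable
  then show "(\<lambda>x. f x * indicator {0..t} x) \<in> borel_measurable unit_lebesgue"
    using f by (intro borel_measurable_times) auto
qed (auto simp: indicator_def)

lemma L2_unit_integrable: "f \<in> L2_unit \<Longrightarrow> integrable unit_lebesgue f"
  unfolding L2_unit_eq by (rule square_integrable_integrable[OF unit.finite_measure_axioms])

text \<open>Passage to the sequence model, coefficient plus scaled noise. It is exact for step
  functions; all discretization error sits in the replacement of the wavelets.\<close>

lemma increments_observed_path:
  assumes f: "f \<in> L2_unit"
  shows "increments K \<alpha> (observed_path m n f W \<omega>) =
    inner_unit f (step K \<alpha>) + sqrt (real m / real n) * increments K \<alpha> (\<lambda>t. W t \<omega>)"
proof -
  note fi = L2_unit_integrable[OF f]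
  have cell: "observed_path m n f W \<omega> (real (Suc l) / real K) - observed_path m n f W \<omega> (real l / real K)
     = (\<integral>x. f x * indicator {real l / real K<..real (Suc l) / real K} x \<partial>unit_lebesgue)
       + sqrt (real m / real n) * (W (real (Suc l) / real K) \<omega> - W (real l / real K) \<omega>)" if l: "l < K" for l
  proof -
    let ?a = "real l / real K" and ?b = "real (Suc l) / real K"
    have ab: "0 \<le> ?a" "?a \<le> ?b" by (auto intro: divide_right_mono)
    have "(\<integral>x. f x * indicator {0..?b} x \<partial>unit_lebesgue) - (\<integral>x. f x * indicator {0..?a} x \<partial>unit_lebesgue)
      = (\<integral>x. f x * indicator {0..?b} x - f x * indicator {0..?a} x \<partial>unit_lebesgue)"
      by (intro Bochner_Integration.integral_diff[symmetric] integrable_mult_initial_segment fi)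
    also have "(\<lambda>x. f x * indicator {0..?b} x - f x * indicator {0..?a} x) = (\<lambda>x. f x * indicator {?a<..?b} x)"
      by (intro ext) (auto simp: indicator_def simp del: of_nat_Suc; use ab in linarith)
    finally have I: "(\<integral>x. f x * indicator {0..?b} x \<partial>unit_lebesgue) - (\<integral>x. f x * indicator {0..?a} x \<partial>unit_lebesgue)
      = (\<integral>x. f x * indicator {?a<..?b} x \<partial>unit_lebesgue)" .
    have o: "observed_path m n f W \<omega> t = (\<integral>x. f x * indicator {0..t} x \<partial>unit_lebesgue) + sqrt (real m / real n) * W t \<omega>"
      if "t \<in> {0..1}" for t
      by (simp only: observed_path_def restrict_apply' integral_initial_segment that)
    show ?thesis
      unfolding o[OF grid_in_unit(1)[OF l]] o[OF grid_in_unit(2)[OF l]] I[symmetric] right_diff_distrib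
      by linarith
  qed
  have "increments K \<alpha> (observed_path m n f W \<omega>) = (\<Sum>l<K. \<alpha> l * 
       ((\<integral>x. f x * indicator {real l / real K<..real (Suc l) / real K} x \<partial>unit_lebesgue)
       + sqrt (real m / real n) * (W (real (Suc l) / real K) \<omega> - W (real l / real K) \<omega>)))"
    unfolding increments_def by (intro sum.cong refl arg_cong2[of _ _ _ _ "(*)"] cell) simp
  also have "\<dots> = (\<Sum>l<K. \<alpha> l * (\<integral>x. f x * indicator {real l / real K<..real (Suc l) / real K} x \<partial>unit_lebesgue))
     + sqrt (real m / real n) * increments K \<alpha> (\<lambda>t. W t \<omega>)"
    unfolding increments_def by (simp add: sum.distrib distrib_left sum_distrib_left mult.left_commute del: of_nat_Suc)
  also have "(\<Sum>l<K. \<alpha> l * (\<integral>x. f x * indicator {real l / real K<..real (Suc l) / real K} x \<partial>unit_lebesgue))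
     = inner_unit f (step K \<alpha>)"
    unfolding inner_unit_def by (rule step_integral[OF fi, symmetric])
  finally show ?thesis .
qed

lemma normal_moments:
  fixes s :: real
  assumes X: "distributed M lborel X (normal_density 0 s)" and s: "0 < s"
  shows "integrable M (\<lambda>\<omega>. X \<omega> ^ 4)" "(\<integral>\<omega>. (X \<omega>)\<^sup>2 \<partial>M) = s\<^sup>2" "(\<integral>\<omega>. X \<omega> ^ 4 \<partial>M) = 3 * (s\<^sup>2)\<^sup>2"
proof -
  have 4: "has_bochner_integral lborel (\<lambda>x. normal_density 0 s x * x ^ 4) (3 * (s\<^sup>2)\<^sup>2)"
    using normal_moment_even[OF s, of 0 2] s by (simp add: fact_numeral power_divide)
  have 2: "has_bochner_integral lborel (\<lambda>x. normal_density 0 s x * x\<^sup>2) (s\<^sup>2)"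
    using normal_moment_even[OF s, of 0 1] s by (simp add: fact_numeral power_divide)
  show "integrable M (\<lambda>\<omega>. X \<omega> ^ 4)"
    using distributed_integrable[OF X, of "\<lambda>x. x ^ 4"] 4 by (simp add: has_bochner_integral_iff)
  show "(\<integral>\<omega>. (X \<omega>)\<^sup>2 \<partial>M) = s\<^sup>2"
    using distributed_integral[OF X, of "\<lambda>x. x\<^sup>2"] 2 by (simp add: has_bochner_integral_iff)
  show "(\<integral>\<omega>. X \<omega> ^ 4 \<partial>M) = 3 * (s\<^sup>2)\<^sup>2"
    using distributed_integral[OF X, of "\<lambda>x. x ^ 4"] 4 by (simp add: has_bochner_integral_iff)
qed

lemma wiener_increments_moments:
  assumes W: "standard_wiener M W" and K: "K > 0"
  shows "integrable M (\<lambda>\<omega>. increments K \<alpha> (\<lambda>t. W t \<omega>) ^ 4)"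
    "(\<integral>\<omega>. (increments K \<alpha> (\<lambda>t. W t \<omega>))\<^sup>2 \<partial>M) = (\<Sum>l<K. (\<alpha> l)\<^sup>2) / real K"
    "(\<integral>\<omega>. increments K \<alpha> (\<lambda>t. W t \<omega>) ^ 4 \<partial>M) = 3 * ((\<Sum>l<K. (\<alpha> l)\<^sup>2) / real K)\<^sup>2"
proof -
  interpret prob_space M using W by (simp add: standard_wiener_def)
  define D where "D l \<omega> = W (real (Suc l) / real K) \<omega> - W (real l / real K) \<omega>" for l \<omega>
  \<comment> \<open>Cells of height 0 are dropped: a normal law needs positive standard deviation to
    have a density. If nothing remains, all moments vanish.\<close>
  define L where "L = {l \<in> {..<K}. \<alpha> l \<noteq> 0}"
  have sumL: "(\<Sum>l<K. \<alpha> l * D l \<omega>) = (\<Sum>l\<in>L. \<alpha> l * D l \<omega>)" for \<omega>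
    unfolding L_def by (intro sum.mono_neutral_right) auto
  have sumL2: "(\<Sum>l<K. (\<alpha> l)\<^sup>2) = (\<Sum>l\<in>L. (\<alpha> l)\<^sup>2)"
    unfolding L_def by (intro sum.mono_neutral_right) auto
  have inc: "increments K \<alpha> (\<lambda>t. W t \<omega>) = (\<Sum>l\<in>L. \<alpha> l * D l \<omega>)" for \<omega>
    using sumL[of \<omega>] by (simp add: increments_def D_def)
  have "integrable M (\<lambda>\<omega>. increments K \<alpha> (\<lambda>t. W t \<omega>) ^ 4) \<and>
    (\<integral>\<omega>. (increments K \<alpha> (\<lambda>t. W t \<omega>))\<^sup>2 \<partial>M) = (\<Sum>l<K. (\<alpha> l)\<^sup>2) / real K \<and>
    (\<integral>\<omega>. increments K \<alpha> (\<lambda>t. W t \<omega>) ^ 4 \<partial>M) = 3 * ((\<Sum>l<K. (\<alpha> l)\<^sup>2) / real K)\<^sup>2"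
  proof (cases "L = {}")
    case True
    then show ?thesis unfolding inc sumL2 by simp
  next
    case False
    have fin: "finite L" by (simp add: L_def)
    have grid: "(\<forall>k\<le>K. real k / real K \<in> {0..1}) \<and> (\<forall>k<K. real k / real K \<le> real (Suc k) / real K)"
      using K by (auto simp: divide_le_eq_1 intro: divide_right_mono)
    have "\<forall>(r::nat) (t::nat \<Rightarrow> real). (\<forall>k\<le>r. t k \<in> {0..1}) \<and> (\<forall>k<r. t k \<le> t (Suc k)) \<longrightarrow>
        indep_vars (\<lambda>_. borel) (\<lambda>k \<omega>. W (t (Suc k)) \<omega> - W (t k) \<omega>) {..<r}"
      using W unfolding standard_wiener_def by blast
    from this[rule_format, of K "\<lambda>k. real k / real K", OF grid]
    have "indep_vars (\<lambda>_. borel) D {..<K}" by (simp only: D_def[abs_def])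
    then have "indep_vars (\<lambda>_. borel) D L" by (rule indep_vars_subset) (auto simp: L_def)
    then have ind: "indep_vars (\<lambda>_. borel) (\<lambda>l \<omega>. \<alpha> l * D l \<omega>) L"
      by (rule indep_vars_compose2) simp
    have dist: "distributed M lborel (\<lambda>\<omega>. \<alpha> l * D l \<omega>) (normal_density 0 (\<bar>\<alpha> l\<bar> * sqrt (1 / real K)))"
      if l: "l \<in> L" for l
    proof -
      have t: "0 \<le> real l / real K" "real l / real K < real (Suc l) / real K" "real (Suc l) / real K \<le> 1"
        using l grid_in_unit[of l K] K by (auto simp: L_def divide_strict_right_mono)
      have "real (Suc l) / real K - real l / real K = 1 / real K" by (simp add: diff_divide_distrib[symmetric])
      moreover have "distributed M lborel (D l) (\<lambda>x. ennreal (normal_density 0 (sqrt (real (Suc l) / real K - real l / real K)) x))"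
        using W t unfolding standard_wiener_def D_def[abs_def] by blast
      ultimately have d: "distributed M lborel (D l) (\<lambda>x. ennreal (normal_density 0 (sqrt (1 / real K)) x))" by simp
      from normal_density_affine[OF d, of "\<alpha> l" 0] show ?thesis using l K by (simp add: L_def)
    qed
    have pos: "0 < \<bar>\<alpha> l\<bar> * sqrt (1 / real K)" if "l \<in> L" for l using that K by (simp add: L_def)
    have s: "(\<Sum>l\<in>L. (\<bar>\<alpha> l\<bar> * sqrt (1 / real K))\<^sup>2) = (\<Sum>l\<in>L. (\<alpha> l)\<^sup>2) / real K"
      by (simp add: power_mult_distrib power_divide sum_divide_distrib)
    have "distributed M lborel (\<lambda>\<omega>. \<Sum>l\<in>L. \<alpha> l * D l \<omega>) (normal_density (\<Sum>l\<in>L. 0) (sqrt (\<Sum>l\<in>L. (\<bar>\<alpha> l\<bar> * sqrt (1 / real K))\<^sup>2)))"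
      by (rule sum_indep_normal[OF fin False ind pos dist])
    then have N: "distributed M lborel (\<lambda>\<omega>. \<Sum>l\<in>L. \<alpha> l * D l \<omega>) (normal_density 0 (sqrt ((\<Sum>l\<in>L. (\<alpha> l)\<^sup>2) / real K)))"
      by (simp only: s sum.neutral_const)
    have p: "0 < (\<Sum>l\<in>L. (\<alpha> l)\<^sup>2) / real K"
      using K False fin by (intro divide_pos_pos sum_pos) (auto simp: L_def)
    show ?thesis
      unfolding inc sumL2 using normal_moments[OF N] p by simp
  qed
  then show "integrable M (\<lambda>\<omega>. increments K \<alpha> (\<lambda>t. W t \<omega>) ^ 4)"
    "(\<integral>\<omega>. (increments K \<alpha> (\<lambda>t. W t \<omega>))\<^sup>2 \<partial>M) = (\<Sum>l<K. (\<alpha> l)\<^sup>2) / real K"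
    "(\<integral>\<omega>. increments K \<alpha> (\<lambda>t. W t \<omega>) ^ 4 \<partial>M) = 3 * ((\<Sum>l<K. (\<alpha> l)\<^sup>2) / real K)\<^sup>2"
    by blast+
qed

text \<open>By the isometry for step functions, the variance of a combination of noise variables is
  the squared norm of the same combination of step functions, so \<open>op\<close> becomes the
  covariance bound of the locale.\<close>

lemma wiener_noise_level:
  assumes W: "standard_wiener M W" and K: "K > 0" and S: "finite S"
    and op: "\<And>u. (\<integral>x. (\<Sum>k\<in>S. u k * step K (\<alpha> k) x)\<^sup>2 \<partial>unit_lebesgue) \<le> 4 * (\<Sum>k\<in>S. (u k)\<^sup>2)"
  shows "noise_level M S (\<lambda>k \<omega>. increments K (\<alpha> k) (\<lambda>t. W t \<omega>))"
proof -
  interpret prob_space M using W by (simp add: standard_wiener_def)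
  have Wm: "W t \<in> borel_measurable M" if "t \<in> {0..1}" for t
    using W that by (simp add: standard_wiener_def)
  show ?thesis
  proof
    show "finite S" by fact
    show "(\<lambda>\<omega>. increments K (\<alpha> k) (\<lambda>t. W t \<omega>)) \<in> borel_measurable M" for k
      unfolding increments_def
      by (intro borel_measurable_sum borel_measurable_times borel_measurable_diff borel_measurable_const
          Wm grid_in_unit) auto
  next
    fix u
    show "integrable M (\<lambda>\<omega>. (\<Sum>k\<in>S. u k * increments K (\<alpha> k) (\<lambda>t. W t \<omega>)) ^ 4)"
      unfolding increments_linear by (rule wiener_increments_moments(1)[OF W K])
    show "expectation (\<lambda>\<omega>. (\<Sum>k\<in>S. u k * increments K (\<alpha> k) (\<lambda>t. W t \<omega>))\<^sup>2) \<le> 4 * (\<Sum>k\<in>S. (u k)\<^sup>2)"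
      using op[of u] unfolding increments_linear step_linear wiener_increments_moments(2)[OF W K] step_sq_integral[OF K] .
    show "expectation (\<lambda>\<omega>. (\<Sum>k\<in>S. u k * increments K (\<alpha> k) (\<lambda>t. W t \<omega>)) ^ 4) =
        3 * (expectation (\<lambda>\<omega>. (\<Sum>k\<in>S. u k * increments K (\<alpha> k) (\<lambda>t. W t \<omega>))\<^sup>2))\<^sup>2"
      unfolding increments_linear wiener_increments_moments(2,3)[OF W K] ..
  qed
qed

section \<open>Orthonormal systems and their perturbation\<close>

lemma square_integrable_sq_sum_orthonormal:
  assumes P: "finite P" and \<psi>: "\<And>p. p \<in> P \<Longrightarrow> \<psi> p \<in> square_integrable M"
    and on: "\<And>p q. p \<in> P \<Longrightarrow> q \<in> P \<Longrightarrow> (\<integral>x. \<psi> p x * \<psi> q x \<partial>M) = (if p = q then 1 else 0)"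
  shows "(\<integral>x. (\<Sum>p\<in>P. u p * \<psi> p x)\<^sup>2 \<partial>M) = (\<Sum>p\<in>P. (u p)\<^sup>2)"
proof -
  have "(\<integral>x. (\<Sum>p\<in>P. u p * \<psi> p x)\<^sup>2 \<partial>M) =
      (\<Sum>p\<in>P. \<Sum>q\<in>P. u p * u q * (\<integral>x. \<psi> p x * \<psi> q x \<partial>M))"
    by (rule integral_sum_sq) (rule \<psi>)
  also have "\<dots> = (\<Sum>p\<in>P. \<Sum>q\<in>P. u p * u q * (if p = q then 1 else 0))"
    by (intro sum.cong refl) (simp only: on)
  finally show ?thesis using P by (simp add: power2_eq_square if_distrib[of "\<lambda>x. _ * x"] cong: if_cong)
qed

text \<open>By pointwise Cauchy-Schwarz, a perturbation of total squared size at most 1 moves a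
  combination by at most the norm of its coefficient vector. Together with the orthonormal part this
  gives 2 + 2 = 4, the constant of \<open>noise_level\<close>.\<close>

lemma near_orthonormal_operator_bound:
  assumes S: "finite S" and \<psi>: "\<And>k. k \<in> S \<Longrightarrow> \<psi> k \<in> square_integrable M" and h: "\<And>k. k \<in> S \<Longrightarrow> h k \<in> square_integrable M"
    and on: "\<And>k l. k \<in> S \<Longrightarrow> l \<in> S \<Longrightarrow> (\<integral>x. \<psi> k x * \<psi> l x \<partial>M) = (if k = l then 1 else 0)"
    and close: "(\<Sum>k\<in>S. \<integral>x. (\<psi> k x - h k x)\<^sup>2 \<partial>M) \<le> 1"
  shows "(\<integral>x. (\<Sum>k\<in>S. u k * h k x)\<^sup>2 \<partial>M) \<le> 4 * (\<Sum>k\<in>S. (u k :: real)\<^sup>2)"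
proof -
  have c: "(\<lambda>x. \<Sum>k\<in>S. u k * \<psi> k x) \<in> square_integrable M" "(\<lambda>x. \<Sum>k\<in>S. u k * h k x) \<in> square_integrable M"
    by (intro square_integrable_sum square_integrable_cmult \<psi> h; assumption)+
  have u0: "0 \<le> (\<Sum>k\<in>S. (u k)\<^sup>2)" by (intro sum_nonneg) auto
  have d: "\<And>k. k \<in> S \<Longrightarrow> integrable M (\<lambda>x. (\<psi> k x - h k x)\<^sup>2)"
    by (intro square_integrable_int square_integrable_diff \<psi> h)
  have 1: "(\<integral>x. (\<Sum>k\<in>S. u k * \<psi> k x)\<^sup>2 \<partial>M) = (\<Sum>k\<in>S. (u k)\<^sup>2)"
    by (rule square_integrable_sq_sum_orthonormal[OF S \<psi> on])
  have "(\<integral>x. ((\<Sum>k\<in>S. u k * h k x) - (\<Sum>k\<in>S. u k * \<psi> k x))\<^sup>2 \<partial>M) \<le>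
      (\<integral>x. (\<Sum>k\<in>S. (u k)\<^sup>2) * (\<Sum>k\<in>S. (\<psi> k x - h k x)\<^sup>2) \<partial>M)"
  proof (rule integral_mono)
    show "integrable M (\<lambda>x. ((\<Sum>k\<in>S. u k * h k x) - (\<Sum>k\<in>S. u k * \<psi> k x))\<^sup>2)"
      by (intro square_integrable_int square_integrable_diff c)
    show "integrable M (\<lambda>x. (\<Sum>k\<in>S. (u k)\<^sup>2) * (\<Sum>k\<in>S. (\<psi> k x - h k x)\<^sup>2))"
      by (intro integrable_mult_right Bochner_Integration.integrable_sum d)
    fix x
    have "((\<Sum>k\<in>S. u k * h k x) - (\<Sum>k\<in>S. u k * \<psi> k x))\<^sup>2 = (\<Sum>k\<in>S. u k * (\<psi> k x - h k x))\<^sup>2"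
      by (simp add: sum_subtractf right_diff_distrib power2_commute)
    also have "\<dots> \<le> (\<Sum>k\<in>S. (u k)\<^sup>2) * (\<Sum>k\<in>S. (\<psi> k x - h k x)\<^sup>2)"
      by (rule Cauchy_Schwarz_ineq_sum)
    finally show "((\<Sum>k\<in>S. u k * h k x) - (\<Sum>k\<in>S. u k * \<psi> k x))\<^sup>2 \<le> (\<Sum>k\<in>S. (u k)\<^sup>2) * (\<Sum>k\<in>S. (\<psi> k x - h k x)\<^sup>2)" .
  qed
  also have "\<dots> = (\<Sum>k\<in>S. (u k)\<^sup>2) * (\<Sum>k\<in>S. \<integral>x. (\<psi> k x - h k x)\<^sup>2 \<partial>M)"
    using d by simp
  also have "\<dots> \<le> (\<Sum>k\<in>S. (u k)\<^sup>2) * 1" by (intro mult_left_mono close u0)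
  finally have 2: "(\<integral>x. ((\<Sum>k\<in>S. u k * h k x) - (\<Sum>k\<in>S. u k * \<psi> k x))\<^sup>2 \<partial>M) \<le> (\<Sum>k\<in>S. (u k)\<^sup>2)" by simp
  have "(\<lambda>x. 0) \<in> square_integrable M" by (rule square_integrable_zero)
  from sq_dist_triangle[OF c(2) c(1) this] 1 2 show ?thesis by simp
qed

section \<open>Wavelet expansions\<close>

lemma L2_sqnorm_eq: "g \<in> L2_unit \<Longrightarrow> L2_sqnorm g = ennreal (\<integral>x. (g x)\<^sup>2 \<partial>unit_lebesgue)"
  unfolding L2_sqnorm_def L2_unit_eq
  by (rule nn_integral_eq_integral) (auto intro: square_integrable_int)

locale wavelet_basis =
  fixes \<psi> :: "nat \<Rightarrow> nat \<Rightarrow> real \<Rightarrow> real"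
  assumes basis: "orthonormal_wavelet_basis \<psi>"
begin

lemma basis_L2: "k \<in> {1..2 ^ j} \<Longrightarrow> \<psi> j k \<in> L2_unit"
  using basis unfolding orthonormal_wavelet_basis_def wavelet_index_def by auto

lemma basis_orthonormal:
  "k \<in> {1..2 ^ j} \<Longrightarrow> k' \<in> {1..2 ^ j'} \<Longrightarrow>
    (\<integral>x. \<psi> j k x * \<psi> j' k' x \<partial>unit_lebesgue) = (if j = j' \<and> k = k' then 1 else 0)"
  using basis unfolding orthonormal_wavelet_basis_def wavelet_index_def inner_unit_def by auto

lemma expansion_L2: "(\<lambda>x. \<Sum>j<J. \<Sum>k=1..2^j. u j k * \<psi> j k x) \<in> L2_unit"
  unfolding L2_unit_eq
  by (intro square_integrable_sum square_integrable_cmult basis_L2[unfolded L2_unit_eq])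

lemma expansion_norm:
  "(\<integral>x. (\<Sum>j<J. \<Sum>k=1..2^j. u j k * \<psi> j k x)\<^sup>2 \<partial>unit_lebesgue) = (\<Sum>j<J. \<Sum>k=1..2^j. (u j k)\<^sup>2)"
proof -
  let ?P = "SIGMA j:{..<J}. {1..(2::nat) ^ j}"
  have "(\<integral>x. (\<Sum>p\<in>?P. u (fst p) (snd p) * \<psi> (fst p) (snd p) x)\<^sup>2 \<partial>unit_lebesgue) = (\<Sum>p\<in>?P. (u (fst p) (snd p))\<^sup>2)"
    by (rule square_integrable_sq_sum_orthonormal[where \<psi> = "\<lambda>p. \<psi> (fst p) (snd p)" and u = "\<lambda>p. u (fst p) (snd p)"])
      (auto intro!: basis_L2[unfolded L2_unit_eq] simp: basis_orthonormal prod_eq_iff)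
  then show ?thesis
    by (simp add: sum.Sigma split_def)
qed

abbreviation level_energy :: "(real \<Rightarrow> real) \<Rightarrow> nat \<Rightarrow> real" where
  "level_energy f j \<equiv> \<Sum>k=1..2^j. (inner_unit f (\<psi> j k))\<^sup>2"

text \<open>Up to a finite level J' the error is computed by Parseval; completeness is used only to
  let J' tend to infinity. Accordingly \<open>H\<close> has to bound the finite blocks of energies
  beyond \<open>J\<close>, uniformly in J'.\<close>

lemma expansion_error:
  assumes f: "f \<in> L2_unit" and H: "\<And>J'. J \<le> J' \<Longrightarrow> (\<Sum>j\<in>{J..<J'}. level_energy f j) \<le> H"
  shows "L2_sqnorm (\<lambda>x. (\<Sum>j<J. \<Sum>k=1..2^j. c j k * \<psi> j k x) - f x) \<le>
    ennreal (2 * ((\<Sum>j<J. \<Sum>k=1..2^j. (c j k - inner_unit f (\<psi> j k))\<^sup>2) + H))"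
proof -
  let ?g = "\<lambda>x. \<Sum>j<J. \<Sum>k=1..2^j. c j k * \<psi> j k x"
  let ?a = "\<lambda>j k. inner_unit f (\<psi> j k)"
  let ?S = "\<lambda>J' x. \<Sum>j<J'. \<Sum>k=1..2^j. ?a j k * \<psi> j k x"
  let ?E = "\<Sum>j<J. \<Sum>k=1..2^j. (c j k - ?a j k)\<^sup>2"
  have f2: "f \<in> square_integrable unit_lebesgue" using f by (simp add: L2_unit_eq)
  have g2: "?g \<in> square_integrable unit_lebesgue" using expansion_L2 by (simp add: L2_unit_eq)
  have S2: "?S J' \<in> square_integrable unit_lebesgue" for J' using expansion_L2[of ?a] by (simp add: L2_unit_eq)
  define r where "r J' = (\<integral>x. (f x - ?S J' x)\<^sup>2 \<partial>unit_lebesgue)" for J'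
  have r_eq: "L2_sqnorm (\<lambda>x. f x - ?S J' x) = ennreal (r J')" for J'
    unfolding r_def by (rule L2_sqnorm_eq) (use square_integrable_diff[OF f2 S2] in \<open>simp add: L2_unit_eq\<close>)
  have "(\<lambda>J'. L2_sqnorm (\<lambda>x. f x - ?S J' x)) \<longlonglongrightarrow> 0"
    using basis f unfolding orthonormal_wavelet_basis_def by blast
  then have "(\<lambda>J'. ennreal (r J')) \<longlonglongrightarrow> ennreal 0" by (simp only: r_eq ennreal_0)
  then have r0: "r \<longlonglongrightarrow> 0"
    by (subst (asm) tendsto_ennreal_iff) (auto simp: r_def)
  have bound: "(\<integral>x. (?g x - f x)\<^sup>2 \<partial>unit_lebesgue) \<le> 2 * (?E + H) + 2 * r J'" if J': "J \<le> J'" for J'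
  proof -
    \<comment> \<open>Padding by zero puts both expansions on the levels below J'; each padded level
      contributes exactly its energy.\<close>
    define c' where "c' j k = (if j < J then c j k else 0)" for j k
    have gc: "?g x = (\<Sum>j<J'. \<Sum>k=1..2^j. c' j k * \<psi> j k x)" for x
      using J' unfolding c'_def by (intro sum.mono_neutral_cong_left) auto
    have "(\<integral>x. (?g x - ?S J' x)\<^sup>2 \<partial>unit_lebesgue) =
       (\<integral>x. (\<Sum>j<J'. \<Sum>k=1..2^j. (c' j k - ?a j k) * \<psi> j k x)\<^sup>2 \<partial>unit_lebesgue)"
      unfolding gc by (simp add: sum_subtractf left_diff_distrib)
    also have "\<dots> = (\<Sum>j<J'. \<Sum>k=1..2^j. (c' j k - ?a j k)\<^sup>2)" by (rule expansion_norm)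
    also have "\<dots> = (\<Sum>j\<in>{..<J} \<union> {J..<J'}. \<Sum>k=1..2^j. (c' j k - ?a j k)\<^sup>2)"
      using J' by (intro sum.cong) auto
    also have "\<dots> = (\<Sum>j<J. \<Sum>k=1..2^j. (c' j k - ?a j k)\<^sup>2) + (\<Sum>j\<in>{J..<J'}. \<Sum>k=1..2^j. (c' j k - ?a j k)\<^sup>2)"
      by (rule sum.union_disjoint) auto
    also have "\<dots> = ?E + (\<Sum>j\<in>{J..<J'}. level_energy f j)"
      by (intro arg_cong2[of _ _ _ _ "(+)"] sum.cong refl) (auto simp: c'_def)
    also have "\<dots> \<le> ?E + H" using H[OF J'] by simp
    finally have 1: "(\<integral>x. (?g x - ?S J' x)\<^sup>2 \<partial>unit_lebesgue) \<le> ?E + H" .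
    have "(\<integral>x. (?g x - f x)\<^sup>2 \<partial>unit_lebesgue) \<le>
       2 * (\<integral>x. (?g x - ?S J' x)\<^sup>2 \<partial>unit_lebesgue) + 2 * (\<integral>x. (?S J' x - f x)\<^sup>2 \<partial>unit_lebesgue)"
      by (rule sq_dist_triangle[OF g2 S2 f2])
    also have "(\<integral>x. (?S J' x - f x)\<^sup>2 \<partial>unit_lebesgue) = r J'"
      unfolding r_def by (simp add: power2_commute)
    also have "2 * (\<integral>x. (?g x - ?S J' x)\<^sup>2 \<partial>unit_lebesgue) + 2 * r J' \<le> 2 * (?E + H) + 2 * r J'"
      by (intro add_right_mono mult_left_mono 1) simp
    finally show ?thesis .
  qed
  have "(\<integral>x. (?g x - f x)\<^sup>2 \<partial>unit_lebesgue) \<le> 2 * (?E + H)"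
  proof (rule LIMSEQ_le_const)
    have "(\<lambda>J'. 2 * (?E + H) + 2 * r J') \<longlonglongrightarrow> 2 * (?E + H) + 2 * 0"
      by (intro tendsto_intros r0)
    then show "(\<lambda>J'. 2 * (?E + H) + 2 * r J') \<longlonglongrightarrow> 2 * (?E + H)" by simp
    show "\<exists>N. \<forall>J'\<ge>N. (\<integral>x. (?g x - f x)\<^sup>2 \<partial>unit_lebesgue) \<le> 2 * (?E + H) + 2 * r J'"
      using bound by blast
  qed
  moreover have "L2_sqnorm (\<lambda>x. ?g x - f x) = ennreal (\<integral>x. (?g x - f x)\<^sup>2 \<partial>unit_lebesgue)"
    by (rule L2_sqnorm_eq) (use square_integrable_diff[OF g2 f2] in \<open>simp add: L2_unit_eq\<close>)
  ultimately show ?thesis by (simp add: ennreal_leI)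
qed

text \<open>This is \<open>expansion_error\<close> for the empty expansion. Its spare factor 2 is
  harmless, as only a uniform bound for the norm is wanted.\<close>

lemma L2_norm_le_energy:
  assumes f: "f \<in> L2_unit" and H: "\<And>J. (\<Sum>j<J. level_energy f j) \<le> H"
  shows "(\<integral>x. (f x)\<^sup>2 \<partial>unit_lebesgue) \<le> 2 * H"
proof -
  have H0: "H \<ge> 0" using H[of 0] by simp
  have "L2_sqnorm (\<lambda>x. (\<Sum>j<0. \<Sum>k=1..2^j. 0 * \<psi> j k x) - f x) \<le>
    ennreal (2 * ((\<Sum>j<0. \<Sum>k=1..2^j. (0 - inner_unit f (\<psi> j k))\<^sup>2) + H))"
    by (rule expansion_error[OF f]) (use H in \<open>simp add: atLeast0LessThan\<close>)
  then have "ennreal (\<integral>x. (- f x)\<^sup>2 \<partial>unit_lebesgue) \<le> ennreal (2 * H)"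
    using L2_sqnorm_eq[of "\<lambda>x. - f x"] square_integrable_cmult[of f unit_lebesgue "- 1"] f by (simp add: L2_unit_eq)
  then show ?thesis using H0 by (simp add: ennreal_le_iff)
qed

end

lemma sum_pow2_below:
  fixes R :: real
  assumes "R \<ge> 0"
  shows "(\<Sum>j | j < J \<and> 2 ^ j < R. 2 ^ j) \<le> 2 * R"
proof (induction J)
  case (Suc J)
  show ?case
  proof (cases "2 ^ J < R")
    case True
    have "{j. j < Suc J \<and> 2 ^ j < R} \<subseteq> {..<Suc J}" by auto
    then have "(\<Sum>j | j < Suc J \<and> 2 ^ j < R. 2 ^ j) \<le> (\<Sum>j<Suc J. (2::real) ^ j)"
      by (intro sum_mono2) auto
    also have "\<dots> = 2 * 2 ^ J - 1" by (induction J) auto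
    also have "\<dots> \<le> 2 * R" using True by simp
    finally show ?thesis .
  next
    case False
    then have "{j. j < Suc J \<and> 2 ^ j < R} = {j. j < J \<and> 2 ^ j < R}" by (auto simp: less_Suc_eq)
    then show ?thesis using Suc by simp
  qed
qed (use assms in simp)

section \<open>The estimator\<close>

text \<open>Everything fixed before signal and noise are known. The bound on \<open>b\<close> gives
  a code word to each quantized value, up to \<open>2 * n\<^sup>2\<close>. The accuracy 1/n serves
  twice: it keeps each level nearly orthonormal, and it makes the discretization bias negligible
  against every rate.\<close>

locale wavelet_scheme = wavelet_basis +
  fixes n m J b K :: nat and \<alpha> :: "nat \<Rightarrow> nat \<Rightarrow> nat \<Rightarrow> real"
    and c :: "nat \<Rightarrow> bool list" and Q :: "bool list \<Rightarrow> nat \<Rightarrow> nat \<Rightarrow> real" and \<tau> :: real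
  assumes n: "n > 0" and m: "m > 0" "m \<le> n" and J: "2 ^ J \<le> n" and b: "2 * n\<^sup>2 < 2 ^ b"
    and \<tau>: "\<tau> \<ge> 1" and K: "K > 0"
    and approx: "(\<Sum>j<J. \<Sum>k=1..2^j. \<integral>x. (\<psi> j k x - step K (\<alpha> j k) x)\<^sup>2 \<partial>unit_lebesgue) \<le> 1 / n"
    and code: "inj_on c {..<2 ^ b}" "\<And>z. length (c z) = b"
    and decoder: "\<And>D z j k. (\<And>j k. z j k \<in> {..<2 ^ b}) \<Longrightarrow> j < J \<Longrightarrow> k \<in> {1..2 ^ j} \<Longrightarrow>
      Q (encode c J D z) j k = (if D j then dequantize n (z j k) else 0)"
begin

abbreviation S :: "nat \<Rightarrow> nat set" where "S j \<equiv> {1..2 ^ j}"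

definition coefficient :: "nat \<Rightarrow> nat \<Rightarrow> (real \<Rightarrow> real) \<Rightarrow> real" where
  "coefficient j k w = increments K (\<alpha> j k) w"

text \<open>The expected noise energy before scaling by m/n, computed from the step heights; a
  machine can subtract it without reference to a probability space.\<close>

definition energy :: "nat \<Rightarrow> real" where
  "energy j = (\<Sum>k\<in>S j. (\<Sum>l<K. (\<alpha> j k l)\<^sup>2) / real K)"

definition detects :: "(real \<Rightarrow> real) \<Rightarrow> nat \<Rightarrow> bool" where
  "detects w j \<longleftrightarrow> \<tau> * 2 ^ j / n \<le> (\<Sum>k\<in>S j. (coefficient j k w)\<^sup>2) - m / n * energy j"

definition enc :: "nat \<Rightarrow> (real \<Rightarrow> real) \<times> real \<Rightarrow> bool list" where
  "enc i d = encode c J (detects (fst d)) (\<lambda>j k. quantize n (coefficient j k (fst d)))"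

definition dec :: "(nat \<Rightarrow> bool list) \<Rightarrow> real \<Rightarrow> real" where
  "dec y x = (\<Sum>j<J. \<Sum>k=1..2^j. ((\<Sum>i\<in>{1..m}. Q (y i) j k) / m) * \<psi> j k x)"

lemma coefficient_measurable [measurable]: "coefficient j k \<in> borel_measurable path_space"
  unfolding coefficient_def[abs_def] by measurable

lemma detects_measurable [measurable]: "Measurable.pred path_space (\<lambda>w. detects w j)"
  unfolding detects_def by measurable

lemma is_distributed_estimator: "distributed_estimator m enc dec"
  unfolding distributed_estimator_def
proof (intro conjI ballI allI)
  fix i
  show "enc i \<in> data_space \<rightarrow>\<^sub>M count_space UNIV"
    unfolding enc_def[abs_def] data_space_def by (rule measurable_encode) measurable
  show "dec y \<in> L2_unit" for y
    unfolding dec_def[abs_def] by (rule expansion_L2)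
qed

lemma length_enc: "length (enc i d) = J + b * (\<Sum>j<J. if detects (fst d) j then 2 ^ j else 0)"
  unfolding enc_def by (rule length_encode[OF code(2)])

lemma length_enc_le: "length (enc i d) \<le> J + b * (2 ^ J - 1)"
proof -
  have "(\<Sum>j<J. if detects (fst d) j then 2 ^ j else 0) \<le> (\<Sum>j<J. (2::nat) ^ j)"
    by (intro sum_mono) auto
  also have "\<dots> = 2 ^ J - 1" by (induction J) auto
  finally show ?thesis unfolding length_enc by simp
qed

lemma level_approx: "j < J \<Longrightarrow> (\<Sum>k\<in>S j. \<integral>x. (\<psi> j k x - step K (\<alpha> j k) x)\<^sup>2 \<partial>unit_lebesgue) \<le> 1 / n"
  by (rule order_trans[OF _ approx], rule member_le_sum) (auto intro!: sum_nonneg)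

lemma step_operator_bound:
  assumes "j < J"
  shows "(\<integral>x. (\<Sum>k\<in>S j. u k * step K (\<alpha> j k) x)\<^sup>2 \<partial>unit_lebesgue) \<le> 4 * (\<Sum>k\<in>S j. (u k)\<^sup>2)"
proof (rule near_orthonormal_operator_bound)
  have "1 / real n \<le> 1" using n by simp
  then show "(\<Sum>k\<in>S j. \<integral>x. (\<psi> j k x - step K (\<alpha> j k) x)\<^sup>2 \<partial>unit_lebesgue) \<le> 1"
    using level_approx[OF assms] by linarith
qed (auto simp: basis_orthonormal step_L2_unit[unfolded L2_unit_eq] basis_L2[unfolded L2_unit_eq])

lemma step_norm_le:
  assumes "j < J" "k \<in> S j"
  shows "(\<integral>x. (step K (\<alpha> j k) x)\<^sup>2 \<partial>unit_lebesgue) \<le> 4"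
  using step_operator_bound[OF assms(1), of "\<lambda>i. if i = k then 1 else 0"] assms(2)
  by (simp add: if_distrib[of "\<lambda>x. x * _"] if_distrib[of "\<lambda>x. x\<^sup>2"] cong: if_cong)

end

text \<open>One run of an already fixed scheme: noise and signal come in only here, so bounds that
  depend on \<open>F\<close> alone are uniform in the signal.\<close>

locale wavelet_run = wavelet_scheme +
  fixes M :: "'w measure" and W :: "nat \<Rightarrow> real \<Rightarrow> 'w \<Rightarrow> real" and U :: "nat \<Rightarrow> 'w \<Rightarrow> real"
    and f :: "real \<Rightarrow> real" and F :: real
  assumes model: "white_noise_model m M W U" and f: "f \<in> L2_unit"
    and F: "(\<integral>x. (f x)\<^sup>2 \<partial>unit_lebesgue) \<le> F"
begin

sublocale prob_space M
  using model by (simp add: white_noise_model_def)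

definition \<sigma> :: real where "\<sigma> = sqrt (real m / real n)"

definition \<xi> :: "nat \<Rightarrow> nat \<Rightarrow> nat \<Rightarrow> 'w \<Rightarrow> real" where
  "\<xi> i j k \<omega> = increments K (\<alpha> j k) (\<lambda>t. W i t \<omega>)"

definition g :: "nat \<Rightarrow> nat \<Rightarrow> real" where
  "g j k = inner_unit f (step K (\<alpha> j k))"

abbreviation obs :: "nat \<Rightarrow> 'w \<Rightarrow> real \<Rightarrow> real" where
  "obs i \<omega> \<equiv> observed_path m n f (W i) \<omega>"

definition test :: "nat \<Rightarrow> nat \<Rightarrow> 'w \<Rightarrow> real" where
  "test j i = noise_level.detect M (S j) (\<xi> i j) (g j) \<sigma> (\<tau> * card (S j) / n)"

lemma \<sigma>_sq: "\<sigma>\<^sup>2 = real m / real n"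
  by (simp add: \<sigma>_def)

lemma F_nonneg: "F \<ge> 0"
  using F order_trans[OF Bochner_Integration.integral_nonneg F] by simp

lemma wiener: "i \<in> {1..m} \<Longrightarrow> standard_wiener M (W i)"
  using model by (simp add: white_noise_model_def)

lemma noise_lev:
  assumes "i \<in> {1..m}" "j < J"
  shows "noise_level M (S j) (\<xi> i j)"
  unfolding \<xi>_def[abs_def]
  by (rule wiener_noise_level[OF wiener[OF assms(1)] K _ step_operator_bound[OF assms(2)]]) simp

lemma noise_energy_eq:
  assumes "i \<in> {1..m}" "j < J"
  shows "noise_level.noise_energy M (S j) (\<xi> i j) = energy j"
  unfolding noise_level.noise_energy_def[OF noise_lev[OF assms]] energy_def \<xi>_def
    wiener_increments_moments(2)[OF wiener[OF assms(1)] K] ..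

lemma coefficient_obs: "coefficient j k (obs i \<omega>) = g j k + \<sigma> * \<xi> i j k \<omega>"
  unfolding coefficient_def increments_observed_path[OF f] g_def \<sigma>_def \<xi>_def ..

text \<open>Connects the rule that the encoder evaluates on the observed path with the abstract
  test, whose statistic is written with the unobserved signal and noise.\<close>

lemma test_eq:
  assumes "i \<in> {1..m}" "j < J"
  shows "test j i \<omega> = of_bool (detects (obs i \<omega>) j)"
  unfolding test_def noise_level.detect_def[OF noise_lev[OF assms]] noise_level.energy_stat_def[OF noise_lev[OF assms]]
    detects_def coefficient_obs noise_energy_eq[OF assms] \<sigma>_sq by simp

text \<open>For a fixed signal, decision and noise coefficient form one measurable function of the
  noise path of the machine, so independence of the machines carries over to the products.\<close>

lemma test_noise_indep:
  assumes j: "j < J" and k: "k \<in> S j"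
  shows "indep_vars (\<lambda>_. borel) (\<lambda>i \<omega>. test j i \<omega> * \<xi> i j k \<omega>) {1..m}"
proof -
  let ?h = "\<lambda>w. of_bool (\<tau> * 2 ^ j / n \<le> (\<Sum>k\<in>S j. (g j k + \<sigma> * increments K (\<alpha> j k) w)\<^sup>2) - m / n * energy j)
     * increments K (\<alpha> j k) w"
  have "indep_vars (\<lambda>_. data_space) (\<lambda>i \<omega>. (\<lambda>t\<in>{0..1}. W i t \<omega>, U i \<omega>)) {1..m}"
    using model by (simp add: white_noise_model_def)
  then have "indep_vars (\<lambda>_. borel) (\<lambda>i \<omega>. ?h (fst (\<lambda>t\<in>{0..1}. W i t \<omega>, U i \<omega>))) {1..m}"
    by (rule indep_vars_compose2) (unfold data_space_def, measurable)
  moreover have "?h (fst (\<lambda>t\<in>{0..1}. W i t \<omega>, U i \<omega>)) = test j i \<omega> * \<xi> i j k \<omega>" if "i \<in> {1..m}" for i \<omega>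
    unfolding fst_conv increments_restrict test_eq[OF that j] detects_def coefficient_obs by (simp add: \<xi>_def)
  ultimately show ?thesis by (subst indep_vars_cong[OF refl _ refl]) (auto simp: fun_eq_iff)
qed

definition err :: "nat \<Rightarrow> nat \<Rightarrow> nat \<Rightarrow> 'w \<Rightarrow> real" where
  "err j i k \<omega> = dequantize n (quantize n (g j k + \<sigma> * \<xi> i j k \<omega>)) - (g j k + \<sigma> * \<xi> i j k \<omega>)"

definition estimate :: "nat \<Rightarrow> nat \<Rightarrow> 'w \<Rightarrow> real" where
  "estimate j k \<omega> = (\<Sum>i\<in>{1..m}. test j i \<omega> * (g j k + \<sigma> * \<xi> i j k \<omega> + err j i k \<omega>)) / card {1..m}"

lemma dec_eq:
  "dec (\<lambda>i\<in>{1..m}. message m n enc f W U i \<omega>) x = (\<Sum>j<J. \<Sum>k=1..2^j. estimate j k \<omega> * \<psi> j k x)"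
proof -
  have "Q (message m n enc f W U i \<omega>) j k = test j i \<omega> * (g j k + \<sigma> * \<xi> i j k \<omega> + err j i k \<omega>)"
    if "i \<in> {1..m}" "j < J" "k \<in> S j" for i j k
  proof -
    have "quantize n x \<in> {..<2 ^ b}" for x using quantize_le[of n x] b by simp
    then have "Q (message m n enc f W U i \<omega>) j k =
        (if detects (obs i \<omega>) j then dequantize n (quantize n (coefficient j k (obs i \<omega>))) else 0)"
      unfolding message_def enc_def fst_conv by (intro decoder that)
    then show ?thesis unfolding test_eq[OF that(1,2)] err_def coefficient_obs by simp
  qed
  then show ?thesis unfolding dec_def estimate_def
    by (intro sum.cong refl arg_cong2[of _ _ _ _ "(*)"] arg_cong2[of _ _ _ _ "(/)"]) auto
qed

lemma g_pow4_le:
  assumes "j < J" "k \<in> S j"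
  shows "g j k ^ 4 \<le> 16 * F\<^sup>2"
proof -
  have "(g j k)\<^sup>2 \<le> (\<integral>x. (f x)\<^sup>2 \<partial>unit_lebesgue) * (\<integral>x. (step K (\<alpha> j k) x)\<^sup>2 \<partial>unit_lebesgue)"
    unfolding g_def inner_unit_def
    by (rule Cauchy_Schwarz_integral) (use f step_L2_unit in \<open>simp_all add: L2_unit_eq\<close>)
  also have "\<dots> \<le> F * 4"
    by (intro mult_mono F step_norm_le assms F_nonneg) simp
  finally have "((g j k)\<^sup>2)\<^sup>2 \<le> (F * 4)\<^sup>2" by (intro power_mono) auto
  then show ?thesis by (simp add: power_mult_distrib)
qed

text \<open>Cauchy-Schwarz coefficient by coefficient; the accuracy 1/n was imposed on the sum over
  all levels, so no factor for the number of coefficients appears.\<close>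

lemma approximation_bias: "(\<Sum>j<J. \<Sum>k=1..2^j. (g j k - inner_unit f (\<psi> j k))\<^sup>2) \<le> F / n"
proof -
  have "(\<Sum>j<J. \<Sum>k=1..2^j. (g j k - inner_unit f (\<psi> j k))\<^sup>2) \<le>
    (\<Sum>j<J. \<Sum>k=1..2^j. F * (\<integral>x. (\<psi> j k x - step K (\<alpha> j k) x)\<^sup>2 \<partial>unit_lebesgue))"
  proof (intro sum_mono)
    fix j k assume "k \<in> S j"
    then have \<psi>2: "\<psi> j k \<in> square_integrable unit_lebesgue" using basis_L2 by (simp add: L2_unit_eq)
    have f2: "f \<in> square_integrable unit_lebesgue" using f by (simp add: L2_unit_eq)
    note s2 = step_L2_unit[of K "\<alpha> j k", unfolded L2_unit_eq]
    have "inner_unit f (\<psi> j k) - g j k = (\<integral>x. f x * (\<psi> j k x - step K (\<alpha> j k) x) \<partial>unit_lebesgue)"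
      unfolding g_def inner_unit_def right_diff_distrib
      by (intro Bochner_Integration.integral_diff[symmetric] square_integrable_mult f2 \<psi>2 s2)
    then have "(g j k - inner_unit f (\<psi> j k))\<^sup>2 = (\<integral>x. f x * (\<psi> j k x - step K (\<alpha> j k) x) \<partial>unit_lebesgue)\<^sup>2"
      by (simp add: power2_commute)
    also have "\<dots> \<le> (\<integral>x. (f x)\<^sup>2 \<partial>unit_lebesgue) * (\<integral>x. (\<psi> j k x - step K (\<alpha> j k) x)\<^sup>2 \<partial>unit_lebesgue)"
      by (rule Cauchy_Schwarz_integral[OF f2 square_integrable_diff[OF \<psi>2 s2]])
    also have "\<dots> \<le> F * (\<integral>x. (\<psi> j k x - step K (\<alpha> j k) x)\<^sup>2 \<partial>unit_lebesgue)"
      by (intro mult_right_mono F) simp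
    finally show "(g j k - inner_unit f (\<psi> j k))\<^sup>2 \<le> F * (\<integral>x. (\<psi> j k x - step K (\<alpha> j k) x)\<^sup>2 \<partial>unit_lebesgue)" .
  qed
  also have "\<dots> \<le> F * (1 / n)"
    unfolding sum_distrib_left[symmetric] by (intro mult_left_mono approx F_nonneg)
  finally show ?thesis by simp
qed

lemma level_bias: 
  assumes j: "j < J"
  shows "(\<Sum>k=1..2^j. (g j k)\<^sup>2) \<le> 2 * level_energy f j + 2 * (\<Sum>k=1..2^j. (g j k - inner_unit f (\<psi> j k))\<^sup>2)"
    and "(\<Sum>k=1..2^j. (g j k - inner_unit f (\<psi> j k))\<^sup>2) \<le> F / n"
proof -
  have "(\<Sum>k=1..2^j. (g j k)\<^sup>2) \<le> (\<Sum>k=1..2^j. 2 * (inner_unit f (\<psi> j k))\<^sup>2 + 2 * (g j k - inner_unit f (\<psi> j k))\<^sup>2)"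
  proof (intro sum_mono)
    fix k
    show "(g j k)\<^sup>2 \<le> 2 * (inner_unit f (\<psi> j k))\<^sup>2 + 2 * (g j k - inner_unit f (\<psi> j k))\<^sup>2"
      using sq_sum2_le[of "inner_unit f (\<psi> j k)" "g j k - inner_unit f (\<psi> j k)"] by simp
  qed
  then show "(\<Sum>k=1..2^j. (g j k)\<^sup>2) \<le> 2 * level_energy f j + 2 * (\<Sum>k=1..2^j. (g j k - inner_unit f (\<psi> j k))\<^sup>2)"
    by (simp add: sum.distrib sum_distrib_left)
  show "(\<Sum>k=1..2^j. (g j k - inner_unit f (\<psi> j k))\<^sup>2) \<le> F / n"
    by (rule order_trans[OF _ approximation_bias], rule member_le_sum) (use j in \<open>auto intro!: sum_nonneg\<close>)
qed

section \<open>Risk of a single level\<close>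

lemma test_nonneg: "i \<in> {1..m} \<Longrightarrow> j < J \<Longrightarrow> 0 \<le> expectation (test j i)"
  unfolding test_def by (rule noise_level.detect_expectation_nonneg[OF noise_lev])

lemma test_le_1: 
  assumes "i \<in> {1..m}" "j < J"
  shows "expectation (test j i) \<le> 1"
proof -
  have "expectation (test j i) \<le> expectation (\<lambda>_. 1)"
    unfolding test_def
    by (intro integral_mono noise_level.detect_integrable[OF noise_lev] noise_level.detect_bounds[OF noise_lev] assms) simp
  then show ?thesis by (simp add: prob_space)
qed

lemma test_integrable: "i \<in> {1..m} \<Longrightarrow> j < J \<Longrightarrow> integrable M (test j i)"
  unfolding test_def by (rule noise_level.detect_integrable[OF noise_lev])

lemma false_alarm_level:
  assumes "i \<in> {1..m}" "j < J" "(\<Sum>k\<in>S j. (g j k)\<^sup>2) \<le> \<tau> * 2 ^ j / (2 * n)"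
  shows "2 ^ j * expectation (test j i) \<le> 320 * (real m)\<^sup>2"
  using noise_level.false_alarm[OF noise_lev[OF assms(1,2)], of \<tau> "real n" "real m" \<sigma> "g j"] \<tau> \<sigma>_sq assms(3) n m
  by (simp add: test_def)

lemma level_risk_le:
  assumes j: "j < J"
    and miss: "\<And>i. i \<in> {1..m} \<Longrightarrow> (\<Sum>k\<in>S j. (g j k)\<^sup>2) * (1 - expectation (test j i)) \<le> B"
    and noise: "\<And>i. i \<in> {1..m} \<Longrightarrow> expectation (\<lambda>\<omega>. test j i \<omega> * (\<Sum>k\<in>S j. (\<xi> i j k \<omega>)\<^sup>2)) \<le> N"
  shows "integrable M (\<lambda>\<omega>. \<Sum>k\<in>S j. (estimate j k \<omega> - g j k)\<^sup>2)"
    and "expectation (\<lambda>\<omega>. \<Sum>k\<in>S j. (estimate j k \<omega> - g j k)\<^sup>2) \<le>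
      3 * ((385 + 128 * F\<^sup>2) * 2 ^ j / n\<^sup>2 + (N / n + 4 * m / n) + B)"
proof -
  have e: "err j i k \<in> borel_measurable M" if "i \<in> {1..m}" "k \<in> S j" for i k
  proof -
    have [measurable]: "\<xi> i j k \<in> borel_measurable M"
      using noise_level.noise_meas[OF noise_lev[OF that(1) j]] that by blast
    show ?thesis unfolding err_def[abs_def] by measurable
  qed
  have eb: "(err j i k \<omega>)\<^sup>2 \<le> (1 + (g j k + \<sigma> * \<xi> i j k \<omega>) ^ 4) / (real n)\<^sup>2" for i k \<omega>
    unfolding err_def by (rule quantize_error[OF n])
  have I: "finite {1..m}" "{1..m} \<noteq> {}" using m by auto
  have s: "\<sigma>\<^sup>2 = real (card {1..m}) / real n" "real n \<ge> real (card {1..m})" using \<sigma>_sq m by auto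
  have D: "test j i = noise_level.detect M (S j) (\<xi> i j) (g j) \<sigma> (\<tau> * card (S j) / n)" for i
    by (rule test_def)
  note risk = level_risk[where \<xi> = "\<lambda>i. \<xi> i j" and e = "err j" and D = "test j" and M = M and S = "S j",
      OF I noise_lev[OF _ j] D test_noise_indep[OF j] e eb s miss noise, folded estimate_def]
  then show "integrable M (\<lambda>\<omega>. \<Sum>k\<in>S j. (estimate j k \<omega> - g j k)\<^sup>2)" by blast
  have "(\<Sum>k\<in>S j. 385 + 8 * g j k ^ 4) \<le> (\<Sum>k\<in>S j. 385 + 8 * (16 * F\<^sup>2))"
    by (intro sum_mono add_left_mono mult_left_mono g_pow4_le j) auto
  also have "\<dots> = (385 + 128 * F\<^sup>2) * 2 ^ j" by simp
  finally have "(\<Sum>k\<in>S j. 385 + 8 * g j k ^ 4) / (real n)\<^sup>2 \<le> (385 + 128 * F\<^sup>2) * 2 ^ j / (real n)\<^sup>2"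
    by (intro divide_right_mono) auto
  then show "expectation (\<lambda>\<omega>. \<Sum>k\<in>S j. (estimate j k \<omega> - g j k)\<^sup>2) \<le>
      3 * ((385 + 128 * F\<^sup>2) * 2 ^ j / n\<^sup>2 + (N / n + 4 * m / n) + B)"
    using risk(2) by simp
qed

text \<open>For levels below the critical resolution, where nothing is assumed about the signal:
  transmitting costs at most the full noise 2^j / n, and not transmitting is covered by
  \<open>missed_detection\<close>.\<close>

lemma level_risk_low:
  assumes j: "j < J"
  shows "integrable M (\<lambda>\<omega>. \<Sum>k\<in>S j. (estimate j k \<omega> - g j k)\<^sup>2)"
    and "expectation (\<lambda>\<omega>. \<Sum>k\<in>S j. (estimate j k \<omega> - g j k)\<^sup>2) \<le>
      3 * ((385 + 128 * F\<^sup>2) * 2 ^ j / n\<^sup>2 + (4 * 2 ^ j / n + 4 * m / n) + (2 * \<tau> * 2 ^ j / n + 256 * (real m)\<^sup>2 / n))"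
proof -
  have "(\<Sum>k\<in>S j. (g j k)\<^sup>2) * (1 - expectation (test j i)) \<le> 2 * \<tau> * 2 ^ j / n + 256 * (real m)\<^sup>2 / n"
    if "i \<in> {1..m}" for i
    using noise_level.missed_detection[OF noise_lev[OF that j], of \<tau> "real n" "real m" \<sigma> "g j"] \<tau> \<sigma>_sq n m
    by (simp add: test_def)
  moreover have "expectation (\<lambda>\<omega>. test j i \<omega> * (\<Sum>k\<in>S j. (\<xi> i j k \<omega>)\<^sup>2)) \<le> 4 * 2 ^ j" if "i \<in> {1..m}" for i
    using noise_level.detected_noise_le[OF noise_lev[OF that j]] by (simp add: test_def)
  ultimately show "integrable M (\<lambda>\<omega>. \<Sum>k\<in>S j. (estimate j k \<omega> - g j k)\<^sup>2)"
     "expectation (\<lambda>\<omega>. \<Sum>k\<in>S j. (estimate j k \<omega> - g j k)\<^sup>2) \<le>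
      3 * ((385 + 128 * F\<^sup>2) * 2 ^ j / n\<^sup>2 + (4 * 2 ^ j / n + 4 * m / n) + (2 * \<tau> * 2 ^ j / n + 256 * (real m)\<^sup>2 / n))"
    using level_risk_le[OF j] by blast+
qed

text \<open>For fine levels with small signal: its complete loss is accepted, and noise enters only
  through false alarms; 1600 = 5 * 320.\<close>

lemma level_risk_high:
  assumes j: "j < J" and small: "(\<Sum>k\<in>S j. (g j k)\<^sup>2) \<le> \<tau> * 2 ^ j / (2 * n)"
  shows "expectation (\<lambda>\<omega>. \<Sum>k\<in>S j. (estimate j k \<omega> - g j k)\<^sup>2) \<le>
      3 * ((385 + 128 * F\<^sup>2) * 2 ^ j / n\<^sup>2 + ((1600 * (real m)\<^sup>2 + 8) / n + 4 * m / n) + (\<Sum>k\<in>S j. (g j k)\<^sup>2))"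
proof (rule level_risk_le(2)[OF j])
  fix i assume i: "i \<in> {1..m}"
  have "0 \<le> (\<Sum>k\<in>S j. (g j k)\<^sup>2)" by (intro sum_nonneg) auto
  then show "(\<Sum>k\<in>S j. (g j k)\<^sup>2) * (1 - expectation (test j i)) \<le> (\<Sum>k\<in>S j. (g j k)\<^sup>2)"
    using test_nonneg[OF i j] by (simp add: mult_left_le)
  have "expectation (\<lambda>\<omega>. test j i \<omega> * (\<Sum>k\<in>S j. (\<xi> i j k \<omega>)\<^sup>2)) \<le> 5 * (2 ^ j * expectation (test j i)) + 8"
    using noise_level.detected_noise_le_false_alarm[OF noise_lev[OF i j]] by (simp add: test_def mult.assoc)
  then show "expectation (\<lambda>\<omega>. test j i \<omega> * (\<Sum>k\<in>S j. (\<xi> i j k \<omega>)\<^sup>2)) \<le> 1600 * (real m)\<^sup>2 + 8"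
    using false_alarm_level[OF i j small] by linarith
qed

end

section \<open>Risk and expected number of bits\<close>

context wavelet_run
begin

text \<open>Levels with 2^j < R count as always transmitted, which by geometric growth costs at most
  2 R coefficients; every other level costs only its false alarms. The summand \<open>J\<close> pays
  for the flags.\<close>

lemma bits_bound:
  fixes R :: real
  assumes i: "i \<in> {1..m}" and R: "R \<ge> 0"
    and high: "\<And>j. j < J \<Longrightarrow> R \<le> 2 ^ j \<Longrightarrow> (\<Sum>k\<in>S j. (g j k)\<^sup>2) \<le> \<tau> * 2 ^ j / (2 * n)"
  shows "expected_bits m n enc f M W U i \<le> ennreal (J + b * (2 * R + 320 * (J * (real m)\<^sup>2)))"
proof -
  have len: "real (length (message m n enc f W U i \<omega>)) = J + b * (\<Sum>j<J. 2 ^ j * test j i \<omega>)" for \<omega>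
  proof -
    have "(\<Sum>j<J. if detects (obs i \<omega>) j then 2 ^ j else 0) = (\<Sum>j<J. 2 ^ j * test j i \<omega>)"
      by (intro sum.cong refl) (simp add: test_eq[OF i])
    then show ?thesis unfolding message_def length_enc fst_conv by (simp add: of_nat_sum if_distrib cong: if_cong)
  qed
  have int: "integrable M (\<lambda>\<omega>. J + b * (\<Sum>j<J. 2 ^ j * test j i \<omega>))"
    using test_integrable[OF i] by (intro Bochner_Integration.integrable_add integrable_mult_right Bochner_Integration.integrable_sum) auto
  have "expected_bits m n enc f M W U i = ennreal (expectation (\<lambda>\<omega>. J + b * (\<Sum>j<J. 2 ^ j * test j i \<omega>)))"
    unfolding expected_bits_def len
    by (rule nn_integral_eq_integral[OF int]) (intro AE_I2, simp add: len[symmetric])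
  also have "expectation (\<lambda>\<omega>. J + b * (\<Sum>j<J. 2 ^ j * test j i \<omega>)) = J + b * (\<Sum>j<J. 2 ^ j * expectation (test j i))"
  proof -
    have "integrable M (\<lambda>\<omega>. \<Sum>j<J. 2 ^ j * test j i \<omega>)"
      using test_integrable[OF i] by (intro integrable_mult_right Bochner_Integration.integrable_sum) auto
    moreover have "expectation (\<lambda>\<omega>. \<Sum>j<J. 2 ^ j * test j i \<omega>) = (\<Sum>j<J. 2 ^ j * expectation (test j i))"
      by (subst Bochner_Integration.integral_sum) (auto simp: test_integrable[OF i])
    ultimately show ?thesis
      by (subst Bochner_Integration.integral_add) (auto simp: prob_space)
  qed
  also have "\<dots> \<le> J + b * (2 * R + 320 * (J * (real m)\<^sup>2))"
  proof (intro add_left_mono mult_left_mono)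
    have "(\<Sum>j<J. 2 ^ j * expectation (test j i)) \<le> (\<Sum>j<J. (if 2 ^ j < R then 2 ^ j else 0) + 320 * (real m)\<^sup>2)"
    proof (intro sum_mono)
      fix j assume "j \<in> {..<J}"
      then have j: "j < J" by simp
      show "2 ^ j * expectation (test j i) \<le> (if 2 ^ j < R then 2 ^ j else 0) + 320 * (real m)\<^sup>2"
      proof (cases "2 ^ j < R")
        case True
        have "2 ^ j * expectation (test j i) \<le> 2 ^ j * 1"
          using test_le_1[OF i j] by (intro mult_left_mono) auto
        then show ?thesis using True by (simp add: add_increasing2)
      next
        case False
        then show ?thesis using false_alarm_level[OF i j high[OF j]] by simp
      qed
    qed
    also have "\<dots> = (\<Sum>j | j < J \<and> 2 ^ j < R. 2 ^ j) + 320 * (J * (real m)\<^sup>2)"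
      by (simp add: sum.distrib sum.inter_filter[symmetric])
    also have "\<dots> \<le> 2 * R + 320 * (J * (real m)\<^sup>2)"
      using sum_pow2_below[OF R, of J] by simp
    finally show "(\<Sum>j<J. 2 ^ j * expectation (test j i)) \<le> 2 * R + 320 * (J * (real m)\<^sup>2)" .
  qed simp
  finally show ?thesis by (simp add: ennreal_leI)
qed

text \<open>\<open>R\<close> separates the two regimes. The terms that do not grow with 2^j amount
  to at most 260 m^2 / n at coarse and 1612 m^2 / n at fine levels; 2000 covers both. The
  quantization errors sum to order 2^J / n^2, hence 1/n.\<close>

lemma total_level_risk:
  fixes R H :: real
  assumes R: "R \<ge> 0"
    and high: "\<And>j. j < J \<Longrightarrow> R \<le> 2 ^ j \<Longrightarrow> (\<Sum>k\<in>S j. (g j k)\<^sup>2) \<le> \<tau> * 2 ^ j / (2 * n)"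
    and H: "(\<Sum>j | j < J \<and> R \<le> 2 ^ j. level_energy f j) \<le> H"
  shows "(\<Sum>j<J. expectation (\<lambda>\<omega>. \<Sum>k\<in>S j. (estimate j k \<omega> - g j k)\<^sup>2)) \<le>
    3 * ((385 + 128 * F\<^sup>2) / n + (8 + 4 * \<tau>) * R / n + 2 * H + 2 * F / n + 2000 * (J * (real m)\<^sup>2) / n)"
proof -
  let ?C = "385 + 128 * F\<^sup>2"
  let ?e = "\<lambda>j. \<Sum>k=1..2^j. (g j k - inner_unit f (\<psi> j k))\<^sup>2"
  let ?l = "\<lambda>j. if 2 ^ j < R then (4 + 2 * \<tau>) / n * 2 ^ j else 0"
  let ?h = "\<lambda>j. if R \<le> 2 ^ j then 2 * level_energy f j else 0"
  have n0: "real n > 0" using n by simp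
  have m1: "real m \<le> (real m)\<^sup>2" "1 \<le> (real m)\<^sup>2" using m by (auto simp: power2_eq_square one_le_power[of "real m" 2, unfolded power2_eq_square])
  have "(\<Sum>j<J. expectation (\<lambda>\<omega>. \<Sum>k\<in>S j. (estimate j k \<omega> - g j k)\<^sup>2)) \<le>
     (\<Sum>j<J. 3 * (?C * 2 ^ j / n\<^sup>2 + ?l j + ?h j + 2 * ?e j + 2000 * (real m)\<^sup>2 / n))"
  proof (intro sum_mono)
    fix j assume "j \<in> {..<J}"
    then have j: "j < J" by simp
    have e0: "0 \<le> ?e j" by (intro sum_nonneg) auto
    show "expectation (\<lambda>\<omega>. \<Sum>k\<in>S j. (estimate j k \<omega> - g j k)\<^sup>2) \<le>
       3 * (?C * 2 ^ j / n\<^sup>2 + ?l j + ?h j + 2 * ?e j + 2000 * (real m)\<^sup>2 / n)"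
    proof (cases "2 ^ j < R")
      case True
      have "(4 * 2 ^ j / n + 4 * m / n) + (2 * \<tau> * 2 ^ j / n + 256 * (real m)\<^sup>2 / n) =
          (4 + 2 * \<tau>) / n * 2 ^ j + (4 * m + 256 * (real m)\<^sup>2) / n"
        by (simp add: add_divide_distrib distrib_right)
      also have "\<dots> \<le> (4 + 2 * \<tau>) / n * 2 ^ j + 2000 * (real m)\<^sup>2 / n"
        using m1 n0 by (intro add_left_mono divide_right_mono) linarith+
      finally show ?thesis using level_risk_low(2)[OF j] True e0 by simp
    next
      case False
      then have Rj: "R \<le> 2 ^ j" by simp
      have "(1600 * (real m)\<^sup>2 + 8) / n + 4 * m / n \<le> 2000 * (real m)\<^sup>2 / n"
        unfolding add_divide_distrib[symmetric] using m1 n0 by (intro divide_right_mono) linarith+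
      note le = this
      have "?l j = 0" "?h j = 2 * level_energy f j" using False by simp_all
      then have "?C * 2 ^ j / n\<^sup>2 + ((1600 * (real m)\<^sup>2 + 8) / n + 4 * m / n) + (\<Sum>k\<in>S j. (g j k)\<^sup>2) \<le>
          ?C * 2 ^ j / n\<^sup>2 + ?l j + ?h j + 2 * ?e j + 2000 * (real m)\<^sup>2 / n"
        using le level_bias(1)[OF j] by linarith
      then show ?thesis
        by (intro order_trans[OF level_risk_high[OF j high[OF j Rj]]] mult_left_mono) auto
    qed
  qed
  also have "\<dots> = 3 * (?C / n\<^sup>2 * (\<Sum>j<J. 2 ^ j) + (\<Sum>j<J. ?l j) + (\<Sum>j<J. ?h j) + 2 * (\<Sum>j<J. ?e j) + 2000 * (J * (real m)\<^sup>2) / n)"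
    unfolding sum_distrib_left[symmetric] sum.distrib by (simp add: sum_distrib_left)
  also have "\<dots> \<le> 3 * (?C / n + (8 + 4 * \<tau>) * R / n + 2 * H + 2 * (F / n) + 2000 * (J * (real m)\<^sup>2) / n)"
  proof (intro mult_left_mono add_mono order_refl)
    have "(\<Sum>j<J. (2::real) ^ j) = 2 ^ J - 1" by (induction J) auto
    also have "\<dots> \<le> n" using J by (metis diff_le_eq add_increasing2 numeral_power_le_of_nat_cancel_iff of_nat_le_iff of_nat_numeral of_nat_power zero_le_one)
    finally have "?C / n\<^sup>2 * (\<Sum>j<J. 2 ^ j) \<le> ?C / n\<^sup>2 * n"
      by (intro mult_left_mono) (auto intro: add_nonneg_nonneg)
    then show "?C / n\<^sup>2 * (\<Sum>j<J. 2 ^ j) \<le> ?C / n" using n0 by (simp add: power2_eq_square)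
    have "(\<Sum>j<J. ?l j) = (4 + 2 * \<tau>) / n * (\<Sum>j | j < J \<and> 2 ^ j < R. 2 ^ j)"
      by (simp add: sum.inter_filter[symmetric] sum_distrib_left)
    also have "\<dots> \<le> (4 + 2 * \<tau>) / n * (2 * R)"
      using \<tau> by (intro mult_left_mono sum_pow2_below R) auto
    finally show "(\<Sum>j<J. ?l j) \<le> (8 + 4 * \<tau>) * R / n" by (simp add: field_simps)
    have "(\<Sum>j<J. ?h j) = 2 * (\<Sum>j | j < J \<and> R \<le> 2 ^ j. level_energy f j)"
      by (simp add: sum.inter_filter[symmetric] sum_distrib_left)
    then show "(\<Sum>j<J. ?h j) \<le> 2 * H" using H by simp
    show "(\<Sum>j<J. ?e j) \<le> F / n" by (rule approximation_bias)
  qed simp_all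
  finally show ?thesis by simp
qed

text \<open>The triangle inequality for squares is used twice, once for the levels beyond
  \<open>J\<close> and once to pass from wavelet to step coefficients; this makes 12 = 4 *
  3.\<close>

lemma risk_bound:
  fixes R H :: real
  assumes R: "R \<ge> 0"
    and high: "\<And>j. j < J \<Longrightarrow> R \<le> 2 ^ j \<Longrightarrow> (\<Sum>k\<in>S j. (g j k)\<^sup>2) \<le> \<tau> * 2 ^ j / (2 * n)"
    and H: "(\<Sum>j | j < J \<and> R \<le> 2 ^ j. level_energy f j) \<le> H"
    and tail: "\<And>J'. J \<le> J' \<Longrightarrow> (\<Sum>j\<in>{J..<J'}. level_energy f j) \<le> H"
  shows "risk m n enc dec f M W U \<le> ennreal (12 * ((385 + 128 * F\<^sup>2) / n + (8 + 4 * \<tau>) * R / n + 2 * H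
     + 2 * F / n + 2000 * (J * (real m)\<^sup>2) / n) + 4 * F / n + 2 * H)"
proof -
  let ?a = "\<lambda>j k. inner_unit f (\<psi> j k)"
  let ?E = "\<lambda>j \<omega>. \<Sum>k\<in>S j. (estimate j k \<omega> - g j k)\<^sup>2"
  have H0: "0 \<le> H" using tail[of J] by simp
  have F0: "0 \<le> F / n" using F_nonneg by simp
  have pointwise: "L2_sqnorm (\<lambda>x. dec (\<lambda>i\<in>{1..m}. message m n enc f W U i \<omega>) x - f x) \<le>
    ennreal (4 * (\<Sum>j<J. ?E j \<omega>) + 4 * (F / n) + 2 * H)" for \<omega>
  proof -
    have "L2_sqnorm (\<lambda>x. dec (\<lambda>i\<in>{1..m}. message m n enc f W U i \<omega>) x - f x) \<le>
      ennreal (2 * ((\<Sum>j<J. \<Sum>k=1..2^j. (estimate j k \<omega> - ?a j k)\<^sup>2) + H))"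
      unfolding dec_eq by (rule expansion_error[OF f tail])
    also have "\<dots> \<le> ennreal (4 * (\<Sum>j<J. ?E j \<omega>) + 4 * (F / n) + 2 * H)"
    proof (rule ennreal_leI)
      have "(\<Sum>j<J. \<Sum>k=1..2^j. (estimate j k \<omega> - ?a j k)\<^sup>2) \<le>
        (\<Sum>j<J. \<Sum>k=1..2^j. 2 * (estimate j k \<omega> - g j k)\<^sup>2 + 2 * (g j k - ?a j k)\<^sup>2)"
      proof (intro sum_mono)
        fix j k
        show "(estimate j k \<omega> - ?a j k)\<^sup>2 \<le> 2 * (estimate j k \<omega> - g j k)\<^sup>2 + 2 * (g j k - ?a j k)\<^sup>2"
          using sq_sum2_le[of "estimate j k \<omega> - g j k" "g j k - ?a j k"] by simp
      qed
      also have "\<dots> = 2 * (\<Sum>j<J. ?E j \<omega>) + 2 * (\<Sum>j<J. \<Sum>k=1..2^j. (g j k - ?a j k)\<^sup>2)"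
        by (simp add: sum.distrib sum_distrib_left)
      also have "\<dots> \<le> 2 * (\<Sum>j<J. ?E j \<omega>) + 2 * (F / n)"
        by (intro add_left_mono mult_left_mono approximation_bias) simp
      finally show "2 * ((\<Sum>j<J. \<Sum>k=1..2^j. (estimate j k \<omega> - ?a j k)\<^sup>2) + H) \<le>
          4 * (\<Sum>j<J. ?E j \<omega>) + 4 * (F / n) + 2 * H" by simp
    qed
    finally show ?thesis .
  qed
  have E: "integrable M (?E j)" if "j < J" for j by (rule level_risk_low(1)[OF that])
  have int: "integrable M (\<lambda>\<omega>. 4 * (\<Sum>j<J. ?E j \<omega>) + 4 * (F / n) + 2 * H)"
    by (intro Bochner_Integration.integrable_add integrable_mult_right Bochner_Integration.integrable_sum[of "{..<J}"] E) auto
  have "risk m n enc dec f M W U \<le> (\<integral>\<^sup>+\<omega>. ennreal (4 * (\<Sum>j<J. ?E j \<omega>) + 4 * (F / n) + 2 * H) \<partial>M)"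
    unfolding risk_def by (intro nn_integral_mono pointwise)
  also have "(\<integral>\<^sup>+\<omega>. ennreal (4 * (\<Sum>j<J. ?E j \<omega>) + 4 * (F / n) + 2 * H) \<partial>M) = ennreal (expectation (\<lambda>\<omega>. 4 * (\<Sum>j<J. ?E j \<omega>) + 4 * (F / n) + 2 * H))"
    by (rule nn_integral_eq_integral[OF int])
      (intro AE_I2 add_nonneg_nonneg mult_nonneg_nonneg sum_nonneg H0 F0, auto)
  also have "expectation (\<lambda>\<omega>. 4 * (\<Sum>j<J. ?E j \<omega>) + 4 * (F / n) + 2 * H) =
      4 * (\<Sum>j<J. expectation (?E j)) + 4 * (F / n) + 2 * H"
  proof -
    have i: "integrable M (\<lambda>\<omega>. 4 * (\<Sum>j<J. ?E j \<omega>))"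
      by (intro integrable_mult_right Bochner_Integration.integrable_sum[of "{..<J}"] E) auto
    have "expectation (\<lambda>\<omega>. (4 * (\<Sum>j<J. ?E j \<omega>)) + (4 * (F / n) + 2 * H)) =
        expectation (\<lambda>\<omega>. 4 * (\<Sum>j<J. ?E j \<omega>)) + (4 * (F / n) + 2 * H)"
      using i by (subst Bochner_Integration.integral_add) (auto simp: prob_space)
    also have "expectation (\<lambda>\<omega>. 4 * (\<Sum>j<J. ?E j \<omega>)) = 4 * (\<Sum>j<J. expectation (?E j))"
      using E by (subst integral_mult_right_zero, subst Bochner_Integration.integral_sum) auto
    finally show ?thesis by (simp add: add.assoc)
  qed
  also have "\<dots> \<le> 4 * (3 * ((385 + 128 * F\<^sup>2) / n + (8 + 4 * \<tau>) * R / n + 2 * H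
     + 2 * F / n + 2000 * (J * (real m)\<^sup>2) / n)) + 4 * (F / n) + 2 * H"
    by (intro add_right_mono mult_left_mono total_level_risk[OF R high H]) auto
  also have "\<dots> = 12 * ((385 + 128 * F\<^sup>2) / n + (8 + 4 * \<tau>) * R / n + 2 * H
     + 2 * F / n + 2000 * (J * (real m)\<^sup>2) / n) + 4 * F / n + 2 * H"
    by simp
  finally show ?thesis by (simp only: ennreal_leI)
qed

end

lemma (in wavelet_basis) wavelet_scheme_exists:
  assumes "n > 0" "m > 0" "m \<le> n" "2 ^ J \<le> n" "2 * n\<^sup>2 < 2 ^ b" "\<tau> \<ge> 1"
  shows "\<exists>K \<alpha> c Q. wavelet_scheme \<psi> n m J b K \<alpha> c Q \<tau>"
proof -
  let ?P = "SIGMA j:{..<J}. {1..(2::nat) ^ j}"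
  \<comment> \<open>Accuracy 1/N for each function adds up to at most 1/n; the summand 1 keeps
    \<open>N\<close> positive when there is no level at all.\<close>
  define N where "N = real n * real (card ?P + 1)"
  have N: "N > 0"
    unfolding N_def using assms(1)
    by (intro mult_pos_pos of_nat_0_less_iff[THEN iffD2]) (simp_all only: add_gr_0 zero_less_one simp_thms)
  have "\<exists>K>0. \<exists>\<alpha>. \<forall>p\<in>?P. (\<integral>x. (\<psi> (fst p) (snd p) x - step K (\<alpha> p) x)\<^sup>2 \<partial>unit_lebesgue) \<le> 1 / N"
    by (rule step_approximation) (use N in \<open>auto intro: basis_L2\<close>)
  then obtain K \<alpha> where K: "K > 0" and \<alpha>: "\<And>p. p \<in> ?P \<Longrightarrow>
      (\<integral>x. (\<psi> (fst p) (snd p) x - step K (\<alpha> p) x)\<^sup>2 \<partial>unit_lebesgue) \<le> 1 / N" by blast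
  obtain c :: "nat \<Rightarrow> bool list" where c: "inj_on c {..<2 ^ b}" "\<And>z. length (c z) = b"
    using finite_code_exists by blast
  obtain Q where Q: "\<And>D z j k. (\<forall>j k. z j k \<in> {..<2 ^ b}) \<Longrightarrow> j < J \<Longrightarrow> k \<in> {1..2 ^ j} \<Longrightarrow>
      Q (encode c J D z) j k = (if D j then dequantize n (z j k) else 0)"
    using decoder_exists[OF c, of J "dequantize n"] by blast
  have "(\<Sum>j<J. \<Sum>k=1..2^j. \<integral>x. (\<psi> j k x - step K (\<alpha> (j, k)) x)\<^sup>2 \<partial>unit_lebesgue) =
     (\<Sum>p\<in>?P. \<integral>x. (\<psi> (fst p) (snd p) x - step K (\<alpha> p) x)\<^sup>2 \<partial>unit_lebesgue)"
    by (simp add: sum.Sigma split_def)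
  also have "\<dots> \<le> (\<Sum>p\<in>?P. 1 / N)" by (intro sum_mono \<alpha>)
  also have "\<dots> = card ?P / N" by simp
  also have "\<dots> \<le> real (card ?P + 1) / N" using N by (intro divide_right_mono) auto
  also have "\<dots> = 1 / n"
  proof -
    have "real (card ?P + 1) \<noteq> 0" by linarith
    then show ?thesis unfolding N_def by simp
  qed
  finally have "wavelet_scheme \<psi> n m J b K (\<lambda>j k. \<alpha> (j, k)) c Q \<tau>"
    by unfold_locales (use assms K c Q in auto)
  then show ?thesis by blast
qed

section \<open>Adaptation over Besov balls\<close>

lemma geometric_sum_ge:
  fixes q :: real
  assumes T: "finite T" "\<And>j. j \<in> T \<Longrightarrow> j0 \<le> j" and q: "0 < q" "q < 1"
  shows "(\<Sum>j\<in>T. q ^ j) \<le> q ^ j0 / (1 - q)"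
proof -
  obtain N where N: "T \<subseteq> {j0..<j0 + N}"
  proof
    show "T \<subseteq> {j0..<j0 + (Suc (\<Sum>T) )}"
      using T member_le_sum[of _ T "\<lambda>j. j"] by (fastforce simp: less_Suc_eq_le intro: trans_le_add2)
  qed
  have "(\<Sum>j\<in>T. q ^ j) \<le> (\<Sum>j\<in>{j0..<j0 + N}. q ^ j)"
    using N q by (intro sum_mono2) auto
  also have "\<dots> = (\<Sum>i<N. q ^ (i + j0))"
    using sum.shift_bounds_nat_ivl[of "\<lambda>j. q ^ j" 0 j0 N] by (simp add: atLeast0LessThan add.commute)
  also have "\<dots> = q ^ j0 * ((1 - q ^ N) / (1 - q))"
    using q by (simp add: power_add sum_distrib_left[symmetric] mult.commute[of _ "q ^ j0"] sum_gp_strict)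
  also have "\<dots> \<le> q ^ j0 * (1 / (1 - q))"
    using q by (intro mult_left_mono divide_right_mono) auto
  finally show ?thesis by simp
qed

lemma (in wavelet_basis) besov_level_energy:
  assumes "f \<in> besov_ball \<psi> s L"
  shows "level_energy f j \<le> L\<^sup>2 * (2 powr (- 2 * s)) ^ j"
proof -
  have "ennreal (2 powr (2 * real j * s) * level_energy f j) \<le> besov_sqnorm \<psi> s f"
    unfolding besov_sqnorm_def by (rule SUP_upper) simp
  also have "\<dots> \<le> ennreal (L\<^sup>2)" using assms by (simp add: besov_ball_def less_imp_le)
  finally have "2 powr (2 * real j * s) * level_energy f j \<le> L\<^sup>2" by (simp add: ennreal_le_iff)
  then have "level_energy f j \<le> L\<^sup>2 / 2 powr (2 * real j * s)" by (simp add: field_simps)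
  also have "\<dots> = L\<^sup>2 * (2 powr (- 2 * s)) ^ j"
    by (simp add: powr_power powr_minus field_simps)
  finally show ?thesis .
qed

lemma pow_scale: "(2 powr (- 2 * s)) ^ j = (2 ^ j) powr (- (2 * s :: real))"
  by (simp add: powr_power powr_powr mult.commute flip: powr_realpow)

context wavelet_basis
begin

context
  fixes s1 s L :: real and f
  assumes s1: "0 < s1" "s1 \<le> s" and fb: "f \<in> besov_ball \<psi> s L"
begin

text \<open>A geometric series with ratio 2^(-2s). Its factor 1/(1 - 2^(-2s)) is replaced by the
  larger value at \<open>s1\<close>, to be uniform in s.\<close>

lemma besov_energy_sum:
  assumes T: "finite T" "\<And>j. j \<in> T \<Longrightarrow> j0 \<le> j"
  shows "(\<Sum>j\<in>T. level_energy f j) \<le> L\<^sup>2 / (1 - 2 powr (- 2 * s1)) * (2 ^ j0) powr (- (2 * s))"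
proof -
  let ?q = "2 powr (- 2 * s)"
  have q: "0 < ?q" "?q < 1" using s1 by (auto simp: powr_less_one)
  have q1: "2 powr (- 2 * s1) < (1 :: real)" using s1 by (auto simp: powr_less_one)
  have "?q \<le> 2 powr (- 2 * s1)" using s1 by (intro powr_mono) auto
  then have le: "1 / (1 - ?q) \<le> 1 / (1 - 2 powr (- 2 * s1))" using q q1 by (intro divide_left_mono) auto
  have "(\<Sum>j\<in>T. level_energy f j) \<le> (\<Sum>j\<in>T. L\<^sup>2 * ?q ^ j)"
    by (intro sum_mono besov_level_energy fb)
  also have "\<dots> \<le> L\<^sup>2 * (?q ^ j0 / (1 - ?q))"
    unfolding sum_distrib_left[symmetric] by (intro mult_left_mono geometric_sum_ge T q) auto
  also have "\<dots> = L\<^sup>2 * ?q ^ j0 * (1 / (1 - ?q))" by simp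
  also have "\<dots> \<le> L\<^sup>2 * ?q ^ j0 * (1 / (1 - 2 powr (- 2 * s1)))"
    using q by (intro mult_left_mono le) auto
  finally show ?thesis unfolding pow_scale by (simp add: mult_ac)
qed

lemma besov_norm_le: "(\<integral>x. (f x)\<^sup>2 \<partial>unit_lebesgue) \<le> 2 * (L\<^sup>2 / (1 - 2 powr (- 2 * s1)))"
proof (rule L2_norm_le_energy)
  show "f \<in> L2_unit" using fb by (simp add: besov_ball_def)
  show "(\<Sum>j<J. level_energy f j) \<le> L\<^sup>2 / (1 - 2 powr (- 2 * s1))" for J
    using besov_energy_sum[of "{..<J}" 0] by simp
qed

end

end

text \<open>At the critical resolution \<open>R = n powr (1 / (1 + 2 s))\<close> squared bias and variance balance:
  \<open>R powr (- 2 s) = R / n\<close>.\<close>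

lemma critical_resolution:
  fixes n s :: real
  assumes "n > 0" "s > 0"
  shows "(n powr (1 / (1 + 2 * s))) powr (- (2 * s)) = n powr (1 / (1 + 2 * s)) / n"
    and "n powr (1 / (1 + 2 * s)) / n = n powr (- (2 * s) / (1 + 2 * s))"
proof -
  have e: "1 / (1 + 2 * s) - 1 = - (2 * s) / (1 + 2 * s)" using assms by (simp add: field_simps)
  show 2: "n powr (1 / (1 + 2 * s)) / n = n powr (- (2 * s) / (1 + 2 * s))"
    unfolding e[symmetric] powr_diff using assms by simp
  show "(n powr (1 / (1 + 2 * s))) powr (- (2 * s)) = n powr (1 / (1 + 2 * s)) / n"
    unfolding 2 powr_powr by (simp add: field_simps)
qed

text \<open>The constant of the geometric series of level energies at the least smoothness; twice
  this value bounds the squared norm of the signal.\<close>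

definition adaptive_const :: "real \<Rightarrow> real \<Rightarrow> real" where
  "adaptive_const s1 L = L\<^sup>2 / (1 - 2 powr (- 2 * s1))"

text \<open>At a level with 2^j \<ge> R the Besov bound gives energy at most L^2 2^j / n, and
  discretization adds at most F / n, where F is twice \<open>adaptive_const\<close>. Twice their sum
  has to stay below half the threshold, hence 4 L^2 + 4 F; the last 1 ensures \<tau> \<ge> 1. The
  smoothness s does not enter.\<close>

definition adaptive_threshold :: "real \<Rightarrow> real \<Rightarrow> real" where
  "adaptive_threshold s1 L = 4 * L\<^sup>2 + 8 * adaptive_const s1 L + 1"

text \<open>The power of 16 pays for a finest level that lies up to a factor 16 below the critical
  resolution of \<open>s1\<close>.\<close>

definition adaptive_risk_const :: "real \<Rightarrow> real \<Rightarrow> real \<Rightarrow> real" where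
  "adaptive_risk_const s1 s2 L = (let F = 2 * adaptive_const s1 L; H = adaptive_const s1 L * 16 powr (2 * s2) in
     12 * ((385 + 128 * F\<^sup>2) + (8 + 4 * adaptive_threshold s1 L) + 2 * H + 2 * F + 2000) + 4 * F + 2 * H)"

lemma adaptive_const_nonneg: "s1 > 0 \<Longrightarrow> adaptive_const s1 L \<ge> 0"
  unfolding adaptive_const_def using powr_less_one[of 2 "- 2 * s1"] by (intro divide_nonneg_nonneg) auto

text \<open>Adaptation is visible in the order of quantifiers: the critical resolution R of the true
  smoothness appears only in the analysis, where it separates coarse from fine levels, and not in
  the encoder or decoder. The bound on \<open>J\<close> and \<open>m\<close> is required at
  \<open>s2\<close> only; 322 = 2 + 320.\<close>

lemma (in wavelet_basis) adaptive_scheme: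
  assumes s12: "0 < s1" "s1 < s2" and n: "n > 0" and m: "m > 0" "m \<le> n"
    and J: "2 ^ J \<le> n" "real n powr (1 / (1 + 2 * s1)) / 16 \<le> 2 ^ J"
    and b: "2 * n\<^sup>2 < 2 ^ b"
    and Jm: "real J * (real m)\<^sup>2 \<le> real n powr (1 / (1 + 2 * s2))"
  shows "\<exists>enc dec. distributed_estimator m enc dec \<and> (\<forall>i d. length (enc i d) \<le> J + b * (2 ^ J - 1)) \<and>
    (\<forall>(M :: 'w measure) W U s f. white_noise_model m M W U \<longrightarrow> s \<in> {s1..s2} \<longrightarrow> f \<in> besov_ball \<psi> s L \<longrightarrow>
       (\<forall>i\<in>{1..m}. expected_bits m n enc f M W U i \<le> ennreal (J + b * (322 * real n powr (1 / (1 + 2 * s))))) \<and>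
       risk m n enc dec f M W U \<le> ennreal (adaptive_risk_const s1 s2 L * real n powr (- (2 * s) / (1 + 2 * s))))"
proof -
  define Cs where "Cs = adaptive_const s1 L"
  define F where "F = 2 * Cs"
  define \<tau> where "\<tau> = adaptive_threshold s1 L"
  define H0 where "H0 = Cs * 16 powr (2 * s2)"
  have Cs0: "Cs \<ge> 0" unfolding Cs_def by (rule adaptive_const_nonneg[OF s12(1)])
  have \<tau>: "\<tau> \<ge> 1" using Cs0 by (simp add: \<tau>_def adaptive_threshold_def Cs_def)
  have \<tau>_eq: "\<tau> = 4 * L\<^sup>2 + 4 * F + 1" by (simp add: \<tau>_def adaptive_threshold_def Cs_def F_def)
  have "16 powr (2 * s2) \<ge> (16 powr 0 :: real)" using s12 by (intro powr_mono) auto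
  then have p16: "16 powr (2 * s2) \<ge> (1 :: real)" by simp
  have n0: "real n > 0" "real n \<ge> 1" using n by auto
  obtain K \<alpha> c Q where "wavelet_scheme \<psi> n m J b K \<alpha> c Q \<tau>"
    using wavelet_scheme_exists[OF n m J(1) b \<tau>] by blast
  then interpret sch: wavelet_scheme \<psi> n m J b K \<alpha> c Q \<tau> .
  have main: "(\<forall>i\<in>{1..m}. expected_bits m n sch.enc f M W U i \<le> ennreal (J + b * (322 * real n powr (1 / (1 + 2 * s))))) \<and>
       risk m n sch.enc sch.dec f M W U \<le> ennreal (adaptive_risk_const s1 s2 L * real n powr (- (2 * s) / (1 + 2 * s)))"
    if model: "white_noise_model m M W U" and s: "s \<in> {s1..s2}" and fb: "f \<in> besov_ball \<psi> s L"
    for M :: "'w measure" and W U s f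
  proof -
    define R where "R = real n powr (1 / (1 + 2 * s))"
    have ss: "s > 0" "s1 \<le> s" "s \<le> s2" using s s12 by auto
    have f: "f \<in> L2_unit" using fb by (simp add: besov_ball_def)
    note crit = critical_resolution[OF n0(1) ss(1), folded R_def]
    have R1: "R \<ge> 1" unfolding R_def using n0 ss by (intro ge_one_powr_ge_zero) auto
    have R0: "R \<ge> 0" using R1 by simp
    have norm: "(\<integral>x. (f x)\<^sup>2 \<partial>unit_lebesgue) \<le> F"
      unfolding F_def Cs_def adaptive_const_def by (rule besov_norm_le[OF s12(1) ss(2) fb])
    interpret run: wavelet_run \<psi> n m J b K \<alpha> c Q \<tau> M W U f F
      by unfold_locales (use model f norm in auto)
    \<comment> \<open>The critical resolution decreases in s, so the case \<open>s2\<close> is the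
      most demanding one.\<close>
    have JmR: "real J * (real m)\<^sup>2 \<le> R"
    proof -
      have "real n powr (1 / (1 + 2 * s2)) \<le> R"
        unfolding R_def using n0 ss by (intro powr_mono divide_left_mono) auto
      then show ?thesis using Jm by linarith
    qed
    have energy_sum: "(\<Sum>j\<in>T. level_energy f j) \<le> Cs * (2 ^ j0) powr (- (2 * s))"
      if "finite T" "\<And>j. j \<in> T \<Longrightarrow> j0 \<le> j" for T j0
      unfolding Cs_def adaptive_const_def by (rule besov_energy_sum[OF s12(1) ss(2) fb that])
    have powR: "(2 ^ j) powr (- (2 * s)) \<le> R / n" if "R \<le> 2 ^ j" for j :: nat
      unfolding crit(1)[symmetric] using that R1 ss by (intro powr_mono2') auto
    have high: "(\<Sum>k\<in>sch.S j. (run.g j k)\<^sup>2) \<le> \<tau> * 2 ^ j / (2 * n)" if j: "j < J" and Rj: "R \<le> 2 ^ j" for j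
    proof -
      have "level_energy f j \<le> L\<^sup>2 * (2 ^ j) powr (- (2 * s))"
        using besov_level_energy[OF fb, of j] by (simp only: pow_scale)
      also have "\<dots> \<le> L\<^sup>2 * (R / n)" by (intro mult_left_mono powR Rj) auto
      also have "\<dots> \<le> L\<^sup>2 * (2 ^ j / n)" using Rj n0 by (intro mult_left_mono divide_right_mono) auto
      finally have 1: "level_energy f j \<le> L\<^sup>2 * (2 ^ j / n)" .
      have F0: "F \<ge> 0" using Cs0 by (simp add: F_def)
      have "F / n \<le> F * (2 ^ j / n)" using F0 n0 by (simp add: divide_right_mono mult_le_cancel_left1)
      then have "(\<Sum>k\<in>sch.S j. (run.g j k)\<^sup>2) \<le> 2 * (L\<^sup>2 * (2 ^ j / n)) + 2 * (F * (2 ^ j / n))"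
        using run.level_bias[OF j] 1 by linarith
      also have "\<dots> = (4 * L\<^sup>2 + 4 * F) * 2 ^ j / (2 * n)" using n0 by (simp add: field_simps)
      also have "\<dots> \<le> \<tau> * 2 ^ j / (2 * n)" unfolding \<tau>_eq using n0 by (intro divide_right_mono mult_right_mono) auto
      finally show ?thesis .
    qed
    have H: "(\<Sum>j | j < J \<and> R \<le> 2 ^ j. level_energy f j) \<le> H0 * (R / n)"
    proof (cases "{j. j < J \<and> R \<le> 2 ^ j} = {}")
      case True
      then show ?thesis unfolding True H0_def using Cs0 R0 by simp
    next
      case False
      define j0 where "j0 = Min {j. j < J \<and> R \<le> 2 ^ j}"
      have j0: "j0 \<in> {j. j < J \<and> R \<le> 2 ^ j}" unfolding j0_def by (rule Min_in) (use False in auto)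
      have "(\<Sum>j | j < J \<and> R \<le> 2 ^ j. level_energy f j) \<le> Cs * (2 ^ j0) powr (- (2 * s))"
        by (rule energy_sum) (auto simp: j0_def)
      also have "\<dots> \<le> Cs * (R / n)" using j0 by (intro mult_left_mono powR Cs0) auto
      also have "\<dots> \<le> H0 * (R / n)" unfolding H0_def using Cs0 R0 p16
        by (intro mult_right_mono) (auto simp: mult_le_cancel_left1)
      finally show ?thesis .
    qed
    \<comment> \<open>The depth is tied to \<open>s1\<close>, whose critical resolution is the
      largest; truncation at \<open>J\<close> is therefore fine enough for every s, up to the factor
      16.\<close>
    have tail: "(\<Sum>j\<in>{J..<J'}. level_energy f j) \<le> H0 * (R / n)" for J'
    proof -
      have "R \<le> real n powr (1 / (1 + 2 * s1))"
        unfolding R_def using n0 ss s12 by (intro powr_mono divide_left_mono) auto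
      then have "R / 16 \<le> 2 ^ J" using J(2) by linarith
      then have "(2 ^ J) powr (- (2 * s)) \<le> (R / 16) powr (- (2 * s))"
        using R1 ss by (intro powr_mono2') auto
      also have "\<dots> = R powr (- (2 * s)) * 16 powr (2 * s)"
        using R1 by (simp add: powr_divide powr_minus field_simps)
      also have "\<dots> = R / n * 16 powr (2 * s)" by (simp only: crit(1))
      also have "\<dots> \<le> R / n * 16 powr (2 * s2)"
        using R0 ss by (intro mult_left_mono powr_mono) auto
      finally have "Cs * (2 ^ J) powr (- (2 * s)) \<le> Cs * (R / n * 16 powr (2 * s2))"
        by (intro mult_left_mono Cs0)
      moreover have "(\<Sum>j\<in>{J..<J'}. level_energy f j) \<le> Cs * (2 ^ J) powr (- (2 * s))"
        by (rule energy_sum) auto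
      ultimately show ?thesis by (simp add: H0_def mult_ac)
    qed
    have bits: "expected_bits m n sch.enc f M W U i \<le> ennreal (J + b * (322 * R))" if i: "i \<in> {1..m}" for i
    proof -
      have "expected_bits m n sch.enc f M W U i \<le> ennreal (J + b * (2 * R + 320 * (J * (real m)\<^sup>2)))"
        by (rule run.bits_bound[OF i R0 high])
      also have "\<dots> \<le> ennreal (J + b * (322 * R))"
        using JmR by (intro ennreal_leI add_left_mono mult_left_mono) auto
      finally show ?thesis .
    qed
    have "risk m n sch.enc sch.dec f M W U \<le> ennreal (12 * ((385 + 128 * F\<^sup>2) / n + (8 + 4 * \<tau>) * R / n + 2 * (H0 * (R / n))
     + 2 * F / n + 2000 * (J * (real m)\<^sup>2) / n) + 4 * F / n + 2 * (H0 * (R / n)))"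
      by (rule run.risk_bound[OF R0 high H tail])
    also have "\<dots> \<le> ennreal (12 * ((385 + 128 * F\<^sup>2) * (R / n) + (8 + 4 * \<tau>) * (R / n) + 2 * (H0 * (R / n))
     + (2 * F) * (R / n) + 2000 * (R / n)) + (4 * F) * (R / n) + 2 * (H0 * (R / n)))"
    proof -
      have le: "a / n \<le> a * (R / n)" if "a \<ge> 0" for a :: real
        using that R1 n0 by (simp add: divide_right_mono mult_le_cancel_left1)
      have F0: "F \<ge> 0" using Cs0 by (simp add: F_def)
      have e: "(8 + 4 * \<tau>) * R / n = (8 + 4 * \<tau>) * (R / n)" by simp
      have "2000 * (J * (real m)\<^sup>2) / n \<le> 2000 * R / n" using JmR n0 by (intro divide_right_mono) auto
      also have "\<dots> = 2000 * (R / n)" by simp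
      finally have Jb: "2000 * (J * (real m)\<^sup>2) / n \<le> 2000 * (R / n)" .
      show ?thesis unfolding e
        by (intro ennreal_leI add_mono mult_left_mono order_refl le Jb) (use F0 in auto)
    qed
    also have "12 * ((385 + 128 * F\<^sup>2) * (R / n) + (8 + 4 * \<tau>) * (R / n) + 2 * (H0 * (R / n))
     + (2 * F) * (R / n) + 2000 * (R / n)) + (4 * F) * (R / n) + 2 * (H0 * (R / n)) = adaptive_risk_const s1 s2 L * (R / n)"
    proof -
      have c: "adaptive_risk_const s1 s2 L = 12 * ((385 + 128 * F\<^sup>2) + (8 + 4 * \<tau>) + 2 * H0 + 2 * F + 2000) + 4 * F + 2 * H0"
        by (simp add: adaptive_risk_const_def Let_def F_def \<tau>_def H0_def Cs_def)
      show ?thesis unfolding c by (simp only: distrib_right distrib_left mult.assoc)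
    qed
    finally have "risk m n sch.enc sch.dec f M W U \<le>
        ennreal (adaptive_risk_const s1 s2 L * real n powr (- (2 * s) / (1 + 2 * s)))"
      by (simp only: crit(2))
    then show ?thesis using bits unfolding R_def by blast
  qed
  show ?thesis
    using sch.is_distributed_estimator sch.length_enc_le main by blast
qed

section \<open>Asymptotics\<close>

text \<open>Division by 8 leaves room in the strict length limit for about 5 log n bits per
  coefficient, and rounding down to a power of two costs another factor 2. For \<open>J = 0\<close>
  the value 2^0 may exceed x / 8, as \<open>nat\<close> cuts off negative logarithms; hence the
  condition in the second claim.\<close>

lemma dyadic_resolution:
  fixes x :: real
  assumes x: "x > 0"
  defines "J \<equiv> nat \<lfloor>log 2 (x / 8)\<rfloor>"
  shows "x / 16 \<le> 2 ^ J" "J > 0 \<Longrightarrow> 2 ^ J \<le> x / 8"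
proof -
  show "2 ^ J \<le> x / 8" if "J > 0"
  proof -
    have "real J \<le> log 2 (x / 8)" using that unfolding J_def by linarith
    then have "2 powr real J \<le> x / 8" using x by (subst (asm) le_log_iff) auto
    then show ?thesis by (simp add: powr_realpow)
  qed
  have "log 2 (x / 8) < real (Suc J)" unfolding J_def by linarith
  then have "x / 8 < 2 powr real (Suc J)" using x by (subst (asm) log_less_iff) auto
  then have "x / 8 < 2 ^ Suc J" by (simp only: powr_realpow zero_less_numeral)
  then show "x / 16 \<le> 2 ^ J" by simp
qed

lemma ennreal_ratio_le:
  assumes "x \<le> ennreal (a * y)" "a \<le> C" "0 \<le> C" "0 < y"
  shows "x / ennreal y \<le> ennreal C"
proof -
  have "x \<le> ennreal (C * y)"
    using assms by (intro order_trans[OF assms(1)] ennreal_leI mult_right_mono) auto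
  then have "x / ennreal y \<le> ennreal (C * y) / ennreal y" by (rule divide_right_mono_ennreal)
  also have "\<dots> = ennreal C" using assms by (simp add: divide_ennreal)
  finally show ?thesis .
qed

theorem corollary2p6:
  fixes L p s1 s2 :: real and m :: "nat \<Rightarrow> nat" and N :: nat
    and \<psi> :: "nat \<Rightarrow> nat \<Rightarrow> real \<Rightarrow> real"
  assumes "L > 0"
    and "0 < p" and "p \<le> 1 / 2"
    and "\<And>n. \<bar>real (m n) - real n powr p\<bar> < 1"
    and "\<forall>\<^sub>F n in sequentially. real (m n) \<ge> 5 * log 2 (real n)"
    and "0 < s1" and "s1 < s2" and "s2 < 1 / (4 * p) - 1 / 2"
    and "s2 < real N" and "cdv_wavelet_basis N \<psi>"
  shows "\<exists>(enc :: nat \<Rightarrow> nat \<Rightarrow> (real \<Rightarrow> real) \<times> real \<Rightarrow> bool list)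
          (dec :: nat \<Rightarrow> (nat \<Rightarrow> bool list) \<Rightarrow> real \<Rightarrow> real).
      (\<forall>n. distributed_estimator (m n) (enc n) (dec n)) \<and>
      (\<forall>n. \<forall>i\<in>{1..m n}. \<forall>d\<in>space data_space.
         real (length (enc n i d)) \<le> real n powr (1 / (1 + 2 * s1)) * log 2 (real n)) \<and>
      (\<exists>C>0. \<forall>\<^sub>F n in sequentially.
         \<forall>(M :: 'w measure) W U. white_noise_model (m n) M W U \<longrightarrow>
           (SUP i\<in>{1..m n}. SUP s\<in>{s1..s2}. SUP f\<in>besov_ball \<psi> s L.
              expected_bits (m n) n (enc n) f M W U i
                / ennreal (real n powr (1 / (1 + 2 * s)) * log 2 (real n))) \<le> ennreal C \<and>
           (SUP s\<in>{s1..s2}. SUP f\<in>besov_ball \<psi> s L.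
              risk (m n) n (enc n) (dec n) f M W U
                / ennreal (real n powr (- (2 * s) / (1 + 2 * s)))) \<le> ennreal C)"
proof -
  interpret wavelet_basis \<psi>
    by unfold_locales (use assms(10) in \<open>simp add: cdv_wavelet_basis_def\<close>)
  define X where "X n = real n powr (1 / (1 + 2 * s1))" for n
  define J where "J n = nat \<lfloor>log 2 (X n / 8)\<rfloor>" for n
  \<comment> \<open>The summand 2 gives \<open>2 ^ b n\<close> \<ge> 4 n^2, more than the number of
    codes needs, and still at most 5 log n bits for n \<ge> 2.\<close>
  define b where "b n = nat \<lceil>2 * log 2 (real n)\<rceil> + 2" for n
  \<comment> \<open>The requirements of \<open>adaptive_scheme\<close> hold only for large n,
    whereas an estimator within the length limit is demanded for every n.\<close>
  define good where "good n \<longleftrightarrow> n \<ge> 2 \<and> 0 < m n \<and> m n \<le> n \<and>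
    real (J n) * (real (m n))\<^sup>2 \<le> real n powr (1 / (1 + 2 * s2))" for n
  have X_le: "X n \<le> real n" if "n \<ge> 2" for n
    unfolding X_def using that assms(6) powr_mono[of "1 / (1 + 2 * s1)" 1 "real n"] by simp
  have J_lower: "X n / 16 \<le> 2 ^ J n" if "n \<ge> 2" for n
    unfolding J_def using that by (intro dyadic_resolution) (simp add: X_def)
  have J_upper: "2 ^ J n \<le> X n / 8" if "n \<ge> 2" "J n > 0" for n
    using that unfolding J_def by (intro dyadic_resolution) (simp_all add: X_def)
  have J_n: "2 ^ J n \<le> real n" if "n \<ge> 2" for n
  proof (cases "J n > 0")
    case True
    then show ?thesis using J_upper[OF that] X_le[OF that] by linarith
  next
    case False
    then show ?thesis using that by simp
  qed
  have log_ge: "log 2 (real n) \<ge> 1" if "n \<ge> 2" for n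
    using that by (simp add: le_log_iff)
  have J_log: "real (J n) \<le> log 2 (real n)" if "n \<ge> 2" for n
    using J_n[OF that] that by (simp add: le_log_iff powr_realpow)
  have b_upper: "real (b n) \<le> 5 * log 2 (real n)" if "n \<ge> 2" for n
    using log_ge[OF that] unfolding b_def by linarith
  have b_lower: "2 * n\<^sup>2 < 2 ^ b n" if "n \<ge> 2" for n
  proof -
    have "log 2 (real n) * 2 + 2 \<le> real (b n)" unfolding b_def by linarith
    then have "2 powr (log 2 (real n) * 2 + 2) \<le> 2 powr real (b n)" by (intro powr_mono) auto
    also have "\<dots> = 2 ^ b n" by (simp add: powr_realpow)
    also have "2 powr (log 2 (real n) * 2 + 2) = real (4 * n\<^sup>2)"
      using that by (simp add: powr_add powr_powr[symmetric])
    finally have "real (4 * n\<^sup>2) \<le> real (2 ^ b n)" by simp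
    then have "4 * n\<^sup>2 \<le> 2 ^ b n" by (simp only: of_nat_le_iff)
    moreover have "n\<^sup>2 > 0" using that by simp
    ultimately show ?thesis by linarith
  qed
  \<comment> \<open>The flags use at most X/8 and the coefficients at most 5/8 of X log n. Without
    any level the message is empty.\<close>
  have length_le: "real (J n + b n * (2 ^ J n - 1)) \<le> X n * log 2 (real n)" if n: "n \<ge> 2" for n
  proof (cases "J n = 0")
    case True
    then show ?thesis using log_ge[OF n] by (simp add: X_def)
  next
    case False
    then have U: "2 ^ J n \<le> X n / 8" using J_upper[OF n] by simp
    have "real (J n) \<le> 2 ^ J n" by (metis less_imp_le of_nat_le_iff of_nat_numeral of_nat_power less_exp)
    then have "real (J n) \<le> X n / 8" using U by linarith
    moreover have "real (b n * (2 ^ J n - 1)) \<le> 5 * log 2 (real n) * (X n / 8)"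
    proof -
      have "real (2 ^ J n - 1) \<le> X n / 8"
        using U by (simp add: of_nat_diff)
      then show ?thesis unfolding of_nat_mult using b_upper[OF n] log_ge[OF n] by (intro mult_mono) auto
    qed
    moreover have "X n \<le> X n * log 2 (real n)"
      using log_ge[OF n] mult_left_mono[of 1 "log 2 (real n)" "X n"] by (simp add: X_def)
    moreover have "X n \<ge> 0" by (simp add: X_def)
    moreover have "5 * log 2 (real n) * (X n / 8) = 5 / 8 * (X n * log 2 (real n))" by simp
    ultimately show ?thesis unfolding of_nat_add by linarith
  qed
  have "\<forall>n. \<exists>enc dec. distributed_estimator (m n) enc dec \<and>
     (\<forall>i d. real (length (enc i d :: bool list)) \<le> X n * log 2 (real n)) \<and>
     (good n \<longrightarrow> (\<forall>(M :: 'w measure) W U s f. white_noise_model (m n) M W U \<longrightarrow> s \<in> {s1..s2} \<longrightarrow> f \<in> besov_ball \<psi> s L \<longrightarrow>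
       (\<forall>i\<in>{1..m n}. expected_bits (m n) n enc f M W U i \<le> ennreal (J n + b n * (322 * real n powr (1 / (1 + 2 * s))))) \<and>
       risk (m n) n enc dec f M W U \<le> ennreal (adaptive_risk_const s1 s2 L * real n powr (- (2 * s) / (1 + 2 * s)))))"
    (is "\<forall>n. \<exists>enc dec. ?P n enc dec")
  proof
    fix n
    show "\<exists>enc dec. ?P n enc dec"
    proof (cases "good n")
      case True
      then have n: "n \<ge> 2" and m: "m n > 0" "m n \<le> n"
        and Jm: "real (J n) * (real (m n))\<^sup>2 \<le> real n powr (1 / (1 + 2 * s2))" by (auto simp: good_def)
      have n0: "n > 0" using n by simp
      have "real (2 ^ J n) \<le> real n" using J_n[OF n] by simp
      then have Jn: "2 ^ J n \<le> n" by (simp only: of_nat_le_iff)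
      obtain enc dec where ed: "distributed_estimator (m n) enc dec"
        "\<And>i d. length (enc i d) \<le> J n + b n * (2 ^ J n - 1)"
        "\<forall>(M :: 'w measure) W U s f. white_noise_model (m n) M W U \<longrightarrow> s \<in> {s1..s2} \<longrightarrow> f \<in> besov_ball \<psi> s L \<longrightarrow>
       (\<forall>i\<in>{1..m n}. expected_bits (m n) n enc f M W U i \<le> ennreal (J n + b n * (322 * real n powr (1 / (1 + 2 * s))))) \<and>
       risk (m n) n enc dec f M W U \<le> ennreal (adaptive_risk_const s1 s2 L * real n powr (- (2 * s) / (1 + 2 * s)))"
        using adaptive_scheme[OF assms(6,7) n0 m Jn J_lower[OF n, unfolded X_def] b_lower[OF n] Jm] by blast
      have "real (length (enc i d)) \<le> X n * log 2 (real n)" for i d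
        using ed(2)[of i d] length_le[OF n] of_nat_le_iff order_trans by blast
      then show ?thesis using ed(1,3) by blast
    \<comment> \<open>For the remaining n all messages are empty and the estimate is zero; the
      length limit is nonnegative even at n = 0 and n = 1.\<close>
    next
      case False
      have "distributed_estimator (m n) (\<lambda>_ _. []) (\<lambda>_ _. 0)"
        unfolding distributed_estimator_def by (simp add: const_L2_unit)
      moreover have "0 \<le> X n * log 2 (real n)"
        by (cases "n = 0") (auto simp: X_def)
      ultimately show ?thesis using False by (intro exI[of _ "\<lambda>_ _. []"] exI[of _ "\<lambda>_ _. 0"]) simp
    qed
  qed
  then obtain enc dec where ed: "\<And>n. ?P n (enc n) (dec n)" by metis
  \<comment> \<open>1611 = 1 + 5 * 322: one log n for the flags and 5 log n bits for each of the
    expected 322 R coefficients.\<close>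
  define C where "C = max 1611 (adaptive_risk_const s1 s2 L)"
  have C: "C > 0" "1611 \<le> C" "adaptive_risk_const s1 s2 L \<le> C" by (auto simp: C_def)
  \<comment> \<open>Positivity of this gap is the assumption on \<open>s2\<close> in another form.
    The gain n^\<delta> absorbs 4 log n, where log n bounds the number of levels and 4 comes from
    squaring m \<le> 2 n^p.\<close>
  define \<delta> where "\<delta> = 1 / (1 + 2 * s2) - 2 * p"
  have \<delta>: "\<delta> > 0"
  proof -
    have "(1 + 2 * s2) * (2 * p) < 1" using assms(2,8) by (simp add: field_simps)
    then show ?thesis using assms(6,7) by (simp add: \<delta>_def field_simps)
  qed
  have "\<forall>\<^sub>F n in sequentially. 4 * log 2 (real n) \<le> real n powr \<delta>"
    using \<delta> by real_asymp
  then have good: "\<forall>\<^sub>F n in sequentially. good n"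
    \<comment> \<open>From n = 4 on, 2 sqrt n \<le> n, which with p \<le> 1/2 yields m \<le>
      n.\<close>
    using eventually_ge_at_top[of 4]
  proof eventually_elim
    case (elim n)
    have n1: "real n \<ge> 1" using elim by simp
    have np: "real n powr p \<ge> 1" using n1 assms(2) by (intro ge_one_powr_ge_zero) auto
    have m0: "real (m n) > 0" using assms(4)[of n] np by linarith
    \<comment> \<open>The rounding error is below 1, hence below n^p.\<close>
    have m2: "real (m n) \<le> 2 * real n powr p" using assms(4)[of n] np by linarith
    have "real n powr p \<le> real n powr (1/2)" using n1 assms(3) by (intro powr_mono) auto
    also have "\<dots> = sqrt (real n)" by (simp add: powr_half_sqrt)
    finally have np2: "real n powr p \<le> sqrt (real n)" .
    have "2 \<le> sqrt (real n)" using elim by (intro real_le_rsqrt) simp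
    then have "2 * sqrt (real n) \<le> sqrt (real n) * sqrt (real n)" by (intro mult_right_mono) auto
    then have "2 * real n powr p \<le> real n" using np2 by simp
    then have mn: "m n \<le> n" using m2 by linarith
    have "real (J n) * (real (m n))\<^sup>2 \<le> log 2 (real n) * (2 * real n powr p)\<^sup>2"
      using elim m2 by (intro mult_mono J_log power_mono) auto
    also have "\<dots> = 4 * log 2 (real n) * real n powr (2 * p)"
    proof -
      have "(real n powr p)\<^sup>2 = real n powr (2 * p)" by (simp only: power2_eq_square mult_2 powr_add)
      then show ?thesis by (simp only: power_mult_distrib) simp
    qed
    also have "\<dots> \<le> real n powr \<delta> * real n powr (2 * p)"
      using elim by (intro mult_right_mono) auto
    also have "\<dots> = real n powr (1 / (1 + 2 * s2))" by (simp add: \<delta>_def flip: powr_add)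
    finally show ?case using elim m0 mn by (simp add: good_def)
  qed
  have "\<forall>\<^sub>F n in sequentially.
         \<forall>(M :: 'w measure) W U. white_noise_model (m n) M W U \<longrightarrow>
           (SUP i\<in>{1..m n}. SUP s\<in>{s1..s2}. SUP f\<in>besov_ball \<psi> s L.
              expected_bits (m n) n (enc n) f M W U i
                / ennreal (real n powr (1 / (1 + 2 * s)) * log 2 (real n))) \<le> ennreal C \<and>
           (SUP s\<in>{s1..s2}. SUP f\<in>besov_ball \<psi> s L.
              risk (m n) n (enc n) (dec n) f M W U
                / ennreal (real n powr (- (2 * s) / (1 + 2 * s)))) \<le> ennreal C"
    using good
  proof eventually_elim
    case (elim n)
    then have n: "n \<ge> 2" by (simp add: good_def)
    have bits: "expected_bits (m n) n (enc n) f M W U i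
         / ennreal (real n powr (1 / (1 + 2 * s)) * log 2 (real n)) \<le> ennreal C"
      if "white_noise_model (m n) M W U" "i \<in> {1..m n}" "s \<in> {s1..s2}" "f \<in> besov_ball \<psi> s L"
      for M :: "'w measure" and W U i s f
    proof (rule ennreal_ratio_le)
      let ?R = "real n powr (1 / (1 + 2 * s))"
      have s: "s > 0" using that assms(6) by auto
      have R1: "?R \<ge> 1" using n s by (intro ge_one_powr_ge_zero) auto
      have l: "log 2 (real n) \<ge> 1" by (rule log_ge[OF n])
      have "expected_bits (m n) n (enc n) f M W U i \<le> ennreal (J n + b n * (322 * ?R))"
        using ed[of n] elim that by blast
      also have "\<dots> \<le> ennreal (1611 * (?R * log 2 (real n)))"
      proof (rule ennreal_leI)
        have "real (J n) \<le> 1 * log 2 (real n)" using J_log[OF n] by simp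
        also have "\<dots> \<le> ?R * log 2 (real n)" using R1 l by (intro mult_right_mono) auto
        finally have 1: "real (J n) \<le> ?R * log 2 (real n)" .
        have "real (b n) * (322 * ?R) \<le> 5 * log 2 (real n) * (322 * ?R)"
          using b_upper[OF n] by (intro mult_right_mono) auto
        also have "\<dots> = 1610 * (?R * log 2 (real n))" by simp
        finally show "J n + b n * (322 * ?R) \<le> 1611 * (?R * log 2 (real n))" using 1 by linarith
      qed
      finally show "expected_bits (m n) n (enc n) f M W U i \<le> ennreal (1611 * (?R * log 2 (real n)))" .
      show "0 < ?R * log 2 (real n)" using R1 l by (intro mult_pos_pos) linarith+
    qed (use C in auto)
    have risk: "risk (m n) n (enc n) (dec n) f M W U
         / ennreal (real n powr (- (2 * s) / (1 + 2 * s))) \<le> ennreal C"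
      if "white_noise_model (m n) M W U" "s \<in> {s1..s2}" "f \<in> besov_ball \<psi> s L"
      for M :: "'w measure" and W U s f
    proof (rule ennreal_ratio_le)
      show "risk (m n) n (enc n) (dec n) f M W U \<le>
          ennreal (adaptive_risk_const s1 s2 L * real n powr (- (2 * s) / (1 + 2 * s)))"
        using ed[of n] elim that by blast
    qed (use C n in auto)
    show ?case
      by (intro allI impI conjI SUP_least bits risk)
  qed
  moreover have "\<forall>n. distributed_estimator (m n) (enc n) (dec n)" using ed by blast
  moreover have "\<forall>n. \<forall>i\<in>{1..m n}. \<forall>d\<in>space data_space.
         real (length (enc n i d)) \<le> real n powr (1 / (1 + 2 * s1)) * log 2 (real n)"
    using ed unfolding X_def by blast
  ultimately show ?thesis using C(1) by blast
qed

end
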